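(* There exists an algorithm that, given a graph $G$, an integer $r\in\mathbb{N}$, and a linear ordering $L$ of $V(G)$, computes a set of unordered pairs $F\subseteq\binom{V(G)}{2}$ such that the graph $T=(V(G),F)$ is a tree of maximum degree at most $3$ and \[\mathrm{adm}_r(G+F,L)\le 2+2\cdot\mathrm{col}_{2r}(G,L),\] where $G+F=(V(G),E(G)\cup F)$. The running time of the algorithm is $\mathcal{O}((n+m)\cdot\alpha(m))$, where $n=|V(G)|$, $m=|E(G)|$ and $\alpha$ is the inverse Ackermann function.
   Context: For a linear ordering $L$ of $V(G)$ write $u<_L v$ if $u$ precedes $v$, and $u\le_L v$ if $u<_L v$ or $u=v$. A vertex $u$ is strongly $r$-reachable from $v$ w.r.t. $L$ if $u\le_L v$ and there is a path of length at most $r$ from $v$ to $u$ all of whose internal vertices are larger than $v$ in $L$; $\mathrm{SReach}_r[G,L,v]$ is the set of such $u$ (it contains $v$), and $\mathrm{col}_r(G,L)=\max_{v}|\mathrm{SReach}_r[G,L,v]|$. The $r$-admissibility $\mathrm{adm}_r[G,L,v]$ of $v$ is the maximum size of a family of paths, each of length at most $r$, starting at $v$, each either the trivial path or ending in a vertex $u<_L v$ with all internal vertices larger than $v$ in $L$, and pairwise vertex-disjoint apart from the common start $v$; $\mathrm{adm}_r(G,L)=\max_v\mathrm{adm}_r[G,L,v]$. The inverse Ackermann function $\alpha$ is the inverse of $n\mapsto A(n,n)$ with $A(0,n)=n+1$, $A(m,0)=A(m-1,1)$, $A(m,n)=A(m-1,A(m,n-1))$. *)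

theory Defs
  imports Main
begin

section \<open>Finite simple graphs\<close>

text \<open>A graph is given by its vertex set and its set of edges, an edge being a
  two-element set of vertices.\<close>

definition all_pairs :: "'a set \<Rightarrow> 'a set set" where
  "all_pairs V = {e. e \<subseteq> V \<and> card e = 2}"

definition simple_graph :: "'a set \<Rightarrow> 'a set set \<Rightarrow> bool" where
  "simple_graph V E \<longleftrightarrow> finite V \<and> V \<noteq> {} \<and> E \<subseteq> all_pairs V"

definition is_path :: "'a set \<Rightarrow> 'a set set \<Rightarrow> 'a list \<Rightarrow> bool" where
  "is_path V E p \<longleftrightarrow> p \<noteq> [] \<and> set p \<subseteq> V \<and> distinct p \<and>
     (\<forall>i. Suc i < length p \<longrightarrow> {p ! i, p ! Suc i} \<in> E)"

definition path_length :: "'a list \<Rightarrow> nat" where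
  "path_length p = length p - 1"

definition internal_vertices :: "'a list \<Rightarrow> 'a set" where
  "internal_vertices p = set (butlast (tl p))"

definition connected_graph :: "'a set \<Rightarrow> 'a set set \<Rightarrow> bool" where
  "connected_graph V E \<longleftrightarrow>
     V \<noteq> {} \<and> (\<forall>u\<in>V. \<forall>v\<in>V. \<exists>p. is_path V E p \<and> hd p = u \<and> last p = v)"

definition acyclic_graph :: "'a set \<Rightarrow> 'a set set \<Rightarrow> bool" where
  "acyclic_graph V E \<longleftrightarrow> \<not> (\<exists>p. is_path V E p \<and> 3 \<le> length p \<and> {last p, hd p} \<in> E)"

definition tree_graph :: "'a set \<Rightarrow> 'a set set \<Rightarrow> bool" where
  "tree_graph V E \<longleftrightarrow> simple_graph V E \<and> connected_graph V E \<and> acyclic_graph V E"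

definition max_degree :: "'a set \<Rightarrow> 'a set set \<Rightarrow> nat" where
  "max_degree V E = Max ((\<lambda>v. card {e \<in> E. v \<in> e}) ` V)"

section \<open>Strong colouring numbers and admissibility\<close>

text \<open>A linear ordering \<open>L\<close> of \<open>V\<close> is a reflexive relation with \<open>linear_order_on V L\<close>;
  \<open>(u, v) \<in> L\<close> is \<open>u \<le>\<^sub>L v\<close>.\<close>

definition less_L :: "'a rel \<Rightarrow> 'a \<Rightarrow> 'a \<Rightarrow> bool" where
  "less_L L u v \<longleftrightarrow> (u, v) \<in> L \<and> u \<noteq> v"

definition SReach :: "nat \<Rightarrow> 'a set \<Rightarrow> 'a set set \<Rightarrow> 'a rel \<Rightarrow> 'a \<Rightarrow> 'a set" where
  "SReach r V E L v = {u. (u, v) \<in> L \<and>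
     (\<exists>p. is_path V E p \<and> hd p = v \<and> last p = u \<and> path_length p \<le> r \<and>
          (\<forall>w \<in> internal_vertices p. less_L L v w))}"

definition col :: "nat \<Rightarrow> 'a set \<Rightarrow> 'a set set \<Rightarrow> 'a rel \<Rightarrow> nat" where
  "col r V E L = Max ((\<lambda>v. card (SReach r V E L v)) ` V)"

definition adm_family ::
  "nat \<Rightarrow> 'a set \<Rightarrow> 'a set set \<Rightarrow> 'a rel \<Rightarrow> 'a \<Rightarrow> 'a list set \<Rightarrow> bool" where
  "adm_family r V E L v P \<longleftrightarrow>
     (\<forall>p\<in>P. is_path V E p \<and> hd p = v \<and> path_length p \<le> r \<and>
        (p = [v] \<or> less_L L (last p) v \<and> (\<forall>w \<in> internal_vertices p. less_L L v w))) \<and>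
     (\<forall>p\<in>P. \<forall>q\<in>P. p \<noteq> q \<longrightarrow> set p \<inter> set q = {v})"

definition adm_at :: "nat \<Rightarrow> 'a set \<Rightarrow> 'a set set \<Rightarrow> 'a rel \<Rightarrow> 'a \<Rightarrow> nat" where
  "adm_at r V E L v = Max (card ` {P. adm_family r V E L v P})"

definition adm :: "nat \<Rightarrow> 'a set \<Rightarrow> 'a set set \<Rightarrow> 'a rel \<Rightarrow> nat" where
  "adm r V E L = Max (adm_at r V E L ` V)"

section \<open>The inverse Ackermann function\<close>

fun ack :: "nat \<Rightarrow> nat \<Rightarrow> nat" where
  "ack 0 n = n + 1"
| "ack (Suc m) 0 = ack m 1"
| "ack (Suc m) (Suc n) = ack m (ack (Suc m) n)"

text \<open>The restriction \<open>1 \<le> k\<close> only changes the values at \<open>0\<close> and \<open>1\<close>, from \<open>0\<close> to \<open>1\<close>: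
  a time bound \<open>O((n + m) \<sqdot> \<alpha>(m))\<close> would otherwise forbid any computation when \<open>m \<le> 1\<close>.\<close>

definition inv_ack :: "nat \<Rightarrow> nat" where
  "inv_ack m = (LEAST k. 1 \<le> k \<and> m \<le> ack k k)"

section \<open>A word RAM\<close>

text \<open>Structured programs over finitely many registers (a program mentions only finitely many)
  and a random access memory. Every assignment, store and test takes one time unit.
  The parameter \<open>B\<close> of the semantics is the largest number that fits into a machine word;
  an assignment whose result exceeds \<open>B\<close> blocks the execution, so a terminating execution
  is free of overflow, and all addresses it uses are at most \<open>B\<close>.\<close>

type_synonym reg = nat
type_synonym state = "(reg \<Rightarrow> nat) \<times> (nat \<Rightarrow> nat)"

datatype rhs =
    Const nat
  | Copy reg
  | Add reg reg
  | Sub reg reg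
  | Mul reg reg
  | Load reg

datatype test = Less reg reg | Eq reg reg | Neq reg reg

datatype com =
    Skip
  | Assign reg rhs
  | Store reg reg
  | Seq com com
  | If test com com
  | While test com

fun rhs_val :: "rhs \<Rightarrow> state \<Rightarrow> nat" where
  "rhs_val (Const k) (R, M) = k"
| "rhs_val (Copy x) (R, M) = R x"
| "rhs_val (Add x y) (R, M) = R x + R y"
| "rhs_val (Sub x y) (R, M) = R x - R y"
| "rhs_val (Mul x y) (R, M) = R x * R y"
| "rhs_val (Load x) (R, M) = M (R x)"

fun test_val :: "test \<Rightarrow> state \<Rightarrow> bool" where
  "test_val (Less x y) (R, M) \<longleftrightarrow> R x < R y"
| "test_val (Eq x y) (R, M) \<longleftrightarrow> R x = R y"
| "test_val (Neq x y) (R, M) \<longleftrightarrow> R x \<noteq> R y"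

text \<open>\<open>exec B c s t s'\<close>: started in \<open>s\<close>, the program \<open>c\<close> halts in \<open>s'\<close> after \<open>t\<close> time units.\<close>

inductive exec :: "nat \<Rightarrow> com \<Rightarrow> state \<Rightarrow> nat \<Rightarrow> state \<Rightarrow> bool" for B :: nat where
  Skip: "exec B Skip s 1 s"
| Assign: "rhs_val e (R, M) \<le> B \<Longrightarrow>
    exec B (Assign x e) (R, M) 1 (R(x := rhs_val e (R, M)), M)"
| Store: "exec B (Store x y) (R, M) 1 (R, M(R x := R y))"
| Seq: "exec B c1 s t1 s' \<Longrightarrow> exec B c2 s' t2 s'' \<Longrightarrow> exec B (Seq c1 c2) s (t1 + t2) s''"
| IfTrue: "test_val b s \<Longrightarrow> exec B c1 s t s' \<Longrightarrow> exec B (If b c1 c2) s (1 + t) s'"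
| IfFalse: "\<not> test_val b s \<Longrightarrow> exec B c2 s t s' \<Longrightarrow> exec B (If b c1 c2) s (1 + t) s'"
| WhileFalse: "\<not> test_val b s \<Longrightarrow> exec B (While b c) s 1 s"
| WhileTrue: "test_val b s \<Longrightarrow> exec B c s t1 s' \<Longrightarrow> exec B (While b c) s' t2 s'' \<Longrightarrow>
    exec B (While b c) s (1 + t1 + t2) s''"

inductive_cases SkipE: "exec B Skip s t s'"
inductive_cases AssignE: "exec B (Assign x e) s t s'"
inductive_cases StoreE: "exec B (Store x y) s t s'"
inductive_cases SeqE: "exec B (Seq c1 c2) s t s'"
inductive_cases IfE: "exec B (If b c1 c2) s t s'"
inductive_cases WhileE: "exec B (While b c) s t s'"

lemma exec_deterministic:
  "exec B c s t s' \<Longrightarrow> exec B c s u s'' \<Longrightarrow> t = u \<and> s' = s''"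
proof (induction arbitrary: u s'' rule: exec.induct)
  case (Skip s)
  then show ?case by (auto elim: SkipE)
next
  case (Assign e R M x)
  then show ?case by (auto elim: AssignE)
next
  case (Store x y R M)
  then show ?case by (auto elim: StoreE)
next
  case (Seq c1 s t1 s' c2 t2 s2)
  from Seq.prems show ?case
    by (rule SeqE) (metis Seq.IH)
next
  case (IfTrue b s c1 t s' c2)
  from IfTrue.prems show ?case
    by (rule IfE) (metis IfTrue.IH plus_1_eq_Suc, metis IfTrue.hyps(1))
next
  case (IfFalse b s c2 t s' c1)
  from IfFalse.prems show ?case
    by (rule IfE) (metis IfFalse.hyps(1), metis IfFalse.IH plus_1_eq_Suc)
next
  case (WhileFalse b s c)
  from WhileFalse.prems show ?case
    by (rule WhileE) (simp, metis WhileFalse.hyps(1))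
next
  case (WhileTrue b s c t1 s' t2 s2)
  from WhileTrue.prems show ?case
    by (rule WhileE) (metis WhileTrue.hyps(1), metis WhileTrue.IH plus_1_eq_Suc add_Suc)
qed

section \<open>Input and output conventions\<close>

text \<open>The vertices of an input graph are \<open>0, \<dots>, n - 1\<close>. The input consists of \<open>n\<close>, \<open>m\<close>, \<open>r\<close>,
  then the vertices in increasing order with respect to \<open>L\<close>, then the two ends of each edge,
  every edge being listed once, in an arbitrary order and orientation.\<close>

definition edge_of :: "'a \<times> 'a \<Rightarrow> 'a set" where
  "edge_of e = {fst e, snd e}"

definition lists_order :: "'a list \<Rightarrow> 'a set \<Rightarrow> 'a rel \<Rightarrow> bool" where
  "lists_order vs V L \<longleftrightarrow> set vs = V \<and> sorted_wrt (less_L L) vs"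

definition lists_edges :: "('a \<times> 'a) list \<Rightarrow> 'a set set \<Rightarrow> bool" where
  "lists_edges es E \<longleftrightarrow> distinct (map edge_of es) \<and> edge_of ` set es = E"

definition encodes_input ::
  "nat list \<Rightarrow> nat \<Rightarrow> nat set set \<Rightarrow> nat \<Rightarrow> nat rel \<Rightarrow> bool" where
  "encodes_input ws n E r L \<longleftrightarrow>
     (\<exists>vs es. lists_order vs {..<n} L \<and> lists_edges es E \<and>
        ws = [n, length es, r] @ vs @ concat (map (\<lambda>(u, v). [u, v]) es))"

definition init_state :: "nat list \<Rightarrow> state" where
  "init_state ws = ((\<lambda>_. 0), (\<lambda>a. if a < length ws then ws ! a else 0))"

text \<open>The output is the number \<open>k\<close> of computed pairs in cell \<open>0\<close>, followed by the ends of
  these pairs.\<close>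

definition output_pairs :: "state \<Rightarrow> nat set set" where
  "output_pairs s = (let M = snd s in {{M (2 * i + 1), M (2 * i + 2)} | i. i < M 0})"

end

theory Submission
  imports Defs
begin

text \<open>
  Let \<open>U\<close> be the spanning forest of \<open>G\<close> that Kruskal's algorithm produces when the vertices are
  inserted in decreasing order: when \<open>u\<close> is inserted, it is joined to one neighbour in every
  component of \<open>G[{w. w > u}]\<close> adjacent to \<open>u\<close>. So every component of \<open>G[{w. w > u}]\<close> contains at
  most one larger \<open>U\<close>-neighbour of \<open>u\<close>. Root \<open>U\<close>; the tree \<open>F\<close> is its left-child right-sibling
  representation, where the roots count as siblings.

  A path of length \<open>r\<close> in \<open>G + F\<close> turns into a walk of length \<open>2r\<close> in \<open>G\<close> by rerouting every
  sibling edge through the common parent. In a family of paths witnessing the admissibility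
  of \<open>v\<close>, at most one is trivial and at most two start with a sibling edge. Any other path has
  a tag: it ends in some \<open>u\<close> strongly \<open>2r\<close>-reachable from \<open>v\<close>, or it leaves the component of \<open>v\<close>
  in \<open>G[{w. w \<ge> v}]\<close> by a sibling edge whose parent \<open>u < v\<close> is strongly \<open>2r\<close>-reachable, at the
  unique child of \<open>u\<close> in that component, or it passes through the unique root in the
  component of \<open>v\<close> in \<open>G\<close>. As the paths are disjoint, no tag occurs twice, so there are at most
  \<open>1 + 2 + 2 (|SReach| - 1) + 1\<close> paths.

  The components are maintained by union-find with linking by rank and path compression,
  whose amortised cost is bounded by a potential built on the Ackermann function.
\<close>

section \<open>Admissibility of a linked graph\<close>

text \<open>Decreasing insertion matters because every edge of \<open>G[{w. w > u}]\<close> has been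
  examined when \<open>u\<close> arrives: each component there is already connected in
  \<open>U\<close>, and a second edge from \<open>u\<close> into it would close a cycle. First-child
  edges of \<open>F\<close> belong to \<open>U\<close>, hence to \<open>G\<close>, so only sibling
  edges can create new short connections. A vertex meets at most two of them, and its own parent
  edge or first child brings the degree to at most 3. The obstacle on the time side is that
  \<open>\<alpha>\<close> is taken at \<open>m\<close> and not at \<open>n\<close>. Ranks are
  bounded by one plus the number of incidences scanned so far, hence by \<open>2m + 1\<close>. This
  is far from the logarithmic bound on ranks, but the Ackermann function absorbs the difference, and
  \<open>K = \<alpha>(m) + 4\<close> levels suffice for the potential.\<close>

definition adj_on :: "'a set \<Rightarrow> 'a set set \<Rightarrow> 'a rel" where
  "adj_on W E = {(a, b). a \<in> W \<and> b \<in> W \<and> {a, b} \<in> E}"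

lemma adj_on_sym: "sym (adj_on W E)"
  by (auto simp: adj_on_def sym_def insert_commute)

lemma adj_on_rtrancl_commute: "(a, b) \<in> (adj_on W E)\<^sup>* \<Longrightarrow> (b, a) \<in> (adj_on W E)\<^sup>*"
  using sym_rtrancl[OF adj_on_sym] by (metis symD)

lemma adj_on_mono: "W \<subseteq> W' \<Longrightarrow> E \<subseteq> E' \<Longrightarrow> adj_on W E \<subseteq> adj_on W' E'"
  by (auto simp: adj_on_def)

lemma is_path_append_left: "is_path V E (xs @ ys) \<Longrightarrow> xs \<noteq> [] \<Longrightarrow> is_path V E xs"
  unfolding is_path_def
proof (intro conjI allI impI; (elim conjE)?)
  fix i assume "\<forall>i. Suc i < length (xs @ ys) \<longrightarrow> {(xs @ ys) ! i, (xs @ ys) ! Suc i} \<in> E"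
    and i: "Suc i < length xs"
  then have "{(xs @ ys) ! i, (xs @ ys) ! Suc i} \<in> E" by simp
  then show "{xs ! i, xs ! Suc i} \<in> E" using i by (simp add: nth_append)
qed auto

lemma is_path_snoc:
  assumes "is_path V E p" "{last p, y} \<in> E" "y \<in> V" "y \<notin> set p"
  shows "is_path V E (p @ [y])"
  unfolding is_path_def
proof (intro conjI allI impI)
  fix i assume i: "Suc i < length (p @ [y])"
  have p: "p \<noteq> []" using assms(1) by (simp add: is_path_def)
  show "{(p @ [y]) ! i, (p @ [y]) ! Suc i} \<in> E"
  proof (cases "Suc i < length p")
    case True
    then show ?thesis using assms(1) by (simp add: is_path_def nth_append)
  next
    case False
    then have "i = length p - 1" "Suc i = length p" using i p by auto
    then show ?thesis using assms(2) p by (simp add: nth_append last_conv_nth)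
  qed
qed (use assms in \<open>auto simp: is_path_def\<close>)

lemma is_path_rtrancl:
  assumes "is_path V E p" "set p \<subseteq> W"
  shows "(hd p, last p) \<in> (adj_on W E)\<^sup>*"
proof -
  have "i < length p \<Longrightarrow> (p ! 0, p ! i) \<in> (adj_on W E)\<^sup>*" for i
  proof (induction i)
    case (Suc i)
    then have "(p ! i, p ! Suc i) \<in> adj_on W E"
      using assms by (auto simp: is_path_def adj_on_def dest: nth_mem)
    with Suc show ?case by (meson Suc_lessD rtrancl.rtrancl_into_rtrancl)
  qed simp
  from this[of "length p - 1"] show ?thesis
    using assms by (simp add: is_path_def hd_conv_nth last_conv_nth)
qed

text \<open>Isolates what the counting needs. \<open>B\<close> stands for the sibling edges alone;
  \<open>B_cases\<close> asks for a common \<open>U\<close>-neighbour, so no rooting of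
  \<open>U\<close> appears. \<open>U_unique\<close> is the gain of the decreasing insertion order,
  \<open>Rt_unique\<close> that of one root per component.\<close>

locale linked_graph =
  fixes V :: "'a set" and E :: "'a set set" and L :: "'a rel"
    and U B :: "'a set set" and Rt :: "'a set"
  assumes graph: "simple_graph V E"
    and order: "linear_order_on V L"
    and U_sub: "U \<subseteq> E"
    and B_cases: "{x, y} \<in> B \<Longrightarrow> (\<exists>u. {u, x} \<in> U \<and> {u, y} \<in> U) \<or> x \<in> Rt \<and> y \<in> Rt"
    and B_finite: "finite B"
    and B_deg: "card {e \<in> B. v \<in> e} \<le> 2"
    and U_unique: "{u, a} \<in> U \<Longrightarrow> {u, b} \<in> U \<Longrightarrow> less_L L u a \<Longrightarrow> less_L L u b \<Longrightarrow>
      (a, b) \<in> (adj_on {w. less_L L u w} E)\<^sup>* \<Longrightarrow> a = b"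
    and Rt_unique: "a \<in> Rt \<Longrightarrow> b \<in> Rt \<Longrightarrow> (a, b) \<in> (adj_on UNIV E)\<^sup>* \<Longrightarrow> a = b"
begin

lemma edge_V: "{x, y} \<in> E \<Longrightarrow> x \<in> V \<and> y \<in> V"
  using graph by (auto simp: simple_graph_def all_pairs_def)

lemma order_total: "x \<in> V \<Longrightarrow> y \<in> V \<Longrightarrow> (x, y) \<in> L \<or> less_L L y x"
  using order
  by (metis linear_order_on_def partial_order_on_def preorder_on_def refl_onD total_on_def less_L_def)

lemma order_trans: "(x, y) \<in> L \<Longrightarrow> (y, z) \<in> L \<Longrightarrow> (x, z) \<in> L"
  using order by (meson linear_order_on_def partial_order_on_def preorder_on_def transD)

lemma order_antisym: "(x, y) \<in> L \<Longrightarrow> (y, x) \<in> L \<Longrightarrow> x = y"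
  using order by (meson linear_order_on_def partial_order_on_def antisymD)

lemma order_refl: "x \<in> V \<Longrightarrow> (x, x) \<in> L"
  using order by (meson linear_order_on_def partial_order_on_def preorder_on_def refl_onD)

section \<open>Reachability among the vertices not below \<open>v\<close>\<close>

definition up :: "'a \<Rightarrow> 'a set" where
  "up v = {w \<in> V. (v, w) \<in> L}"

text \<open>Kept as a simple path because \<open>SReach\<close> demands one; the bound
  \<open>l\<close> is the budget that rerouting spends.\<close>

definition reach :: "'a \<Rightarrow> nat \<Rightarrow> 'a \<Rightarrow> bool" where
  "reach v l x \<longleftrightarrow> (\<exists>p. is_path V E p \<and> hd p = v \<and> last p = x \<and> path_length p \<le> l \<and> set p \<subseteq> up v)"

lemma reach_mono: "reach v l x \<Longrightarrow> l \<le> l' \<Longrightarrow> reach v l' x"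
  unfolding reach_def by (elim exE conjE) (intro exI conjI, assumption+, rule le_trans)

lemma reach_refl: "v \<in> V \<Longrightarrow> reach v 0 v"
  unfolding reach_def
  by (rule exI[of _ "[v]"]) (auto simp: is_path_def path_length_def up_def order_refl)

lemma reach_up: "reach v l x \<Longrightarrow> x \<in> up v"
  unfolding reach_def is_path_def by (metis in_mono last_in_set)

lemma reach_rtrancl: "reach v l x \<Longrightarrow> (v, x) \<in> (adj_on (up v) E)\<^sup>*"
  unfolding reach_def using is_path_rtrancl by blast

text \<open>If \<open>y\<close> is already on the path, the path is cut there instead of extended,
  so it stays simple and within the length bound.\<close>

lemma reach_step:
  assumes "reach v l x" "{x, y} \<in> E" "y \<in> up v"
  shows "reach v (Suc l) y"
proof -
  obtain p where p: "is_path V E p" "hd p = v" "last p = x" "path_length p \<le> l" "set p \<subseteq> up v"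
    using assms(1) unfolding reach_def by blast
  have ne: "p \<noteq> []" using p(1) by (simp add: is_path_def)
  show ?thesis
  proof (cases "y \<in> set p")
    case True
    then obtain xs ys where s: "p = xs @ y # ys" by (meson split_list)
    have "is_path V E (xs @ [y])"
      using is_path_append_left[of V E "xs @ [y]" ys] p(1) s by simp
    moreover have "hd (xs @ [y]) = v" using p(2) s by (cases xs) auto
    moreover have "path_length (xs @ [y]) \<le> Suc l" using p(4) s by (simp add: path_length_def)
    ultimately show ?thesis unfolding reach_def using p(5) s
      by (intro exI[of _ "xs @ [y]"]) auto
  next
    case False
    then have "is_path V E (p @ [y])"
      using is_path_snoc p(1,3) assms(2) edge_V by metis
    then show ?thesis unfolding reach_def using p ne assms(3)
      by (intro exI[of _ "p @ [y]"]) (auto simp: path_length_def)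
  qed
qed

text \<open>The end \<open>u\<close> lies below \<open>v\<close> and so off the path; since the path
  is simple and starts at \<open>v\<close>, its other vertices are strictly above \<open>v\<close>,
  as internal vertices must be.\<close>

lemma reach_SReach:
  assumes "reach v l x" "{x, u} \<in> E" "less_L L u v" "Suc l \<le> k"
  shows "u \<in> SReach k V E L v"
proof -
  obtain p where p: "is_path V E p" "hd p = v" "last p = x" "path_length p \<le> l" "set p \<subseteq> up v"
    using assms(1) unfolding reach_def by blast
  have ne: "p \<noteq> []" using p(1) by (simp add: is_path_def)
  have u: "u \<notin> set p"
    using p(5) assms(3) order_antisym by (auto simp: up_def less_L_def)
  have path: "is_path V E (p @ [u])"
    using is_path_snoc p(1,3) assms(2) edge_V u by metis
  have "v \<notin> set (tl p)" using p(1,2) by (cases p) (auto simp: is_path_def)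
  then have "\<forall>w \<in> internal_vertices (p @ [u]). less_L L v w"
    using p(5) ne by (cases p) (auto simp: internal_vertices_def up_def less_L_def)
  moreover have "path_length (p @ [u]) \<le> k"
    using p(4) ne assms(4) by (cases p) (auto simp: path_length_def)
  ultimately show ?thesis
    using path p(2) ne assms(3) unfolding SReach_def less_L_def
    by (auto intro!: exI[of _ "p @ [u]"])
qed

section \<open>Tags that tell the paths of an admissible family apart\<close>

datatype 'b tag = End_at 'b | Through 'b | At_root

text \<open>In every case the tag points to a vertex of \<open>p\<close> other than
  \<open>v\<close>. Paths of a family share only \<open>v\<close>, so such a vertex identifies its
  path. \<open>Through u\<close> asks for \<open>u < v\<close> so that all of \<open>up v\<close>
  lies in \<open>{w. less_L L u w}\<close>, where \<open>U_unique\<close> applies.\<close>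

definition tagged :: "nat \<Rightarrow> 'a \<Rightarrow> 'a list \<Rightarrow> 'a tag \<Rightarrow> bool" where
  "tagged k v p t \<longleftrightarrow> (case t of
     End_at u \<Rightarrow> u \<in> SReach k V E L v - {v} \<and> u \<in> set p
   | Through u \<Rightarrow> u \<in> SReach k V E L v - {v} \<and> less_L L u v \<and>
       (\<exists>a. a \<in> set p \<and> a \<noteq> v \<and> {u, a} \<in> U \<and> (v, a) \<in> (adj_on (up v) E)\<^sup>* \<and> a \<in> up v)
   | At_root \<Rightarrow> (\<exists>a. a \<in> set p \<and> a \<noteq> v \<and> a \<in> Rt \<and> (v, a) \<in> (adj_on UNIV E)\<^sup>*))"

text \<open>Every edge of \<open>B\<close> between siblings is rerouted through the common parent, which doubles
  the length at most; the first parent below \<open>v\<close> or root edge met on the way is the tag.\<close>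

lemma ex_tagged:
  assumes p: "is_path V (E \<union> B) p" "hd p = v" "path_length p \<le> r" "p \<noteq> [v]"
    "less_L L (last p) v" "\<forall>w \<in> internal_vertices p. less_L L v w"
    and nb: "{p ! 0, p ! 1} \<notin> B"
  shows "\<exists>t. tagged (2 * r) v p t"
proof (rule ccontr)
  assume no: "\<nexists>t. tagged (2 * r) v p t"
  have ne: "p \<noteq> []" and dist: "distinct p" and pV: "set p \<subseteq> V"
    and edge: "\<And>i. Suc i < length p \<Longrightarrow> {p ! i, p ! Suc i} \<in> E \<union> B"
    using p(1) by (auto simp: is_path_def)
  have p0: "p ! 0 = v" using p(2) ne by (simp add: hd_conv_nth)
  have vV: "v \<in> V" using p(2) ne pV by auto
  have len: "length p \<le> Suc r" using p(3) by (simp add: path_length_def)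
  have internal: "less_L L v (p ! i)" if "0 < i" "Suc i < length p" for i
  proof -
    have "p ! i = butlast (tl p) ! (i - 1)" "i - 1 < length (butlast (tl p))"
      using that by (auto simp: nth_butlast nth_tl)
    then show ?thesis using p(6) nth_mem unfolding internal_vertices_def by metis
  qed
  \<comment> \<open>Without a tag the path can never drop below \<open>v\<close>: vertex
    \<open>j\<close> is reached inside \<open>up v\<close> in at most \<open>2 * j\<close> steps,
    which for the last vertex contradicts \<open>less_L L (last p) v\<close>.\<close>
  have "j < length p \<Longrightarrow> reach v (2 * j) (p ! j)" for j
  proof (induction j)
    case 0
    then show ?case using p0 vV reach_refl by simp
  next
    case (Suc j)
    let ?x = "p ! j" and ?y = "p ! Suc j"
    have x: "reach v (2 * j) ?x" using Suc by simp
    have jr: "Suc j \<le> r" using Suc.prems len by simp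
    have yV: "?y \<in> V" "?y \<in> set p" using Suc.prems pV nth_mem by auto
    have xs: "?x \<in> set p" using Suc.prems by simp
    have vy: "(v, ?y) \<in> L \<Longrightarrow> ?y \<in> up v" using yV by (simp add: up_def)
    \<comment> \<open>\<open>l\<close> is \<open>2 * j\<close> for an edge of \<open>E\<close> and
      \<open>2 * j + 1\<close> after a detour through the common neighbour; one more edge still fits
      into \<open>2 * r\<close>, because \<open>Suc j \<le> r\<close>.\<close>
    have step: "reach v (2 * Suc j) ?y" if z: "reach v l z" "{z, ?y} \<in> E" "l \<le> 2 * j + 1" for l z
    proof (cases "(v, ?y) \<in> L")
      case True
      then show ?thesis using reach_step[OF z(1,2) vy] reach_mono z(3) by fastforce
    next
      case False
      then have *: "less_L L ?y v" using order_total[OF vV yV(1)] by blast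
      then have "?y \<in> SReach (2 * r) V E L v" using reach_SReach[OF z(1,2) *] z(3) jr by simp
      then have "tagged (2 * r) v p (End_at ?y)"
        using * yV by (auto simp: tagged_def less_L_def)
      then show ?thesis using no by blast
    qed
    show ?case
    proof (cases "{?x, ?y} \<in> E")
      case True
      then show ?thesis using step[OF x] by simp
    next
      case False
      then have b: "{?x, ?y} \<in> B" using edge[OF Suc.prems] by blast
      \<comment> \<open>The first edge is not in \<open>B\<close>, so the current vertex differs
        from \<open>v\<close> and can witness a tag.\<close>
      then have j: "j \<noteq> 0" using nb by (cases j) auto
      then have xv: "?x \<noteq> v" using p0 dist Suc.prems
        nth_eq_iff_index_eq[of p j 0] by force
      from B_cases[OF b] show ?thesis
      proof (elim disjE exE conjE)
        fix u assume u: "{u, ?x} \<in> U" "{u, ?y} \<in> U"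
        then have uE: "{?x, u} \<in> E" "{u, ?y} \<in> E" using U_sub by (auto simp: insert_commute)
        show ?thesis
        proof (cases "(v, u) \<in> L")
          case True
          then have "u \<in> up v" using edge_V[OF uE(1)] by (simp add: up_def)
          then show ?thesis using step[OF reach_step[OF x uE(1)] uE(2)] by simp
        next
          case False
          then have *: "less_L L u v" using order_total[OF vV] edge_V[OF uE(1)] by blast
          then have "u \<in> SReach (2 * r) V E L v" using reach_SReach[OF x uE(1) *] jr by simp
          then have "tagged (2 * r) v p (Through u)"
            using * xs xv u reach_rtrancl[OF x] reach_up[OF x] unfolding tagged_def
            by (auto simp: less_L_def)
          then show ?thesis using no by blast
        qed
      next
        assume "?x \<in> Rt" "?y \<in> Rt"
        moreover have "(v, ?x) \<in> (adj_on UNIV E)\<^sup>*"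
          using reach_rtrancl[OF x] rtrancl_mono[OF adj_on_mono[of "up v" UNIV E E]] by auto
        ultimately have "tagged (2 * r) v p At_root" using xs xv by (auto simp: tagged_def)
        then show ?thesis using no by blast
      qed
    qed
  qed
  from this[of "length p - 1"] have "last p \<in> up v"
    using reach_up ne by (simp add: last_conv_nth)
  then show False using p(5) order_antisym by (auto simp: up_def less_L_def)
qed

text \<open>Equal tags make the witnessing vertices equal: at once for \<open>End_at\<close>, by
  \<open>U_unique\<close> for \<open>Through\<close>, by \<open>Rt_unique\<close> for
  \<open>At_root\<close>. A common vertex other than \<open>v\<close> forces equal paths.\<close>

lemma tagged_unique:
  assumes t: "tagged k v p t" "tagged k v q t"
    and disj: "p \<noteq> q \<Longrightarrow> set p \<inter> set q = {v}"
  shows "p = q"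
proof (cases t)
  case (End_at u)
  then show ?thesis using t disj by (auto simp: tagged_def)
next
  case (Through u)
  then obtain a b where u: "less_L L u v"
    and a: "a \<in> set p" "a \<noteq> v" "{u, a} \<in> U" "(v, a) \<in> (adj_on (up v) E)\<^sup>*" "a \<in> up v"
    and b: "b \<in> set q" "b \<noteq> v" "{u, b} \<in> U" "(v, b) \<in> (adj_on (up v) E)\<^sup>*" "b \<in> up v"
    using t by (auto simp: tagged_def)
  have up: "up v \<subseteq> {w. less_L L u w}"
    using u order_trans order_antisym by (auto simp: up_def less_L_def)
  have "(a, b) \<in> (adj_on (up v) E)\<^sup>*"
    using adj_on_rtrancl_commute[OF a(4)] b(4) by (rule rtrancl_trans)
  then have "(a, b) \<in> (adj_on {w. less_L L u w} E)\<^sup>*"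
    using rtrancl_mono[OF adj_on_mono[OF up order.refl]] by blast
  then have "a = b" using U_unique a b up by blast
  then show ?thesis using a b disj by blast
next
  case At_root
  then obtain a b where a: "a \<in> set p" "a \<noteq> v" "a \<in> Rt" "(v, a) \<in> (adj_on UNIV E)\<^sup>*"
    and b: "b \<in> set q" "b \<noteq> v" "b \<in> Rt" "(v, b) \<in> (adj_on UNIV E)\<^sup>*"
    using t by (auto simp: tagged_def)
  have "(a, b) \<in> (adj_on UNIV E)\<^sup>*"
    using adj_on_rtrancl_commute[OF a(4)] b(4) by (rule rtrancl_trans)
  then have "a = b" using Rt_unique a b by blast
  then show ?thesis using a b disj by blast
qed

lemma SReach_subset: "SReach k V E L v \<subseteq> V"
  unfolding SReach_def is_path_def by (auto dest: last_in_set)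

lemma self_SReach: "v \<in> V \<Longrightarrow> v \<in> SReach k V E L v"
  unfolding SReach_def
  by (auto intro!: exI[of _ "[v]"] simp: order_refl is_path_def path_length_def internal_vertices_def)

lemma adm_family_card:
  assumes fam: "adm_family r V (E \<union> B) L v P" and v: "v \<in> V"
  shows "card P \<le> 2 + 2 * card (SReach (2 * r) V E L v)"
proof -
  let ?S = "SReach (2 * r) V E L v"
  have finS: "finite ?S"
    using SReach_subset graph by (metis finite_subset simple_graph_def)
  have P: "\<And>p. p \<in> P \<Longrightarrow> is_path V (E \<union> B) p \<and> hd p = v \<and> path_length p \<le> r \<and>
        (p = [v] \<or> less_L L (last p) v \<and> (\<forall>w \<in> internal_vertices p. less_L L v w))"
    and disj: "\<And>p q. p \<in> P \<Longrightarrow> q \<in> P \<Longrightarrow> p \<noteq> q \<Longrightarrow> set p \<inter> set q = {v}"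
    using fam unfolding adm_family_def by blast+
  define P1 where "P1 = {p \<in> P. p \<noteq> [v] \<and> {p ! 0, p ! 1} \<in> B}"
  define P2 where "P2 = {p \<in> P. p \<noteq> [v] \<and> {p ! 0, p ! 1} \<notin> B}"
  have len: "1 < length p \<and> p ! 0 = v \<and> p ! 1 \<noteq> v" if "p \<in> P" "p \<noteq> [v]" for p
  proof -
    have p: "p \<noteq> []" "hd p = v" "distinct p" using P[OF that(1)] by (auto simp: is_path_def)
    show ?thesis
    proof (cases "tl p")
      case Nil
      then show ?thesis using p that(2) by (cases p) auto
    next
      case (Cons y ys)
      then show ?thesis using p by (cases p) auto
    qed
  qed
  \<comment> \<open>Disjoint paths have different second vertices, so those starting with a sibling
    edge are counted by these edges.\<close>
  have "card P1 \<le> card {e \<in> B. v \<in> e}"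
  proof (rule card_inj_on_le[of "\<lambda>p. {p ! 0, p ! 1}"])
    show "inj_on (\<lambda>p. {p ! 0, p ! 1}) P1"
    proof (rule inj_onI)
      fix p q assume *: "p \<in> P1" "q \<in> P1" and eq: "{p ! 0, p ! 1} = {q ! 0, q ! 1}"
      have p: "p \<in> P" "p \<noteq> [v]" and q: "q \<in> P" "q \<noteq> [v]" using * by (auto simp: P1_def)
      have "p ! 1 = q ! 1" using len[OF p] len[OF q] eq by (auto simp: doubleton_eq_iff)
      then have "p ! 1 \<in> set p \<inter> set q" "p ! 1 \<noteq> v"
        using len[OF p] len[OF q] nth_mem[of 1 p] nth_mem[of 1 q] by simp_all
      then show "p = q" using disj[OF p(1) q(1)] by blast
    qed
    show "(\<lambda>p. {p ! 0, p ! 1}) ` P1 \<subseteq> {e \<in> B. v \<in> e}"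
    proof
      fix e assume "e \<in> (\<lambda>p. {p ! 0, p ! 1}) ` P1"
      then obtain p where "p \<in> P" "p \<noteq> [v]" "{p ! 0, p ! 1} \<in> B" "e = {p ! 0, p ! 1}"
        unfolding P1_def by blast
      then show "e \<in> {e \<in> B. v \<in> e}" using len[of p] by simp
    qed
  qed (use B_finite in simp)
  then have c1: "card P1 \<le> 2" using B_deg[of v] by linarith
  define tg where "tg p = (SOME t. tagged (2 * r) v p t)" for p
  have tg: "tagged (2 * r) v p (tg p)" if "p \<in> P2" for p
  proof -
    have "p \<in> P" "p \<noteq> [v]" "{p ! 0, p ! 1} \<notin> B" using that by (auto simp: P2_def)
    then have "\<exists>t. tagged (2 * r) v p t" using P[of p] by (intro ex_tagged) auto
    then show ?thesis unfolding tg_def by (rule someI_ex)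
  qed
  \<comment> \<open>These are at most \<open>2 * card ?S - 1\<close> tags; the trivial path and two
    sibling edges add 3, which gives \<open>2 + 2 * card ?S\<close>.\<close>
  let ?T = "insert At_root (End_at ` (?S - {v}) \<union> Through ` (?S - {v}))"
  have "card P2 \<le> card ?T"
  proof (rule card_inj_on_le[of tg])
    show "inj_on tg P2"
    proof (rule inj_onI)
      fix p q assume *: "p \<in> P2" "q \<in> P2" and eq: "tg p = tg q"
      then have "p \<in> P" "q \<in> P" by (auto simp: P2_def)
      then show "p = q" using tagged_unique[OF tg[OF *(1)]] tg[OF *(2)] eq disj by simp
    qed
    show "tg ` P2 \<subseteq> ?T"
    proof
      fix t assume "t \<in> tg ` P2"
      then obtain p where "tagged (2 * r) v p t" using tg by blast
      then show "t \<in> ?T" by (cases t) (auto simp: tagged_def)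
    qed
  qed (use finS in auto)
  also have "card ?T \<le> Suc (card (End_at ` (?S - {v}) \<union> Through ` (?S - {v})))"
    by (rule card_insert_le_m1) (auto)
  also have "\<dots> \<le> Suc (card (?S - {v}) + card (?S - {v}))"
    using card_Un_le[of "End_at ` (?S - {v})" "Through ` (?S - {v})"]
      card_image_le[of "?S - {v}" End_at] card_image_le[of "?S - {v}" Through] finS by auto
  finally have c2: "card P2 \<le> 2 * card (?S - {v}) + 1" by simp
  have "card ?S = Suc (card (?S - {v}))"
    using card.remove[OF finS self_SReach[OF v]] .
  moreover have "P \<subseteq> {[v]} \<union> (P1 \<union> P2)" unfolding P1_def P2_def by blast
  moreover have "finite P"
  proof (rule finite_subset)
    show "P \<subseteq> {p. set p \<subseteq> V \<and> length p \<le> Suc r}"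
    proof
      fix p assume "p \<in> P"
      from P[OF this] show "p \<in> {p. set p \<subseteq> V \<and> length p \<le> Suc r}"
        by (auto simp: is_path_def path_length_def)
    qed
    show "finite {p. set p \<subseteq> V \<and> length p \<le> Suc r}"
      using graph finite_lists_length_le by (auto simp: simple_graph_def)
  qed
  ultimately have "card P \<le> card ({[v]} \<union> (P1 \<union> P2))"
    by (intro card_mono) (auto simp: P1_def P2_def)
  also have "\<dots> \<le> 1 + (card P1 + card P2)"
    using card_Un_le[of "{[v]}" "P1 \<union> P2"] card_Un_le[of P1 P2] by simp
  finally show ?thesis using c1 c2 \<open>card ?S = _\<close> by linarith
qed

lemma adm_le_col: "adm r V (E \<union> B) L \<le> 2 + 2 * col (2 * r) V E L"
proof -
  have V: "finite V" "V \<noteq> {}" using graph by (auto simp: simple_graph_def)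
  have "adm_at r V (E \<union> B) L v \<le> 2 + 2 * col (2 * r) V E L" if v: "v \<in> V" for v
  proof -
    let ?A = "{P. adm_family r V (E \<union> B) L v P}"
    have "?A \<subseteq> Pow {p. set p \<subseteq> V \<and> length p \<le> Suc r}"
      by (auto simp: adm_family_def is_path_def path_length_def)
    moreover have "finite {p. set p \<subseteq> V \<and> length p \<le> Suc r}"
      using V finite_lists_length_le by auto
    ultimately have "finite ?A" by (meson finite_Pow_iff finite_subset)
    moreover have "{} \<in> ?A" by (simp add: adm_family_def)
    moreover have "card (SReach (2 * r) V E L v) \<le> col (2 * r) V E L"
      unfolding col_def using V v by (intro Max_ge) auto
    then have "card P \<le> 2 + 2 * col (2 * r) V E L" if "P \<in> ?A" for P
      using adm_family_card[of r v P] that v by auto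
    ultimately show ?thesis unfolding adm_at_def by (subst Max_le_iff) auto
  qed
  then show ?thesis unfolding adm_def using V by (subst Max_le_iff) auto
qed

end

section \<open>Trees built by adding leaves\<close>

lemma is_path_mono: "is_path V E p \<Longrightarrow> V \<subseteq> V' \<Longrightarrow> E \<subseteq> E' \<Longrightarrow> is_path V' E' p"
  unfolding is_path_def by blast

lemma is_path_rev: "is_path V E p \<Longrightarrow> is_path V E (rev p)"
  unfolding is_path_def
proof (intro conjI allI impI; (elim conjE)?)
  fix i assume e: "\<forall>i. Suc i < length p \<longrightarrow> {p ! i, p ! Suc i} \<in> E" and i: "Suc i < length (rev p)"
  let ?j = "length p - Suc (Suc i)"
  have "Suc ?j < length p" "length p - Suc i = Suc ?j" using i by auto
  then show "{rev p ! i, rev p ! Suc i} \<in> E"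
    using e i by (simp add: rev_nth insert_commute)
qed auto

text \<open>The new vertex \<open>w\<close> has \<open>x\<close> as its only neighbour, while a
  vertex of a cycle has two. As a cycle is given as a path with adjacent ends, \<open>w\<close> may
  stand at its start, at its end or in between.\<close>

lemma acyclic_add_leaf:
  assumes ac: "acyclic_graph V F" and F: "F \<subseteq> all_pairs V" and w: "w \<notin> V" and x: "x \<in> V"
  shows "acyclic_graph (insert w V) (insert {w, x} F)"
  unfolding acyclic_graph_def
proof (rule notI, elim exE conjE)
  fix p assume p: "is_path (insert w V) (insert {w, x} F) p" "3 \<le> length p"
    "{last p, hd p} \<in> insert {w, x} F"
  have d: "distinct p" and ne: "p \<noteq> []"
    and e: "\<And>i. Suc i < length p \<Longrightarrow> {p ! i, p ! Suc i} \<in> insert {w, x} F"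
    using p(1) by (auto simp: is_path_def)
  have nb: "b = x" if "{w, b} \<in> insert {w, x} F" for b
    using that F w by (auto simp: all_pairs_def doubleton_eq_iff)
  have nb': "b = x" if "{b, w} \<in> insert {w, x} F" for b
    using nb[of b] that by (simp add: insert_commute)
  show False
  proof (cases "w \<in> set p")
    case True
    then obtain i where i: "i < length p" "p ! i = w" by (meson in_set_conv_nth)
    let ?l = "length p - 1"
    have cyc: "{p ! ?l, p ! 0} \<in> insert {w, x} F"
      using p(3) ne by (simp add: last_conv_nth hd_conv_nth)
    consider "i = 0" | "i = ?l" "i \<noteq> 0" | "0 < i" "Suc i < length p" using i by linarith
    then show False
    proof cases
      case 1
      then have "p ! 1 = x" "p ! ?l = x" using e[of 0] cyc i nb nb' p(2) by auto
      then show False using d p(2) nth_eq_iff_index_eq[of p 1 ?l] ne by (simp add: length_greater_0_conv)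
    next
      case 2
      have s: "Suc (?l - 1) = ?l" using p(2) by simp
      then have "p ! (?l - 1) = x" "p ! 0 = x" using e[of "?l - 1"] cyc i 2 nb nb' p(2) by auto
      then show False using d p(2) nth_eq_iff_index_eq[of p "?l - 1" 0] ne by (simp add: length_greater_0_conv)
    next
      case 3
      then have "p ! (i - 1) = x" "p ! Suc i = x" using e[of "i - 1"] e[of i] i nb nb' by auto
      then show False using d 3 nth_eq_iff_index_eq[of p "i - 1" "Suc i"] by (simp add: less_imp_diff_less)
    qed
  next
    case False
    have *: "f \<in> F" if "f \<in> insert {w, x} F" "w \<notin> f" for f using that by blast
    have "is_path V F p"
      unfolding is_path_def
    proof (intro conjI allI impI)
      fix i assume i: "Suc i < length p"
      then have "p ! i \<noteq> w" "p ! Suc i \<noteq> w" using False by (metis Suc_lessD nth_mem)+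
      then show "{p ! i, p ! Suc i} \<in> F" using e[OF i] by (intro *) auto
    qed (use p(1) False in \<open>auto simp: is_path_def\<close>)
    moreover have "hd p \<noteq> w" "last p \<noteq> w" using False ne by auto
    then have "{last p, hd p} \<in> F" using p(3) by (intro *) auto
    ultimately show False using ac p(2) by (auto simp: acyclic_graph_def)
  qed
qed

lemma tree_add_leaf:
  assumes tr: "tree_graph V F" and w: "w \<notin> V" and x: "x \<in> V"
  shows "tree_graph (insert w V) (insert {w, x} F)"
proof -
  let ?V = "insert w V" and ?F = "insert {w, x} F"
  have F: "F \<subseteq> all_pairs V" and fin: "finite V" and con: "connected_graph V F"
    using tr by (auto simp: tree_graph_def simple_graph_def)
  have "simple_graph ?V ?F"
    using F fin w x unfolding simple_graph_def all_pairs_def by (auto simp: card_insert_if)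
  moreover have "acyclic_graph ?V ?F"
    using acyclic_add_leaf[OF _ F w x] tr by (simp add: tree_graph_def)
  moreover have "connected_graph ?V ?F"
  proof -
    have old: "\<exists>p. is_path V F p \<and> hd p = u \<and> last p = v" if "u \<in> V" "v \<in> V" for u v
      using con that by (simp add: connected_graph_def)
    have up: "\<exists>p. is_path ?V ?F p \<and> hd p = u \<and> last p = w" if u: "u \<in> V" for u
    proof -
      obtain p where p: "is_path V F p" "hd p = u" "last p = x" using old[OF u x] by blast
      then have "p \<noteq> []" "w \<notin> set p" using w by (auto simp: is_path_def)
      moreover have "is_path ?V ?F (p @ [w])"
        using p \<open>w \<notin> set p\<close> is_path_mono[of V F p ?V ?F] by (intro is_path_snoc) (auto simp: insert_commute)
      ultimately show ?thesis using p by (intro exI[of _ "p @ [w]"]) auto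
    qed
    have "\<exists>p. is_path ?V ?F p \<and> hd p = u \<and> last p = v" if "u \<in> ?V" "v \<in> ?V" for u v
    proof (cases "u = w"; cases "v = w")
      assume "u = w" "v = w"
      then show ?thesis by (intro exI[of _ "[w]"]) (auto simp: is_path_def)
    next
      assume "u = w" "v \<noteq> w"
      then obtain p where "is_path ?V ?F p" "hd p = v" "last p = w" using up[of v] \<open>v \<in> ?V\<close> by blast
      then show ?thesis using \<open>u = w\<close> is_path_rev
        by (intro exI[of _ "rev p"]) (auto simp: hd_rev last_rev)
    next
      assume "u \<noteq> w" "v = w"
      then show ?thesis using up[of u] \<open>u \<in> ?V\<close> by blast
    next
      assume "u \<noteq> w" "v \<noteq> w"
      then have "u \<in> V" "v \<in> V" using that by auto
      then show ?thesis using old is_path_mono[of V F _ ?V ?F] by (meson subset_insertI)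
    qed
    then show ?thesis by (auto simp: connected_graph_def)
  qed
  ultimately show ?thesis by (simp add: tree_graph_def)
qed

text \<open>The form in which the search delivers a tree: each position after the first brings one
  pair, joining a new vertex to an earlier one, and so adds a leaf.\<close>

lemma tree_attach:
  fixes q a :: "nat \<Rightarrow> 'a"
  assumes "inj_on q {..<n}" "\<And>i. 0 < i \<Longrightarrow> i < n \<Longrightarrow> a i \<in> q ` {..<i}" "0 < n"
  shows "tree_graph (q ` {..<n}) ((\<lambda>i. {q i, a i}) ` {0<..<n})"
  using assms
proof (induction n)
  case (Suc n)
  show ?case
  proof (cases "n = 0")
    case True
    moreover have "{0<..<Suc 0} = ({} :: nat set)" by auto
    moreover have "is_path {x} {} [x]" for x :: 'a by (simp add: is_path_def)
    then have "tree_graph {q 0} {}"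
      unfolding tree_graph_def simple_graph_def connected_graph_def acyclic_graph_def
      by (auto simp: intro!: exI[of _ "[q 0]"])
    ultimately show ?thesis by (simp add: lessThan_Suc)
  next
    case False
    have IH: "tree_graph (q ` {..<n}) ((\<lambda>i. {q i, a i}) ` {0<..<n})"
      using Suc.prems False by (intro Suc.IH) (auto simp: inj_on_def)
    have "q n \<notin> q ` {..<n}" using Suc.prems(1) by (simp add: lessThan_Suc)
    moreover have "a n \<in> q ` {..<n}" using Suc.prems(2) False by auto
    moreover have "{0<..<Suc n} = insert n {0<..<n}" using False by auto
    ultimately show ?thesis using tree_add_leaf[OF IH] by (simp add: lessThan_Suc)
  qed
qed simp

section \<open>The Ackermann function and union-find\<close>

lemma ack_gt: "m + n < ack m n"
proof (induction m n rule: ack.induct)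
  case (3 m n)
  then show ?case by simp
qed auto

lemma ack_less_Suc: "ack m n < ack m (Suc n)"
proof (cases m)
  case (Suc k)
  have "k + ack (Suc k) n < ack k (ack (Suc k) n)" by (rule ack_gt)
  then show ?thesis using Suc by simp
qed simp

lemma ack_mono: "n \<le> n' \<Longrightarrow> ack m n \<le> ack m n'"
  by (rule lift_Suc_mono_le[of "ack m"]) (simp_all add: ack_less_Suc less_imp_le)

lemma ack_le_Suc_left: "ack m n \<le> ack (Suc m) n"
proof (cases n)
  case (Suc k)
  have "Suc k \<le> ack (Suc m) k" using ack_gt[of "Suc m" k] by simp
  then show ?thesis using Suc ack_mono by simp
qed (simp add: ack_mono)

lemma ack_mono_left: "m \<le> m' \<Longrightarrow> ack m n \<le> ack m' n"
  by (rule lift_Suc_mono_le[of "\<lambda>m. ack m n"]) (simp_all only: ack_le_Suc_left)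

text \<open>Explains the range of iterates used below: from any start that is at least 1,
  \<open>Suc n\<close> iterations of \<open>ack m\<close> reach at least
  \<open>ack (Suc m) n\<close>, the next level.\<close>

lemma ack_Suc_funpow: "ack (Suc m) n = (ack m ^^ Suc n) 1"
  by (induction n) simp_all

lemma ack_funpow_mono: "n \<le> n' \<Longrightarrow> (ack m ^^ i) n \<le> (ack m ^^ i) n'"
  by (induction i) (simp_all add: ack_mono)

lemma ack_1: "ack (Suc 0) n = Suc (Suc n)"
  by (induction n) simp_all

lemma ack_2: "ack (Suc (Suc 0)) n = 2 * n + 3"
  by (induction n) (simp_all add: ack_1)

text \<open>With \<open>k = inv_ack m\<close>, the value \<open>ack k k\<close> is at most
  \<open>ack (k + 2) 1\<close>, hence at most \<open>ack (k + 3) 1\<close>, and the fourth level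
  applies a function that is at least \<open>2 * x + 3\<close>. The value \<open>2 * m + 1\<close>
  is the later bound on ranks.\<close>

lemma inv_ack_bounds: "1 \<le> inv_ack m" "2 * m + 1 < ack (inv_ack m + 4) 1"
proof -
  let ?k = "inv_ack m"
  have "Suc (?k + 3) = ?k + 4" by simp
  have "1 \<le> Suc m \<and> m \<le> ack (Suc m) (Suc m)" using ack_gt[of "Suc m" "Suc m"] by linarith
  then have k: "1 \<le> ?k \<and> m \<le> ack ?k ?k"
    unfolding inv_ack_def by (rule LeastI[of "\<lambda>k. 1 \<le> k \<and> m \<le> ack k k"])
  then show "1 \<le> ?k" by simp
  have "ack ?k ?k \<le> ack (Suc ?k) ?k" by (rule ack_le_Suc_left)
  also have "\<dots> \<le> ack (Suc ?k) (ack (Suc ?k) 1)"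
    using ack_gt[of "Suc ?k" 1] by (intro ack_mono) simp
  also have "\<dots> = ack (Suc (Suc ?k)) 1" by simp
  also have "\<dots> \<le> ack (?k + 3) 1" by (rule ack_mono_left) simp
  finally have "m \<le> ack (?k + 3) 1" using k by (meson le_trans)
  moreover have "2 * ack (?k + 3) 1 + 3 \<le> ack (?k + 3) (ack (?k + 3) 1)"
    using ack_mono_left[of "Suc (Suc 0)" "?k + 3" "ack (?k + 3) 1"] by (simp only: ack_2)
  moreover have "ack (Suc l) 1 = ack l (ack l 1)" for l by simp
  from this[of "?k + 3"] have "ack (?k + 4) 1 = ack (?k + 3) (ack (?k + 3) 1)"
    by (metis \<open>Suc (?k + 3) = ?k + 4\<close>)
  ultimately show "2 * m + 1 < ack (?k + 4) 1" by linarith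
qed

section \<open>Thresholds of iterated Ackermann functions above a rank\<close>

text \<open>Plays the part of level and index in the usual analysis of path compression. Being a set
  of thresholds not yet reached, it can only shrink when \<open>R\<close> grows.\<close>

definition gap :: "nat \<Rightarrow> nat \<Rightarrow> nat \<Rightarrow> (nat \<times> nat) set" where
  "gap K n R = {(k, i). k < K \<and> 1 \<le> i \<and> i \<le> n \<and> R < (ack k ^^ i) n}"

lemma gap_subset: "gap K n R \<subseteq> {..<K} \<times> {1..n}"
  by (auto simp: gap_def)

lemma finite_gap: "finite (gap K n R)"
  by (rule finite_subset[OF gap_subset]) simp

lemma card_gap_le: "card (gap K n R) \<le> K * n"
  using card_mono[OF _ gap_subset, of K n R] by simp

lemma card_gap_antimono: "R \<le> R' \<Longrightarrow> card (gap K n R') \<le> card (gap K n R)"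
  by (rule card_mono[OF finite_gap]) (auto simp: gap_def)

text \<open>Let the \<open>j\<close>-th iterate of \<open>ack k\<close> at \<open>n\<close> be the
  first beyond \<open>R\<close>. Applying \<open>ack k\<close> to \<open>R\<close> reaches it, so
  \<open>(k, j)\<close> leaves the set. Only \<open>j = n + 1\<close> is outside the index range;
  then \<open>R'\<close> has reached \<open>ack (Suc k) n\<close>, and \<open>(Suc k, 1)\<close>
  leaves instead. \<open>R' < ack K 1\<close> keeps the levels in question below
  \<open>K\<close>.\<close>

lemma card_gap_less:
  assumes n: "1 \<le> n" and k: "ack k n \<le> R" "R < ack (Suc k) n"
    and R': "ack k R \<le> R'" "R' < ack K 1"
  shows "card (gap K n R') < card (gap K n R)"
proof -
  have K: "l < K" if "ack l n \<le> R'" for l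
  proof (rule ccontr)
    assume "\<not> l < K"
    then have "ack K 1 \<le> ack l n" using n ack_mono_left[of K l n] ack_mono[of 1 n K] by simp
    then show False using that R' by simp
  qed
  have RR: "R \<le> R'" using R'(1) ack_gt[of k R] by simp
  have top: "ack (Suc k) n \<le> (ack k ^^ Suc n) n"
    unfolding ack_Suc_funpow by (rule ack_funpow_mono[OF n])
  define j where "j = (LEAST j. R < (ack k ^^ j) n)"
  have ex: "R < (ack k ^^ Suc n) n" using top k(2) by linarith
  have j: "R < (ack k ^^ j) n" "j \<le> Suc n"
    unfolding j_def using ex by (rule LeastI, rule Least_le)
  have "\<not> R < (ack k ^^ 0) n" "\<not> R < (ack k ^^ 1) n" using k(1) ack_gt[of k n] by auto
  then have "j \<noteq> 0" "j \<noteq> 1" using j(1) by metis+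
  then have j2: "2 \<le> j" by simp
  have "\<not> R < (ack k ^^ (j - 1)) n"
    using not_less_Least[of "j - 1" "\<lambda>j. R < (ack k ^^ j) n"] j2 unfolding j_def by simp
  then have "ack k ((ack k ^^ (j - 1)) n) \<le> R'" using ack_mono[of _ R k] R'(1) by (meson le_trans not_less)
  moreover have "(ack k ^^ j) n = ack k ((ack k ^^ (j - 1)) n)"
    using j2 funpow.simps(2)[of "j - 1" "ack k"] by simp
  ultimately have jR': "(ack k ^^ j) n \<le> R'" by simp
  have "\<exists>x. x \<in> gap K n R \<and> x \<notin> gap K n R'"
  proof (cases "j \<le> n")
    case True
    have "k < K" using K k(1) RR by simp
    then show ?thesis using True j(1) j2 jR' by (intro exI[of _ "(k, j)"]) (auto simp: gap_def)
  next
    case False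
    then have "j = Suc n" using j(2) by simp
    then have "ack (Suc k) n \<le> R'" using jR' top by simp
    then show ?thesis using K[of "Suc k"] k n
      by (intro exI[of _ "(Suc k, 1)"]) (auto simp: gap_def simp del: ack.simps)
  qed
  moreover have "gap K n R' \<subseteq> gap K n R" using RR by (auto simp: gap_def)
  ultimately show ?thesis by (intro psubset_card_mono[OF finite_gap]) blast
qed

text \<open>The level of a vertex of rank \<open>n\<close> under a parent of rank \<open>R\<close>:
  for \<open>n < R\<close> this is also the greatest \<open>k\<close> with
  \<open>ack k n \<le> R\<close>.\<close>

definition ack_level :: "nat \<Rightarrow> nat \<Rightarrow> nat" where
  "ack_level n R = (LEAST k. R < ack (Suc k) n)"

lemma ack_level:
  assumes "n < R" "R < ack K n"
  shows "ack (ack_level n R) n \<le> R" "R < ack (Suc (ack_level n R)) n" "ack_level n R < K"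
proof -
  have "K \<noteq> 0" using assms by (cases K) auto
  then have K: "R < ack (Suc (K - 1)) n" using assms by simp
  then show 2: "R < ack (Suc (ack_level n R)) n"
    unfolding ack_level_def by (rule LeastI)
  have "ack_level n R \<le> K - 1" unfolding ack_level_def using K by (rule Least_le)
  then show "ack_level n R < K" using \<open>K \<noteq> 0\<close> by simp
  show "ack (ack_level n R) n \<le> R"
  proof (cases "ack_level n R")
    case 0
    then show ?thesis using assms(1) by simp
  next
    case (Suc l)
    then have "\<not> R < ack (Suc l) n"
      using not_less_Least[of l "\<lambda>k. R < ack (Suc k) n"] unfolding ack_level_def by simp
    then show ?thesis using Suc by simp
  qed
qed

text \<open>The root function \<open>\<rho>\<close> is a ghost component: it never has to be computed by recursion.\<close>

definition uf_inv :: "'a set \<Rightarrow> ('a \<Rightarrow> 'a) \<Rightarrow> ('a \<Rightarrow> nat) \<Rightarrow> ('a \<Rightarrow> 'a) \<Rightarrow> bool" where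
  "uf_inv A p rk \<rho> \<longleftrightarrow> finite A \<and> (\<forall>x\<in>A. p x \<in> A \<and> \<rho> x \<in> A \<and> \<rho> (p x) = \<rho> x \<and> p (\<rho> x) = \<rho> x \<and>
     (p x = x \<longrightarrow> \<rho> x = x) \<and> (p x \<noteq> x \<longrightarrow> rk x < rk (p x)) \<and> 1 \<le> rk x)"

text \<open>A non-root vertex \<open>x\<close> of rank \<open>n\<close> whose parent has rank \<open>R\<close> pays one unit for every pair
  \<open>(k, i)\<close> such that \<open>R\<close> has not yet reached the \<open>i\<close>-th iterate of \<open>ack k\<close> at \<open>n\<close>.\<close>

definition pot :: "nat \<Rightarrow> ('a \<Rightarrow> 'a) \<Rightarrow> ('a \<Rightarrow> nat) \<Rightarrow> 'a \<Rightarrow> nat" where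
  "pot K p rk x = (if p x = x then K * rk x else card (gap K (rk x) (rk (p x))))"

text \<open>The list holds the vertices strictly below the root \<open>y\<close>, so its length is
  the number of parent steps, and a root has the empty list.\<close>

fun upath :: "('a \<Rightarrow> 'a) \<Rightarrow> 'a \<Rightarrow> 'a list \<Rightarrow> 'a \<Rightarrow> bool" where
  "upath p x [] y \<longleftrightarrow> x = y \<and> p y = y"
| "upath p x (z # zs) y \<longleftrightarrow> z = x \<and> p x \<noteq> x \<and> upath p (p x) zs y"

definition compress :: "('a \<Rightarrow> 'a) \<Rightarrow> 'a list \<Rightarrow> 'a \<Rightarrow> 'a \<Rightarrow> 'a" where
  "compress p xs y = (\<lambda>z. if z \<in> set xs then y else p z)"

text \<open>Ranks increase strictly towards the root and are bounded by \<open>D\<close>, so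
  climbing ends.\<close>

lemma ex_upath:
  assumes inv: "uf_inv A p rk \<rho>" and bd: "\<And>x. x \<in> A \<Longrightarrow> rk x \<le> D" and x: "x \<in> A"
  shows "\<exists>xs. upath p x xs (\<rho> x)"
  using x
proof (induction "D - rk x" arbitrary: x rule: less_induct)
  case less
  show ?case
  proof (cases "p x = x")
    case True
    then have "upath p x [] (\<rho> x)" using inv less.prems by (auto simp: uf_inv_def)
    then show ?thesis by blast
  next
    case False
    then have px: "p x \<in> A" "\<rho> (p x) = \<rho> x" "rk x < rk (p x)" using inv less.prems by (auto simp: uf_inv_def)
    then have "D - rk (p x) < D - rk x" using bd[OF px(1)] by linarith
    from less.hyps[OF this px(1)] obtain xs where "upath p (p x) xs (\<rho> x)" using px by auto
    then have "upath p x (x # xs) (\<rho> x)" using False by simp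
    then show ?thesis by blast
  qed
qed

lemma upath_facts:
  assumes "uf_inv A p rk \<rho>" "upath p x xs y" "x \<in> A"
  shows "y \<in> A \<and> y = \<rho> x \<and> p y = y \<and> rk x \<le> rk y \<and>
    (\<forall>z\<in>set xs. z \<in> A \<and> \<rho> z = y \<and> p z \<noteq> z \<and> rk x \<le> rk z \<and> rk (p z) \<le> rk y)"
  using assms(2,3)
proof (induction xs arbitrary: x)
  case Nil
  then show ?case using assms(1) by (auto simp: uf_inv_def)
next
  case (Cons z zs)
  then have x: "p x \<in> A" "\<rho> (p x) = \<rho> x" "rk x < rk (p x)" using assms(1) by (auto simp: uf_inv_def)
  have up: "upath p (p x) zs y" "z = x" "p x \<noteq> x" using Cons.prems by auto
  from Cons.IH[OF up(1) x(1)] show ?case using x up Cons.prems(2) by fastforce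
qed

lemma compress_Cons: "compress p (x # xs) y = (compress p xs y)(x := y)"
  by (auto simp: compress_def)

lemma uf_inv_compress:
  assumes inv: "uf_inv A p rk \<rho>" and up: "upath p x xs y" "x \<in> A"
  shows "uf_inv A (compress p xs y) rk \<rho>"
proof -
  note f = upath_facts[OF inv up]
  have "\<rho> y = y" using inv f by (auto simp: uf_inv_def)
  moreover have "rk z < rk y" if "z \<in> set xs" for z
    using inv f that by (auto simp: uf_inv_def intro: less_le_trans)
  moreover have "\<rho> z \<notin> set xs" if "z \<in> A" for z
    using inv f that by (auto simp: uf_inv_def)
  ultimately show ?thesis using inv f unfolding uf_inv_def compress_def by auto
qed

text \<open>On a compressed path every vertex except the last one of its level loses potential.\<close>

lemma pot_compress_level:
  assumes inv: "uf_inv A p rk \<rho>" and up: "upath p x xs y" "x \<in> A"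
    and bd: "\<And>x. x \<in> A \<Longrightarrow> rk x < ack K 1"
  shows "length xs + (\<Sum>z\<in>A. pot K (compress p xs y) rk z)
    \<le> card ((\<lambda>z. ack_level (rk z) (rk (p z))) ` set xs) + (\<Sum>z\<in>A. pot K p rk z)"
  using up
proof (induction xs arbitrary: x)
  case Nil
  then show ?case by (simp add: compress_def)
next
  case (Cons x' zs)
  let ?lev = "\<lambda>z. ack_level (rk z) (rk (p z))"
  have [simp]: "x' = x" and px: "p x \<noteq> x" and up: "upath p (p x) zs y" using Cons.prems by auto
  have x: "p x \<in> A" "rk x < rk (p x)" "1 \<le> rk x" using inv Cons.prems px by (auto simp: uf_inv_def)
  note f = upath_facts[OF inv up x(1)]
  have fin: "finite A" using inv by (simp add: uf_inv_def)
  have xzs: "x \<notin> set zs" using f x(2) by (meson linorder_not_le)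
  have yx: "y \<noteq> x" "rk (p x) \<le> rk y" using f x(2) by auto
  \<comment> \<open>The tail is compressed first; \<open>x\<close> is not on it and still has its
    old parent when its own pointer is moved.\<close>
  let ?q = "compress p zs y"
  have qx: "?q x = p x" using xzs by (simp add: compress_def)
  have split: "(\<Sum>z\<in>A. g z) = g x + (\<Sum>z\<in>A - {x}. g z)" for g :: "'a \<Rightarrow> nat"
    using sum.remove[OF fin Cons.prems(2)] .
  have rest: "(\<Sum>z\<in>A - {x}. pot K (?q(x := y)) rk z) = (\<Sum>z\<in>A - {x}. pot K ?q rk z)"
    by (rule sum.cong) (auto simp: pot_def)
  have new: "pot K (?q(x := y)) rk x = card (gap K (rk x) (rk y))" using yx by (simp add: pot_def)
  have old: "pot K ?q rk x = card (gap K (rk x) (rk (p x)))" using px qx by (simp add: pot_def)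
  have IH: "length zs + (\<Sum>z\<in>A. pot K ?q rk z) \<le> card (?lev ` set zs) + (\<Sum>z\<in>A. pot K p rk z)"
    using Cons.IH[OF up x(1)] .
  have lev: "ack (?lev z) (rk z) \<le> rk (p z)" "rk (p z) < ack (Suc (?lev z)) (rk z)"
    if "z \<in> A" "p z \<noteq> z" for z
  proof -
    have "rk z < rk (p z)" "1 \<le> rk z" "p z \<in> A" using inv that by (auto simp: uf_inv_def)
    moreover have "rk (p z) < ack K (rk z)"
      using bd[of "p z"] ack_mono[of 1 "rk z" K] calculation by linarith
    ultimately show "ack (?lev z) (rk z) \<le> rk (p z)" "rk (p z) < ack (Suc (?lev z)) (rk z)"
      using ack_level by blast+
  qed
  show ?case
  proof (cases "?lev x \<in> ?lev ` set zs")
    \<comment> \<open>\<open>x\<close> is the last vertex of its level: it need not lose potential,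
      and its unit is paid by the new element of the set of levels.\<close>
    case False
    have "card (gap K (rk x) (rk y)) \<le> card (gap K (rk x) (rk (p x)))"
      using yx by (rule_tac card_gap_antimono)
    then show ?thesis using IH False new old rest split[of "pot K ?q rk"]
        split[of "pot K (?q(x := y)) rk"] by (simp add: compress_Cons del: fun_upd_apply)
  next
    \<comment> \<open>A later \<open>z\<close> of the same level \<open>k\<close> gives \<open>ack k
      (rk (p x)) \<le> ack k (rk z) \<le> rk (p z) \<le> rk y\<close>, so the jump to the root is
      large enough for \<open>card_gap_less\<close>.\<close>
    case True
    then obtain z where z: "z \<in> set zs" "?lev z = ?lev x" by auto
    then have zf: "z \<in> A" "p z \<noteq> z" "rk (p x) \<le> rk z" "rk (p z) \<le> rk y" using f by auto
    have "ack (?lev x) (rk (p x)) \<le> ack (?lev x) (rk z)" using zf by (intro ack_mono)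
    also have "\<dots> \<le> rk y" using lev(1)[OF zf(1,2)] z(2) zf(4) by simp
    finally have "card (gap K (rk x) (rk y)) < card (gap K (rk x) (rk (p x)))"
      using lev[OF Cons.prems(2)] px x(3) bd f by (intro card_gap_less) auto
    then show ?thesis using IH True new old rest split[of "pot K ?q rk"]
        split[of "pot K (?q(x := y)) rk"] by (simp add: compress_Cons insert_absorb del: fun_upd_apply)
  qed
qed

text \<open>With all ranks below \<open>ack K 1\<close> at most \<open>K\<close> levels occur, so
  all but \<open>K\<close> vertices of the path pay for their own step.\<close>

lemma pot_compress:
  assumes inv: "uf_inv A p rk \<rho>" and up: "upath p x xs y" "x \<in> A"
    and bd: "\<And>x. x \<in> A \<Longrightarrow> rk x < ack K 1"
  shows "length xs + (\<Sum>z\<in>A. pot K (compress p xs y) rk z) \<le> K + (\<Sum>z\<in>A. pot K p rk z)"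
proof -
  let ?lev = "\<lambda>z. ack_level (rk z) (rk (p z))"
  have "?lev z < K" if "z \<in> set xs" for z
  proof (rule ack_level(3))
    have z: "z \<in> A" "p z \<noteq> z" using upath_facts[OF inv up] that by auto
    then show "rk z < rk (p z)" using inv by (auto simp: uf_inv_def)
    show "rk (p z) < ack K (rk z)"
      using z inv bd[of "p z"] ack_mono[of 1 "rk z" K] by (force simp: uf_inv_def)
  qed
  then have "?lev ` set xs \<subseteq> {..<K}" by auto
  then have "card (?lev ` set xs) \<le> K" using card_mono[of "{..<K}"] by fastforce
  then show ?thesis using pot_compress_level[OF inv up bd] by linarith
qed

text \<open>Leaving the new rank \<open>s\<close> open covers both a strictly larger root, with
  \<open>s\<close> its old rank, and a tie, with \<open>s\<close> one more.\<close>

lemma uf_inv_link: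
  assumes inv: "uf_inv A p rk \<rho>" and ab: "a \<in> A" "b \<in> A" "p a = a" "p b = b" "a \<noteq> b"
    and s: "rk b \<le> s" "rk a < s"
  shows "uf_inv A (p(a := b)) (rk(b := s)) (\<lambda>z. if \<rho> z = a then b else \<rho> z)"
proof -
  have "\<rho> a = a" "\<rho> b = b" using inv ab by (auto simp: uf_inv_def)
  then show ?thesis using inv ab s unfolding uf_inv_def by (auto intro: less_le_trans)
qed

text \<open>Only \<open>b\<close> can gain, by \<open>K\<close> times the increase of its rank. The
  former root \<open>a\<close> held \<open>K * rk a\<close>, an upper bound for any non-root of that
  rank, and for the others the rank of the parent does not fall.\<close>

lemma pot_link:
  assumes inv: "uf_inv A p rk \<rho>" and ab: "a \<in> A" "b \<in> A" "p a = a" "p b = b" "a \<noteq> b"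
    and s: "rk b \<le> s" "s \<le> Suc (rk b)"
  shows "(\<Sum>z\<in>A. pot K (p(a := b)) (rk(b := s)) z) \<le> K + (\<Sum>z\<in>A. pot K p rk z)"
proof -
  have fin: "finite A" using inv by (simp add: uf_inv_def)
  have b: "pot K (p(a := b)) (rk(b := s)) b \<le> K + pot K p rk b"
    using ab s(2) mult_le_mono2[OF s(2), of K] by (auto simp: pot_def)
  have "pot K (p(a := b)) (rk(b := s)) z \<le> pot K p rk z" if "z \<in> A - {b}" for z
    using that ab s(1) by (auto simp: pot_def card_gap_le intro!: card_gap_antimono)
  then have "(\<Sum>z\<in>A - {b}. pot K (p(a := b)) (rk(b := s)) z) \<le> (\<Sum>z\<in>A - {b}. pot K p rk z)"
    by (rule sum_mono)
  then show ?thesis using b sum.remove[OF fin ab(2)] by (metis (no_types, lifting) add.assoc add_mono)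
qed

lemma uf_inv_new:
  assumes inv: "uf_inv A p rk \<rho>" and u: "u \<notin> A"
  shows "uf_inv (insert u A) (p(u := u)) (rk(u := 1)) (\<rho>(u := u))"
  using assms unfolding uf_inv_def by auto

lemma pot_new:
  assumes inv: "uf_inv A p rk \<rho>" and u: "u \<notin> A"
  shows "(\<Sum>z\<in>insert u A. pot K (p(u := u)) (rk(u := 1)) z) = K + (\<Sum>z\<in>A. pot K p rk z)"
proof -
  have "pot K (p(u := u)) (rk(u := 1)) z = pot K p rk z" if "z \<in> A" for z
    using that inv u by (auto simp: pot_def uf_inv_def)
  then show ?thesis using inv u by (simp add: uf_inv_def pot_def)
qed

section \<open>The forest of Kruskal's algorithm\<close>

text \<open>\<open>D\<close> is the set of edges examined so far, whose ends \<open>U\<close> has to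
  connect. The last conjunct is the assumption \<open>U_unique\<close> of
  \<open>linked_graph\<close>.\<close>

definition kforest :: "'a set set \<Rightarrow> 'a rel \<Rightarrow> 'a set set \<Rightarrow> 'a set set \<Rightarrow> bool" where
  "kforest E L D U \<longleftrightarrow> U \<subseteq> E \<and> (\<forall>a b. {a, b} \<in> D \<longrightarrow> (a, b) \<in> (adj_on UNIV U)\<^sup>*) \<and>
     (\<forall>u a b. {u, a} \<in> U \<longrightarrow> {u, b} \<in> U \<longrightarrow> less_L L u a \<longrightarrow> less_L L u b \<longrightarrow>
        (a, b) \<in> (adj_on {w. less_L L u w} E)\<^sup>* \<longrightarrow> a = b)"

lemma kforest_skip:
  "kforest E L D U \<Longrightarrow> (u, w) \<in> (adj_on UNIV U)\<^sup>* \<Longrightarrow> kforest E L (insert {u, w} D) U"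
  unfolding kforest_def
  by (auto simp: doubleton_eq_iff dest: adj_on_rtrancl_commute)

text \<open>By \<open>above\<close>, all edges with both ends beyond \<open>u\<close> are in
  \<open>D\<close>, so \<open>U\<close> connects every component of \<open>G[{w. w > u}]\<close>.
  Were there already a larger \<open>U\<close>-neighbour of \<open>u\<close> in the component of
  \<open>w\<close>, then \<open>u\<close> and \<open>w\<close> would be connected in
  \<open>U\<close>.\<close>

lemma kforest_add:
  assumes k: "kforest E L D U" and L: "antisym L"
    and uw: "{u, w} \<in> E" "less_L L u w" "(u, w) \<notin> (adj_on UNIV U)\<^sup>*"
    and above: "\<And>a b. {a, b} \<in> E \<Longrightarrow> less_L L u a \<Longrightarrow> less_L L u b \<Longrightarrow> {a, b} \<in> D"
  shows "kforest E L (insert {u, w} D) (insert {u, w} U)"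
proof -
  let ?U = "insert {u, w} U"
  have sub: "(adj_on UNIV U)\<^sup>* \<subseteq> (adj_on UNIV ?U)\<^sup>*"
    by (intro rtrancl_mono adj_on_mono) auto
  have "(u, w) \<in> adj_on UNIV ?U" "(w, u) \<in> adj_on UNIV ?U" by (auto simp: adj_on_def insert_commute)
  then have con: "(a, b) \<in> (adj_on UNIV ?U)\<^sup>*" if "{a, b} \<in> insert {u, w} D" for a b
    using that k sub unfolding kforest_def by (auto simp: doubleton_eq_iff)
  have key: False if "{u, b} \<in> U" "less_L L u b" "(w, b) \<in> (adj_on {w. less_L L u w} E)\<^sup>*" for b
  proof -
    have "adj_on {w. less_L L u w} E \<subseteq> (adj_on UNIV U)\<^sup>*"
      using above k unfolding kforest_def by (auto simp: adj_on_def)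
    then have "(w, b) \<in> (adj_on UNIV U)\<^sup>*" using that(3) rtrancl_subset_rtrancl by blast
    moreover have "(u, b) \<in> (adj_on UNIV U)\<^sup>*" using that(1) by (auto simp: adj_on_def)
    ultimately show False using uw(3) adj_on_rtrancl_commute by (metis rtrancl_trans)
  qed
  have new: "c = u \<and> a = w" if "{c, a} = {u, w}" "less_L L c a" for c a
    using that uw(2) L by (auto simp: doubleton_eq_iff less_L_def dest: antisymD)
  have "a = b" if *: "{c, a} \<in> ?U" "{c, b} \<in> ?U" "less_L L c a" "less_L L c b"
    "(a, b) \<in> (adj_on {w. less_L L c w} E)\<^sup>*" for c a b
  proof (cases "{c, a} = {u, w}")
    case True
    then have c: "c = u" "a = w" using new *(3) by auto
    show ?thesis
    proof (cases "{c, b} = {u, w}")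
      case True
      then show ?thesis using new *(4) c by auto
    next
      case False
      then show ?thesis using key[of b] * c by auto
    qed
  next
    case F: False
    show ?thesis
    proof (cases "{c, b} = {u, w}")
      case True
      then have c: "c = u" "b = w" using new *(4) by auto
      then show ?thesis using key[of a] * F adj_on_rtrancl_commute[OF *(5)] by auto
    next
      case False
      then show ?thesis using k * F unfolding kforest_def by blast
    qed
  qed
  then show ?thesis using k con uw(1) unfolding kforest_def by blast
qed

lemma rtrancl_adj_on_insert:
  "(a, b) \<in> (adj_on UNIV (insert {u, w} U))\<^sup>* \<longleftrightarrow> (a, b) \<in> (adj_on UNIV U)\<^sup>* \<or>
     (a, u) \<in> (adj_on UNIV U)\<^sup>* \<and> (w, b) \<in> (adj_on UNIV U)\<^sup>* \<or>
     (a, w) \<in> (adj_on UNIV U)\<^sup>* \<and> (u, b) \<in> (adj_on UNIV U)\<^sup>*"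
proof -
  have "adj_on UNIV (insert {u, w} U) = insert (u, w) (insert (w, u) (adj_on UNIV U))"
    by (auto simp: adj_on_def doubleton_eq_iff)
  then show ?thesis
    by (simp add: rtrancl_insert) (meson adj_on_rtrancl_commute rtrancl_trans)
qed

definition classes :: "'a set \<Rightarrow> ('a \<Rightarrow> 'a) \<Rightarrow> 'a set set \<Rightarrow> bool" where
  "classes A \<rho> U \<longleftrightarrow> U \<subseteq> Pow A \<and> (\<forall>a\<in>A. \<forall>b\<in>A. \<rho> a = \<rho> b \<longleftrightarrow> (a, b) \<in> (adj_on UNIV U)\<^sup>*)"

text \<open>Which root survives is decided by rank and not by the orientation of the edge, so both
  assignments of \<open>a\<close> and \<open>b\<close> are allowed.\<close>

lemma classes_link:
  assumes c: "classes A \<rho> U" and uw: "u \<in> A" "w \<in> A" "\<rho> u = a \<and> \<rho> w = b \<or> \<rho> u = b \<and> \<rho> w = a"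
  shows "classes A (\<lambda>z. if \<rho> z = a then b else \<rho> z) (insert {u, w} U)"
proof -
  have eq: "(x, y) \<in> (adj_on UNIV U)\<^sup>* \<longleftrightarrow> \<rho> x = \<rho> y" if "x \<in> A" "y \<in> A" for x y
    using c that by (auto simp: classes_def)
  have "(x, y) \<in> (adj_on UNIV (insert {u, w} U))\<^sup>* \<longleftrightarrow>
    (if \<rho> x = a then b else \<rho> x) = (if \<rho> y = a then b else \<rho> y)" if "x \<in> A" "y \<in> A" for x y
    using uw that by (auto simp: rtrancl_adj_on_insert eq)
  then show ?thesis using c uw by (auto simp: classes_def)
qed

lemma classes_new:
  assumes c: "classes A \<rho> U" and u: "u \<notin> A" and \<rho>: "\<And>x. x \<in> A \<Longrightarrow> \<rho> x \<in> A"
  shows "classes (insert u A) (\<rho>(u := u)) U"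
proof -
  have iso: "y = u" if "(u, y) \<in> (adj_on UNIV U)\<^sup>*" for y
    using that
  proof (induction rule: rtrancl_induct)
    case (step y z)
    then have "{u, z} \<in> U" by (simp add: adj_on_def)
    then show ?case using c u by (auto simp: classes_def)
  qed simp
  have iso': "y = u" if "(y, u) \<in> (adj_on UNIV U)\<^sup>*" for y
    using iso adj_on_rtrancl_commute[OF that] by blast
  have "((\<rho>(u := u)) a = (\<rho>(u := u)) b) = ((a, b) \<in> (adj_on UNIV U)\<^sup>*)"
    if ab: "a \<in> insert u A" "b \<in> insert u A" for a b
  proof (cases "a = u"; cases "b = u")
    assume "a = u" "b \<noteq> u"
    then show ?thesis using iso[of b] \<rho>[of b] ab u by auto
  next
    assume "a \<noteq> u" "b = u"
    then show ?thesis using iso'[of a] \<rho>[of a] ab u by auto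
  next
    assume "a \<noteq> u" "b \<noteq> u"
    then show ?thesis using c ab unfolding classes_def by simp
  qed simp
  then show ?thesis using c unfolding classes_def by blast
qed

section \<open>Program verification with time credits\<close>

text \<open>Preserved by every execution. It discharges the overflow condition of copies, loads and
  subtractions once and for all; constants and sums keep an explicit one.\<close>

definition bnd :: "nat \<Rightarrow> (nat \<Rightarrow> nat) \<Rightarrow> (nat \<Rightarrow> nat) \<Rightarrow> bool" where
  "bnd B R M \<longleftrightarrow> (\<forall>x. R x \<le> B) \<and> (\<forall>a. M a \<le> B)"

lemma exec_bnd: "exec B c s t s' \<Longrightarrow> bnd B (fst s) (snd s) \<Longrightarrow> bnd B (fst s') (snd s')"
  by (induction rule: exec.induct) (auto simp: bnd_def)

text \<open>Weakest preconditions with time credits: the last argument of a condition is the number of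
  time units that may still be spent. As every step costs a credit, loop invariants
  that guarantee a positive credit also prove termination.\<close>

definition wp :: "nat \<Rightarrow> com \<Rightarrow> ((nat \<Rightarrow> nat) \<Rightarrow> (nat \<Rightarrow> nat) \<Rightarrow> nat \<Rightarrow> bool) \<Rightarrow>
    (nat \<Rightarrow> nat) \<Rightarrow> (nat \<Rightarrow> nat) \<Rightarrow> nat \<Rightarrow> bool" where
  "wp B c Q R M k \<longleftrightarrow> (bnd B R M \<longrightarrow>
     (\<exists>t R' M'. exec B c (R, M) t (R', M') \<and> t \<le> k \<and> Q R' M' (k - t)))"

lemma wp_skip: "1 \<le> k \<Longrightarrow> Q R M (k - 1) \<Longrightarrow> wp B Skip Q R M k"
  unfolding wp_def using exec.Skip by blast

lemma wp_assign:
  assumes "bnd B R M \<Longrightarrow> rhs_val e (R, M) \<le> B" "1 \<le> k" "Q (R(x := rhs_val e (R, M))) M (k - 1)"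
  shows "wp B (Assign x e) Q R M k"
  unfolding wp_def using assms exec.Assign by blast

lemma wp_const: "c \<le> B \<Longrightarrow> 1 \<le> k \<Longrightarrow> Q (R(x := c)) M (k - 1) \<Longrightarrow> wp B (Assign x (Const c)) Q R M k"
  by (rule wp_assign) auto

lemma wp_copy: "1 \<le> k \<Longrightarrow> Q (R(x := R y)) M (k - 1) \<Longrightarrow> wp B (Assign x (Copy y)) Q R M k"
  by (rule wp_assign) (auto simp: bnd_def)

lemma wp_add: "R y + R z \<le> B \<Longrightarrow> 1 \<le> k \<Longrightarrow> Q (R(x := R y + R z)) M (k - 1) \<Longrightarrow>
    wp B (Assign x (Add y z)) Q R M k"
  by (rule wp_assign) auto

lemma wp_sub: "1 \<le> k \<Longrightarrow> Q (R(x := R y - R z)) M (k - 1) \<Longrightarrow> wp B (Assign x (Sub y z)) Q R M k"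
  by (rule wp_assign) (auto simp: bnd_def intro: le_trans[OF diff_le_self])

lemma wp_load: "1 \<le> k \<Longrightarrow> Q (R(x := M (R y))) M (k - 1) \<Longrightarrow> wp B (Assign x (Load y)) Q R M k"
  by (rule wp_assign) (auto simp: bnd_def)

lemma wp_store: "1 \<le> k \<Longrightarrow> Q R (M(R x := R y)) (k - 1) \<Longrightarrow> wp B (Store x y) Q R M k"
  unfolding wp_def using exec.Store by blast

lemma wp_seq:
  assumes "wp B c1 (wp B c2 Q) R M k"
  shows "wp B (Seq c1 c2) Q R M k"
  unfolding wp_def
proof
  assume b: "bnd B R M"
  then obtain t R' M' where 1: "exec B c1 (R, M) t (R', M')" "t \<le> k" "wp B c2 Q R' M' (k - t)"
    using assms unfolding wp_def[of B c1] by blast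
  have "bnd B R' M'" using exec_bnd[OF 1(1)] b by simp
  then obtain t2 R2 M2 where 2: "exec B c2 (R', M') t2 (R2, M2)" "t2 \<le> k - t" "Q R2 M2 (k - t - t2)"
    using 1(3) unfolding wp_def by blast
  have "exec B (Seq c1 c2) (R, M) (t + t2) (R2, M2)" using 1(1) 2(1) by (rule exec.Seq)
  moreover have "t + t2 \<le> k" using 1(2) 2(2) by simp
  ultimately show "\<exists>t R' M'. exec B (Seq c1 c2) (R, M) t (R', M') \<and> t \<le> k \<and> Q R' M' (k - t)"
    using 2(3) by (metis diff_diff_left)
qed

lemma wp_if:
  assumes k: "1 \<le> k" and 1: "test_val b (R, M) \<Longrightarrow> wp B c1 Q R M (k - 1)"
    and 2: "\<not> test_val b (R, M) \<Longrightarrow> wp B c2 Q R M (k - 1)"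
  shows "wp B (If b c1 c2) Q R M k"
  unfolding wp_def
proof
  assume "bnd B R M"
  then obtain t R' M' where "exec B (If b c1 c2) (R, M) (1 + t) (R', M')" "t \<le> k - 1" "Q R' M' (k - 1 - t)"
    using 1 2 unfolding wp_def by (metis exec.IfFalse exec.IfTrue)
  moreover from this have "1 + t \<le> k" "k - 1 - t = k - (1 + t)" using k by auto
  ultimately show "\<exists>t R' M'. exec B (If b c1 c2) (R, M) t (R', M') \<and> t \<le> k \<and> Q R' M' (k - t)"
    by metis
qed

lemma wp_while:
  assumes I: "I R M k"
    and k: "\<And>R M k. I R M k \<Longrightarrow> 1 \<le> k"
    and step: "\<And>R M k. I R M k \<Longrightarrow> test_val b (R, M) \<Longrightarrow> wp B c I R M (k - 1)"
    and exit: "\<And>R M k. I R M k \<Longrightarrow> \<not> test_val b (R, M) \<Longrightarrow> Q R M (k - 1)"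
  shows "wp B (While b c) Q R M k"
  using I
proof (induction k arbitrary: R M rule: less_induct)
  case (less k)
  have k1: "1 \<le> k" using k less.prems by blast
  show ?case
  proof (cases "test_val b (R, M)")
    case True
    show ?thesis unfolding wp_def
    proof
      assume b: "bnd B R M"
      then obtain t R' M' where 1: "exec B c (R, M) t (R', M')" "t \<le> k - 1" "I R' M' (k - 1 - t)"
        using step[OF less.prems True] unfolding wp_def by blast
      have "bnd B R' M'" using exec_bnd[OF 1(1)] b by simp
      moreover have "wp B (While b c) Q R' M' (k - 1 - t)" using less.IH[OF _ 1(3)] k1 by simp
      ultimately obtain t2 R2 M2 where 2: "exec B (While b c) (R', M') t2 (R2, M2)"
        "t2 \<le> k - 1 - t" "Q R2 M2 (k - 1 - t - t2)"
        unfolding wp_def by blast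
      have "exec B (While b c) (R, M) (1 + t + t2) (R2, M2)"
        using exec.WhileTrue[OF True 1(1) 2(1)] .
      moreover have "1 + t + t2 \<le> k" "k - 1 - t - t2 = k - (1 + t + t2)" using 1(2) 2(2) k1 by auto
      ultimately show "\<exists>t R' M'. exec B (While b c) (R, M) t (R', M') \<and> t \<le> k \<and> Q R' M' (k - t)"
        using 2(3) by metis
    qed
  next
    case False
    then show ?thesis using exit[OF less.prems False] exec.WhileFalse k1 unfolding wp_def by blast
  qed
qed

section \<open>Arrays of length \<open>N\<close> in the flat memory\<close>

text \<open>Cut to 0 from index \<open>N\<close> on, where the next array begins, so that an array
  is a function unaffected by writes to the others.\<close>

definition arr :: "nat \<Rightarrow> (nat \<Rightarrow> nat) \<Rightarrow> nat \<Rightarrow> nat \<Rightarrow> nat" where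
  "arr N M j i = (if i < N then M (j * N + i) else 0)"

definition aset :: "nat \<Rightarrow> (nat \<Rightarrow> nat) \<Rightarrow> nat \<Rightarrow> nat \<Rightarrow> nat \<Rightarrow> nat \<Rightarrow> nat" where
  "aset N M j i v = M(j * N + i := v)"

text \<open>By division with remainder, the address \<open>j * N + i\<close> determines
  \<open>j\<close> and \<open>i\<close>, so arrays cannot overlap.\<close>

lemma arr_aset:
  assumes "i < N"
  shows "arr N (aset N M j i v) j' = (if j' = j then (arr N M j)(i := v) else arr N M j')"
proof
  fix i'
  have "j * N + i = j' * N + i' \<longleftrightarrow> j = j' \<and> i = i'" if "i' < N"
  proof
    assume eq: "j * N + i = j' * N + i'"
    have "(j * N + i) div N = j" "(j * N + i) mod N = i"
      "(j' * N + i') div N = j'" "(j' * N + i') mod N = i'" using that assms by auto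
    then show "j = j' \<and> i = i'" using eq by metis
  qed auto
  then show "arr N (aset N M j i v) j' i' = (if j' = j then (arr N M j)(i := v) else arr N M j') i'"
    using assms by (auto simp: arr_def aset_def)
qed

text \<open>Registers \<open>0\<close> to \<open>12\<close> hold constants, in particular register \<open>j + 1\<close> holds the base
  address of array \<open>j\<close> for \<open>1 \<le> j \<le> 9\<close>; register \<open>13\<close> is used for addresses.\<close>

definition regs_ok :: "nat \<Rightarrow> nat \<Rightarrow> (nat \<Rightarrow> nat) \<Rightarrow> bool" where
  "regs_ok n N R \<longleftrightarrow> R 0 = 0 \<and> R 1 = n \<and> (\<forall>j\<in>{1..9}. R (Suc j) = j * N) \<and> R 11 = 1 \<and> R 12 = 3 + n"

lemma regs_ok_upd: "13 \<le> x \<Longrightarrow> regs_ok n N (R(x := v)) = regs_ok n N R"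
  by (auto simp: regs_ok_def)

lemma regs_okD: "regs_ok n N R \<Longrightarrow> R 0 = 0" "regs_ok n N R \<Longrightarrow> R (Suc 0) = n"
  "regs_ok n N R \<Longrightarrow> R 2 = N" "regs_ok n N R \<Longrightarrow> R 11 = 1" "regs_ok n N R \<Longrightarrow> R 12 = 3 + n"
proof -
  assume "regs_ok n N R"
  then show "R 2 = N" unfolding regs_ok_def by (auto dest: bspec[where x = 1] simp: numeral_2_eq_2)
qed (auto simp: regs_ok_def)

definition LD :: "nat \<Rightarrow> nat \<Rightarrow> nat \<Rightarrow> com" where
  "LD x j i = Seq (Assign 13 (Add (Suc j) i)) (Assign x (Load 13))"

definition ST :: "nat \<Rightarrow> nat \<Rightarrow> nat \<Rightarrow> com" where
  "ST j i y = Seq (Assign 13 (Add (Suc j) i)) (Store 13 y)"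

lemma arr_addr:
  assumes "regs_ok n N R" "R i < N" "10 * N \<le> B" "1 \<le> j" "j \<le> 9"
  shows "R (Suc j) + R i = j * N + R i" "j * N + R i \<le> B"
proof -
  have "j * N + R i \<le> 9 * N + N" using assms by (intro add_mono mult_le_mono1) auto
  then show "j * N + R i \<le> B" using assms by linarith
qed (use assms in \<open>auto simp: regs_ok_def\<close>)

lemma wp_LD:
  assumes "regs_ok n N R" "10 * N \<le> B" "1 \<le> j" "j \<le> 9" "R i < N" "2 \<le> k"
    "Q (R(13 := j * N + R i, x := arr N M j (R i))) M (k - 2)"
  shows "wp B (LD x j i) Q R M k"
  unfolding LD_def using assms arr_addr[of n N R i B j]
  by (intro wp_seq wp_add wp_load) (auto simp: arr_def numeral_2_eq_2)

lemma wp_ST: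
  assumes "regs_ok n N R" "10 * N \<le> B" "1 \<le> j" "j \<le> 9" "R i < N" "y \<noteq> 13" "2 \<le> k"
    "Q (R(13 := j * N + R i)) (aset N M j (R i) (R y)) (k - 2)"
  shows "wp B (ST j i y) Q R M k"
  unfolding ST_def using assms arr_addr[of n N R i B j]
  by (intro wp_seq wp_add wp_store) (auto simp: aset_def numeral_2_eq_2)

text \<open>Array \<open>0\<close> is the input, so its cells are addressed directly.\<close>

lemma wp_load0:
  "R y < N \<Longrightarrow> 1 \<le> k \<Longrightarrow> Q (R(x := arr N M 0 (R y))) M (k - 1) \<Longrightarrow> wp B (Assign x (Load y)) Q R M k"
  by (rule wp_load) (auto simp: arr_def)

section \<open>Union-find operations on the machine\<close>

text \<open>Register 21 holds the vertex, register 22 receives its root. The first loop climbs to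
  the root, the second redirects each vertex of the same path to it.\<close>

definition FIND :: com where
  "FIND = Seq (Assign 22 (Copy 21)) (Seq (LD 23 5 22)
    (Seq (While (Neq 23 22) (Seq (Assign 22 (Copy 23)) (LD 23 5 22)))
      (While (Neq 21 22) (Seq (LD 23 5 21) (Seq (ST 5 21 22) (Assign 21 (Copy 23)))))))"

lemma ex2I: "P a b \<Longrightarrow> \<exists>x y. P x y"
  by blast

lemma upath_root: "upath p x xs y \<Longrightarrow> p y = y"
  by (induction xs arbitrary: x) auto

lemma compress_snoc: "compress p (xs @ [x]) y = (compress p xs y)(x := y)"
  by (auto simp: compress_def)

text \<open>A path vertex costs 4 units in the climbing loop and 6 in the redirecting loop; 5 go to
  the prologue and the two failing tests. The lower bound on \<open>k'\<close> hands back what a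
  short path leaves over, as amortisation requires.\<close>

lemma wp_FIND:
  assumes ok: "regs_ok n N R" "10 * N \<le> B"
    and up: "upath (arr N M 5) (R 21) xs y" "distinct xs"
    and lt: "\<And>z. z \<in> set xs \<Longrightarrow> z < N" "y < N"
    and k: "10 * length xs + 5 \<le> k"
    and post: "\<And>R' M' k'. (\<And>x. x \<noteq> 13 \<Longrightarrow> x \<noteq> 21 \<Longrightarrow> x \<noteq> 22 \<Longrightarrow> x \<noteq> 23 \<Longrightarrow> R' x = R x) \<Longrightarrow>
      R' 22 = y \<Longrightarrow> (\<And>j. j \<noteq> 5 \<Longrightarrow> arr N M' j = arr N M j) \<Longrightarrow>
      arr N M' 5 = compress (arr N M 5) xs y \<Longrightarrow> k \<le> k' + (10 * length xs + 5) \<Longrightarrow> regs_ok n N R' \<Longrightarrow>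
      Q R' M' k'"
  shows "wp B FIND Q R M k"
proof -
  let ?p = "arr N M 5"
  \<comment> \<open>Of the two inequalities on credits, the first guarantees enough for the rest,
    the second limits what has been spent. \<open>I2\<close> follows the same pattern.\<close>
  define I1 where "I1 R' M' k' \<longleftrightarrow> regs_ok n N R' \<and> M' = M \<and> R' 21 = R 21 \<and>
    (\<forall>x. x \<noteq> 13 \<longrightarrow> x \<noteq> 21 \<longrightarrow> x \<noteq> 22 \<longrightarrow> x \<noteq> 23 \<longrightarrow> R' x = R x) \<and>
    R' 23 = ?p (R' 22) \<and> (\<exists>zs. upath ?p (R' 22) zs y \<and> set zs \<subseteq> set xs \<and>
      6 * length xs + 2 + 4 * length zs \<le> k' \<and> k + 4 * length zs \<le> k' + 4 * length xs + 3)" for R' M' k'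
  define I2 where "I2 R' M' k' \<longleftrightarrow> regs_ok n N R' \<and> R' 22 = y \<and>
    (\<forall>x. x \<noteq> 13 \<longrightarrow> x \<noteq> 21 \<longrightarrow> x \<noteq> 22 \<longrightarrow> x \<noteq> 23 \<longrightarrow> R' x = R x) \<and>
    (\<forall>j. j \<noteq> 5 \<longrightarrow> arr N M' j = arr N M j) \<and>
    (\<exists>ys zs. xs = ys @ zs \<and> upath ?p (R' 21) zs y \<and> arr N M' 5 = compress ?p ys y \<and>
      6 * length zs + 1 \<le> k' \<and> k + 6 * length zs \<le> k' + 10 * length xs + 4)" for R' M' k'
  have upN: "z < N" if "upath ?p z zs y" "set zs \<subseteq> set xs" for z zs
    using that lt by (cases zs) auto
  have x: "R 21 < N" using upN up(1) by blast
  let ?W1 = "While (Neq 23 22) (Seq (Assign 22 (Copy 23)) (LD 23 5 22))"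
  let ?W2 = "While (Neq 21 22) (Seq (LD 23 5 21) (Seq (ST 5 21 22) (Assign 21 (Copy 23))))"
  have loop2: "wp B ?W2 Q R' M' k'" if "I2 R' M' k'" for R' M' k'
  proof (rule wp_while[where I = I2])
    show "I2 R' M' k'" by (rule that)
  next
    fix R2 M2 k2 assume "I2 R2 M2 k2"
    then show "1 \<le> k2" by (auto simp: I2_def)
  next
    fix R2 M2 k2 assume "I2 R2 M2 k2" "test_val (Neq 21 22) (R2, M2)"
    then obtain ys zs where s: "regs_ok n N R2" "R2 22 = y" "R2 21 \<noteq> y"
      "\<forall>x. x \<noteq> 13 \<longrightarrow> x \<noteq> 21 \<longrightarrow> x \<noteq> 22 \<longrightarrow> x \<noteq> 23 \<longrightarrow> R2 x = R x"
      "\<forall>j. j \<noteq> 5 \<longrightarrow> arr N M2 j = arr N M j"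
      "xs = ys @ zs" "upath ?p (R2 21) zs y" "arr N M2 5 = compress ?p ys y"
      "6 * length zs + 1 \<le> k2" "k + 6 * length zs \<le> k2 + 10 * length xs + 4" by (auto simp: I2_def)
    then obtain zs' where z: "zs = R2 21 # zs'" by (cases zs) auto
    \<comment> \<open>As \<open>xs\<close> is distinct, the current vertex is not among those
      already redirected, and its cell still holds the old parent.\<close>
    have p: "arr N M2 5 (R2 21) = ?p (R2 21)" using s z up(2) by (auto simp: compress_def)
    have xN: "R2 21 < N" using upN s by auto
    show "wp B (Seq (LD 23 5 21) (Seq (ST 5 21 22) (Assign 21 (Copy 23)))) I2 R2 M2 (k2 - 1)"
      by (intro wp_seq wp_copy wp_LD[where n = n and N = N] wp_ST[where n = n and N = N])
        (use s z p xN ok in \<open>auto simp: regs_ok_upd I2_def arr_aset compress_snoc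
           intro!: ex2I[of _ "ys @ [R2 21]" zs']\<close>)
  next
    fix R2 M2 k2 assume "I2 R2 M2 k2" "\<not> test_val (Neq 21 22) (R2, M2)"
    then obtain ys zs where s: "regs_ok n N R2" "R2 22 = y" "R2 21 = y"
      "\<forall>x. x \<noteq> 13 \<longrightarrow> x \<noteq> 21 \<longrightarrow> x \<noteq> 22 \<longrightarrow> x \<noteq> 23 \<longrightarrow> R2 x = R x"
      "\<forall>j. j \<noteq> 5 \<longrightarrow> arr N M2 j = arr N M j"
      "xs = ys @ zs" "upath ?p (R2 21) zs y" "arr N M2 5 = compress ?p ys y"
      "6 * length zs + 1 \<le> k2" "k + 6 * length zs \<le> k2 + 10 * length xs + 4" by (auto simp: I2_def)
    have "zs = []" using s(3,7) upath_root[OF s(7)] by (cases zs) auto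
    then show "Q R2 M2 (k2 - 1)" using s by (intro post) auto
  qed
  have loop1: "wp B ?W1 (wp B ?W2 Q) R' M' k'" if "I1 R' M' k'" for R' M' k'
  proof (rule wp_while[where I = I1])
    show "I1 R' M' k'" by (rule that)
  next
    fix R2 M2 k2 assume "I1 R2 M2 k2"
    then show "1 \<le> k2" by (auto simp: I1_def)
  next
    fix R2 M2 k2 assume I: "I1 R2 M2 k2" "test_val (Neq 23 22) (R2, M2)"
    then obtain zs where zs: "upath ?p (R2 22) zs y" "set zs \<subseteq> set xs" "R2 23 = ?p (R2 22)"
      "R2 23 \<noteq> R2 22" "6 * length xs + 2 + 4 * length zs \<le> k2"
      "k + 4 * length zs \<le> k2 + 4 * length xs + 3" by (auto simp: I1_def)
    then obtain z zs' where z: "zs = z # zs'" by (cases zs) auto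
    have z': "upath ?p (R2 23) zs' y" "set zs' \<subseteq> set xs" using z zs by auto
    then have "R2 23 < N" using upN by blast
    then show "wp B (Seq (Assign 22 (Copy 23)) (LD 23 5 22)) I1 R2 M2 (k2 - 1)"
      by (intro wp_seq wp_copy wp_LD[where n = n and N = N])
        (use I ok zs z z' in \<open>auto simp: I1_def regs_ok_upd intro!: exI[of _ zs']\<close>)
  next
    fix R2 M2 k2 assume I: "I1 R2 M2 k2" "\<not> test_val (Neq 23 22) (R2, M2)"
    then obtain zs where zs: "upath ?p (R2 22) zs y" "R2 23 = R2 22" "R2 23 = ?p (R2 22)"
      "6 * length xs + 2 + 4 * length zs \<le> k2"
      "k + 4 * length zs \<le> k2 + 4 * length xs + 3" by (auto simp: I1_def)
    then have "zs = []" by (cases zs) auto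
    then have "I2 R2 M2 (k2 - 1)" using I zs up unfolding I1_def I2_def
      by (auto simp: compress_def intro!: ex2I[of _ "[]" xs])
    then show "wp B ?W2 Q R2 M2 (k2 - 1)" by (rule loop2)
  qed
  show ?thesis
    unfolding FIND_def
    by (intro wp_seq wp_copy wp_LD[where n = n and N = N] loop1)
      (use ok x k up in \<open>auto simp: regs_ok_upd I1_def intro!: exI[of _ xs]\<close>)
qed

definition UNION :: com where
  "UNION = Seq (LD 25 6 24) (Seq (LD 26 6 22) (If (Less 26 25) (ST 5 22 24)
     (Seq (ST 5 24 22) (If (Eq 25 26) (Seq (Assign 25 (Add 25 11)) (ST 6 22 25)) Skip))))"

text \<open>The three branches are presented as one: \<open>lo\<close> is hung below
  \<open>hi\<close>, whose rank becomes \<open>s\<close>. The conditions on \<open>s\<close> are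
  those of \<open>uf_inv_link\<close> and \<open>pot_link\<close>.\<close>

lemma wp_UNION:
  assumes ok: "regs_ok n N R" "10 * N \<le> B" "R 24 < N" "R 22 < N" "arr N M 6 (R 24) < N" "12 \<le> k"
    and post: "\<And>lo hi s R' M' k'. (\<And>x. x \<noteq> 13 \<Longrightarrow> x \<noteq> 25 \<Longrightarrow> x \<noteq> 26 \<Longrightarrow> R' x = R x) \<Longrightarrow> regs_ok n N R' \<Longrightarrow>
      lo = R 24 \<and> hi = R 22 \<or> lo = R 22 \<and> hi = R 24 \<Longrightarrow>
      (\<And>j. j \<noteq> 5 \<Longrightarrow> j \<noteq> 6 \<Longrightarrow> arr N M' j = arr N M j) \<Longrightarrow>
      arr N M' 5 = (arr N M 5)(lo := hi) \<Longrightarrow> arr N M' 6 = (arr N M 6)(hi := s) \<Longrightarrow>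
      arr N M 6 hi \<le> s \<Longrightarrow> s \<le> Suc (arr N M 6 hi) \<Longrightarrow> arr N M 6 lo < s \<Longrightarrow> k \<le> k' + 12 \<Longrightarrow> Q R' M' k'"
  shows "wp B UNION Q R M k"
proof -
  have *: "Q R' M' k'"
    if "\<And>x. x \<noteq> 13 \<Longrightarrow> x \<noteq> 25 \<Longrightarrow> x \<noteq> 26 \<Longrightarrow> R' x = R x" "regs_ok n N R'"
      "lo = R 24 \<and> hi = R 22 \<or> lo = R 22 \<and> hi = R 24"
      "\<And>j. arr N M' j = (if j = 5 then (arr N M 5)(lo := hi) else arr N M j)"
      "arr N M 6 lo < arr N M 6 hi" "k \<le> k' + 12" for lo hi R' M' k'
    using that by (intro post[of R' lo hi M' "arr N M 6 hi"]) auto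
  show ?thesis
    unfolding UNION_def
    apply (intro wp_seq wp_skip wp_if wp_add wp_LD[where n = n and N = N] wp_ST[where n = n and N = N])
                        apply (use ok in \<open>auto simp: regs_ok_upd regs_okD arr_aset\<close>)
      apply (rule *[of _ "R 22" "R 24"]; auto simp: regs_ok_upd arr_aset)
     apply (rule post[of _ "R 24" "R 22" _ "Suc (arr N M 6 (R 24))"]; auto simp: regs_ok_upd arr_aset)
    apply (rule *[of _ "R 24" "R 22"]; auto simp: regs_ok_upd arr_aset)
    done
qed

section \<open>Adjacency lists\<close>

text \<open>The arrays of the program are: \<open>0\<close> the input, \<open>1\<close> the first incidence of a vertex, \<open>2\<close> the next
  incidence of the same vertex, \<open>3\<close> the opposite incidence, \<open>4\<close> the incidences chosen for the
  forest, \<open>5\<close> and \<open>6\<close> the parents and ranks of the union-find structure (rank \<open>0\<close> marks a vertex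
  not yet inserted), \<open>7\<close> the vertices visited by the breadth first search, \<open>8\<close> its queue, and
  \<open>9\<close> the vertex to which each queue entry is attached.\<close>

definition LINK :: "nat \<Rightarrow> com" where
  "LINK e = Seq (Assign 16 (Load e)) (Seq (LD 17 1 16) (Seq (ST 2 e 17) (ST 1 16 e)))"

definition BUILD :: com where
  "BUILD = Seq (Assign 14 (Copy 12)) (While (Less 14 2)
     (Seq (Assign 15 (Add 14 11)) (Seq (LINK 14) (Seq (LINK 15)
       (Seq (ST 3 14 15) (Seq (ST 3 15 14) (Assign 14 (Add 15 11))))))))"

text \<open>Address 0 serves as the null pointer: it is the input cell of \<open>n\<close> and never
  an incidence, and memory filled with zeros consists of empty lists.\<close>

fun chain :: "(nat \<Rightarrow> nat) \<Rightarrow> nat \<Rightarrow> nat list \<Rightarrow> bool" where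
  "chain nx e [] \<longleftrightarrow> e = 0"
| "chain nx e (x # xs) \<longleftrightarrow> e = x \<and> e \<noteq> 0 \<and> chain nx (nx e) xs"

lemma chain_cong: "(\<And>x. x \<in> set xs \<Longrightarrow> nx x = nx' x) \<Longrightarrow> chain nx e xs = chain nx' e xs"
  by (induction xs arbitrary: e) auto

lemma sorted_wrt_less_L_distinct: "sorted_wrt (less_L L) vs \<Longrightarrow> distinct vs"
  by (auto simp: sorted_wrt_iff_nth_less distinct_conv_nth less_L_def) (metis linorder_neqE_nat)

text \<open>An incidence is the address \<open>e\<close> of an endpoint in the edge list of the input; \<open>pt e\<close> is the
  address of the other endpoint of the same edge.\<close>

locale ram_graph =
  fixes n m N B K :: nat and I pt :: "nat \<Rightarrow> nat" and E :: "nat set set" and L :: "nat rel"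
    and vs :: "nat list"
  assumes N: "N = 3 + n + 2 * m" and B: "10 * N \<le> B"
    and graph: "simple_graph {..<n} E" and order: "linear_order_on {..<n} L"
    and set_vs: "set vs = {..<n}" and sorted_vs: "sorted_wrt (less_L L) vs"
    and I_vs: "i < n \<Longrightarrow> I (3 + i) = vs ! i"
    and pt_even: "j < m \<Longrightarrow> pt (3 + n + 2 * j) = Suc (3 + n + 2 * j)"
    and pt_odd: "j < m \<Longrightarrow> pt (Suc (3 + n + 2 * j)) = 3 + n + 2 * j"
    and incidence: "e \<in> {3 + n..<N} \<Longrightarrow> {I e, I (pt e)} \<in> E"
    and ex_incidence: "{u, w} \<in> E \<Longrightarrow> \<exists>e\<in>{3 + n..<N}. I e = u \<and> I (pt e) = w"
    and K: "2 * m + 1 < ack K 1"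
begin

abbreviation Inc :: "nat set" where "Inc \<equiv> {3 + n..<N}"

lemma Inc_cases:
  assumes "e \<in> Inc"
  obtains j where "j < m" "e = 3 + n + 2 * j" | j where "j < m" "e = Suc (3 + n + 2 * j)"
proof (cases "even (e - (3 + n))")
  case True
  then obtain j where "e - (3 + n) = 2 * j" by blast
  then have "e = 3 + n + 2 * j" "j < m" using assms N by auto
  then show thesis using that by blast
next
  case False
  then obtain j where "e - (3 + n) = Suc (2 * j)" by (metis oddE Suc_eq_plus1)
  then have "e = Suc (3 + n + 2 * j)" "j < m" using assms N by auto
  then show thesis using that by blast
qed

lemma pt: "e \<in> Inc \<Longrightarrow> pt e \<in> Inc" "e \<in> Inc \<Longrightarrow> pt (pt e) = e"
  by (erule Inc_cases; use N pt_even pt_odd in \<open>simp add: pt_even pt_odd\<close>)+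

lemma edge_lt: "{u, w} \<in> E \<Longrightarrow> u < n \<and> w < n \<and> u \<noteq> w"
  using graph by (auto simp: simple_graph_def all_pairs_def card_2_iff doubleton_eq_iff)

lemma I_lt: "e \<in> Inc \<Longrightarrow> I e < n" "e \<in> Inc \<Longrightarrow> I (pt e) < n" "e \<in> Inc \<Longrightarrow> I (pt e) \<noteq> I e"
  by (drule incidence, drule edge_lt, simp)+

lemmas LD_rule = wp_LD[where n = n and N = N]

lemmas ST_rule = wp_ST[where n = n and N = N]

lemmas load0_rule = wp_load0[where N = N]

lemma n_less_N: "n < N"
  using N by simp

text \<open>\<open>e\<close> is the first incidence not yet linked; the list is reversed because
  \<open>LINK\<close> inserts at the front.\<close>

definition adjl_upto :: "nat \<Rightarrow> nat \<Rightarrow> nat list" where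
  "adjl_upto e u = rev (filter (\<lambda>x. I x = u) [3 + n..<e])"

abbreviation adjl :: "nat \<Rightarrow> nat list" where "adjl \<equiv> adjl_upto N"

definition chains :: "nat \<Rightarrow> (nat \<Rightarrow> nat) \<Rightarrow> bool" where
  "chains e M \<longleftrightarrow> (\<forall>u<n. chain (arr N M 2) (arr N M 1 u) (adjl_upto e u))"

lemma set_adjl: "set (adjl u) = {e \<in> Inc. I e = u}"
  by (auto simp: adjl_upto_def)

lemma chains_link:
  assumes "chains e M" "3 + n \<le> e" "arr N M' 2 = (arr N M 2)(e := arr N M 1 (I e))"
    "arr N M' 1 = (arr N M 1)(I e := e)"
  shows "chains (Suc e) M'"
  unfolding chains_def
proof (intro allI impI)
  fix u assume "u < n"
  then have c: "chain (arr N M 2) (arr N M 1 u) (adjl_upto e u)" using assms(1) by (simp add: chains_def)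
  have "x \<noteq> e" if "x \<in> set (adjl_upto e u)" for x using that by (auto simp: adjl_upto_def)
  then have "chain (arr N M' 2) (arr N M 1 u) (adjl_upto e u)"
    using c chain_cong[of "adjl_upto e u" "arr N M' 2" "arr N M 2"] assms(3) by simp
  moreover have "adjl_upto (Suc e) u = (if I e = u then e # adjl_upto e u else adjl_upto e u)"
    using assms(2) by (simp add: adjl_upto_def)
  ultimately show "chain (arr N M' 2) (arr N M' 1 u) (adjl_upto (Suc e) u)"
    using assms by auto
qed

lemma wp_LINK:
  assumes "regs_ok n N R" "\<forall>a. arr N M 0 a = I a" "chains (R e) M" "R e \<in> Inc" "e = 14 \<or> e = 15" "7 \<le> k"
    and post: "\<And>R' M' k'. regs_ok n N R' \<Longrightarrow> R' 14 = R 14 \<Longrightarrow> R' 15 = R 15 \<Longrightarrow>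
      (\<And>j. j \<noteq> 1 \<Longrightarrow> j \<noteq> 2 \<Longrightarrow> arr N M' j = arr N M j) \<Longrightarrow> chains (Suc (R e)) M' \<Longrightarrow> k \<le> k' + 7 \<Longrightarrow> Q R' M' k'"
  shows "wp B (LINK e) Q R M k"
proof -
  have lt: "R e < N" "I (R e) < N" using I_lt(1)[OF assms(4)] assms(4) n_less_N by auto
  have e: "e \<noteq> 13" "e \<noteq> 16" "e \<noteq> 17" using assms(5) by auto
  show ?thesis
    unfolding LINK_def
    apply (intro wp_seq load0_rule LD_rule ST_rule post)
                        apply (use assms(1-4,6) e lt B in \<open>simp_all add: regs_ok_upd arr_aset\<close>)
    apply (rule chains_link[OF assms(3)])
      apply (use assms(2,4) lt in \<open>auto simp: arr_aset\<close>)
    done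
qed

text \<open>Kruskal's algorithm and the search write only to arrays from 4 on, so
  \<open>ready_cong\<close> carries this through both.\<close>

definition ready :: "(nat \<Rightarrow> nat) \<Rightarrow> (nat \<Rightarrow> nat) \<Rightarrow> bool" where
  "ready R M \<longleftrightarrow> regs_ok n N R \<and> (\<forall>a. arr N M 0 a = I a) \<and> chains N M \<and> (\<forall>e\<in>Inc. arr N M 3 e = pt e)"

lemma ready_cong: "ready R M \<Longrightarrow> regs_ok n N R' \<Longrightarrow> (\<And>j. j < 4 \<Longrightarrow> arr N M' j = arr N M j) \<Longrightarrow> ready R' M'"
  by (simp add: ready_def chains_def)

text \<open>\<open>c\<close> is the credit set aside for whatever follows, a role played by
  \<open>cr\<close> in the later phases. Linking both incidences of an edge and recording them as
  opposite takes at most 22 units.\<close>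

lemma wp_BUILD:
  assumes ok: "regs_ok n N R" "\<forall>a. arr N M 0 a = I a" "\<And>u. u < n \<Longrightarrow> arr N M 1 u = 0" "22 * m + 2 + c \<le> k"
    and post: "\<And>R' M' k'. ready R' M' \<Longrightarrow> (\<And>j. 4 \<le> j \<Longrightarrow> arr N M' j = arr N M j) \<Longrightarrow> c \<le> k' \<Longrightarrow> Q R' M' k'"
  shows "wp B BUILD Q R M k"
proof -
  define J where "J R' M' k' \<longleftrightarrow> regs_ok n N R' \<and> (\<forall>a. arr N M' 0 a = I a) \<and> (\<forall>j\<ge>4. arr N M' j = arr N M j) \<and>
    chains (R' 14) M' \<and> (\<forall>e\<in>{3 + n..<R' 14}. arr N M' 3 e = pt e) \<and>
    (\<exists>j\<le>m. R' 14 = 3 + n + 2 * j \<and> 22 * (m - j) + 1 + c \<le> k')" for R' M' k'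
  have loop: "wp B (While (Less 14 2)
     (Seq (Assign 15 (Add 14 11)) (Seq (LINK 14) (Seq (LINK 15)
       (Seq (ST 3 14 15) (Seq (ST 3 15 14) (Assign 14 (Add 15 11)))))))) Q R' M' k'"
    if "J R' M' k'" for R' M' k'
  proof (rule wp_while[where I = J])
    show "J R' M' k'" by (rule that)
  next
    fix R M k assume "J R M k"
    then show "1 \<le> k" by (auto simp: J_def)
  next
    fix R1 M1 k1 assume J: "J R1 M1 k1" "test_val (Less 14 2) (R1, M1)"
    then obtain j where j: "j \<le> m" "R1 14 = 3 + n + 2 * j" "22 * (m - j) + 1 + c \<le> k1"
      and ok: "regs_ok n N R1" by (auto simp: J_def)
    have "R1 14 < N" using J regs_okD[OF ok] by auto
    then have jm: "j < m" using j N by auto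
    then have k1: "22 + (22 * (m - Suc j) + 1 + c) \<le> k1" using j by (simp add: Suc_diff_Suc[symmetric])
    show "wp B (Seq (Assign 15 (Add 14 11)) (Seq (LINK 14) (Seq (LINK 15)
       (Seq (ST 3 14 15) (Seq (ST 3 15 14) (Assign 14 (Add 15 11))))))) J R1 M1 (k1 - 1)"
    proof (intro wp_seq wp_add)
      have eN: "Suc (3 + n + 2 * j) < N" using jm N by simp
      let ?R1 = "R1(15 := R1 14 + R1 11)"
      have r1: "?R1 14 = 3 + n + 2 * j" "?R1 15 = Suc (3 + n + 2 * j)" using j regs_okD[OF ok] by auto
      show "R1 14 + R1 11 \<le> B" using r1 eN B by simp
      show "1 \<le> k1 - 1" using k1 by simp
      show "wp B (LINK 14) (wp B (Seq (LINK 15)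
         (Seq (ST 3 14 15) (Seq (ST 3 15 14) (Assign 14 (Add 15 11))))) J) ?R1 M1 (k1 - 1 - 1)"
      proof (rule wp_LINK)
        fix R2 M2 k2
        assume 2: "regs_ok n N R2" "R2 14 = ?R1 14" "R2 15 = ?R1 15"
          "\<And>j. j \<noteq> 1 \<Longrightarrow> j \<noteq> 2 \<Longrightarrow> arr N M2 j = arr N M1 j" "chains (Suc (?R1 14)) M2" "k1 - 1 - 1 \<le> k2 + 7"
        show "wp B (Seq (LINK 15) (Seq (ST 3 14 15) (Seq (ST 3 15 14) (Assign 14 (Add 15 11))))) J R2 M2 k2"
        proof (rule wp_seq, rule wp_LINK)
          fix R3 M3 k3
          assume 3: "regs_ok n N R3" "R3 14 = R2 14" "R3 15 = R2 15"
            "\<And>j. j \<noteq> 1 \<Longrightarrow> j \<noteq> 2 \<Longrightarrow> arr N M3 j = arr N M2 j" "chains (Suc (R2 15)) M3" "k2 \<le> k3 + 7"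
          have e: "R3 14 = 3 + n + 2 * j" "R3 15 = Suc (3 + n + 2 * j)" "R3 11 = 1"
            using 2(2,3) 3(2,3) r1 regs_okD[OF 3(1)] by auto
          have same: "arr N M3 i = arr N M1 i" if "i \<noteq> 1" "i \<noteq> 2" for i using 2(4) 3(4) that by simp
          have ch: "chains (Suc (Suc (3 + n + 2 * j))) M3" using 3(5) 2(3) r1 by simp
          have k3: "22 * (m - Suc j) + 1 + c \<le> k3 - 5" "5 \<le> k3" using 2(6) 3(6) k1 by linarith+
          have old: "arr N M1 3 e = pt e" if "3 + n \<le> e" "e < 3 + n + 2 * j" for e
            using J j that by (auto simp: J_def)
          have J1: "\<And>a. arr N M1 0 a = I a" "\<And>i. 4 \<le> i \<Longrightarrow> arr N M1 i = arr N M i" using J by (auto simp: J_def)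
          let ?M = "aset N (aset N M3 3 (3 + n + 2 * j) (Suc (3 + n + 2 * j))) 3 (Suc (3 + n + 2 * j)) (3 + n + 2 * j)"
          have "J (R3(13 := x, 13 := y, 14 := Suc (Suc (3 + n + 2 * j)))) ?M (k3 - 5)" for x y
            unfolding J_def
          proof (intro conjI ballI allI impI)
            show "chains ((R3(13 := x, 13 := y, 14 := Suc (Suc (3 + n + 2 * j)))) 14) ?M"
              using ch eN by (simp add: chains_def arr_aset)
            show "\<exists>i\<le>m. (R3(13 := x, 13 := y, 14 := Suc (Suc (3 + n + 2 * j)))) 14 = 3 + n + 2 * i \<and>
              22 * (m - i) + 1 + c \<le> k3 - 5"
              using jm k3 by (intro exI[of _ "Suc j"]) auto
            show "arr N ?M 3 e = pt e" if "e \<in> {3 + n..<(R3(13 := x, 13 := y, 14 := Suc (Suc (3 + n + 2 * j)))) 14}" for e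
              using that eN old[of e] same[of 3] pt_even[OF jm] pt_odd[OF jm]
              by (auto simp: arr_aset less_Suc_eq)
          qed (use 3(1) eN same J1 in \<open>auto simp: regs_ok_upd arr_aset\<close>)
          then show "wp B (Seq (ST 3 14 15) (Seq (ST 3 15 14) (Assign 14 (Add 15 11)))) J R3 M3 k3"
            by (intro wp_seq wp_add ST_rule)
              (use 3(1) e eN k3 B in \<open>simp_all add: regs_ok_upd\<close>)
        qed (use 2 r1 eN J k1 in \<open>auto simp: J_def\<close>)
      qed (use J ok r1 eN k1 in \<open>auto simp: J_def regs_ok_upd\<close>)
    qed
  next
    fix R1 M1 k1 assume J: "J R1 M1 k1" "\<not> test_val (Less 14 2) (R1, M1)"
    then obtain j where j: "j \<le> m" "R1 14 = 3 + n + 2 * j" "22 * (m - j) + 1 + c \<le> k1"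
      and ok: "regs_ok n N R1" by (auto simp: J_def)
    have "R1 14 = N" using J regs_okD[OF ok] j N by auto
    then show "Q R1 M1 (k1 - 1)" using J j by (intro post) (auto simp: J_def ready_def)
  qed
  show ?thesis
    unfolding BUILD_def
    by (intro wp_seq wp_copy loop)
      (use ok regs_okD[OF ok(1)] in \<open>auto simp: J_def regs_ok_upd chains_def adjl_upto_def\<close>)
qed

end

section \<open>The program for Kruskal's algorithm\<close>

text \<open>Register 16 is the vertex just inserted, 17 the incidence under inspection, 18 its
  opposite, 19 the neighbour; 24 and 22 are the two roots. Both incidences of a chosen edge are
  marked, so that the forest can be walked from either end.\<close>

definition CHOOSE :: com where
  "CHOOSE = If (Neq 24 22) (Seq UNION (Seq (ST 4 17 11) (ST 4 18 11))) Skip"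

definition JOIN :: com where
  "JOIN = Seq (Assign 21 (Copy 16)) (Seq FIND (Seq (Assign 24 (Copy 22))
     (Seq (Assign 21 (Copy 19)) (Seq FIND
       CHOOSE))))"

text \<open>Rank 0 means that the neighbour has not been inserted; the edge is then met again from
  its other end.\<close>

definition SCAN :: com where
  "SCAN = Seq (LD 18 3 17) (Seq (Assign 19 (Load 18)) (Seq (LD 20 6 19)
     (Seq (If (Neq 20 0) JOIN Skip) (LD 17 2 17))))"

definition INSERT :: com where
  "INSERT = Seq (Assign 14 (Sub 14 11)) (Seq (Assign 15 (Const 3)) (Seq (Assign 15 (Add 15 14))
       (Seq (Assign 16 (Load 15)) (Seq (ST 5 16 16) (Seq (ST 6 16 11) (Seq (LD 17 1 16)
         (While (Neq 17 0) SCAN)))))))"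

definition KRUSKAL :: com where
  "KRUSKAL = Seq (Assign 14 (Copy 1)) (While (Less 0 14) INSERT)"

lemma upath_distinct:
  assumes "uf_inv A p rk \<rho>" "upath p x xs y" "x \<in> A"
  shows "distinct xs"
  using assms(2,3)
proof (induction xs arbitrary: x)
  case (Cons z zs)
  then have x: "p x \<in> A" "rk x < rk (p x)" "z = x" "upath p (p x) zs y"
    using assms(1) by (auto simp: uf_inv_def)
  then have "x \<notin> set zs" using upath_facts[OF assms(1) x(4) x(1)] by (meson linorder_not_le)
  then show ?case using Cons.IH x by auto
qed simp

lemma kforest_mono: "kforest E L D U \<Longrightarrow> D' \<subseteq> D \<Longrightarrow> kforest E L D' U"
  unfolding kforest_def by blast

context ram_graph
begin

section \<open>Invariant and amortised cost of Kruskal's algorithm\<close>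

definition forest_of :: "(nat \<Rightarrow> nat) \<Rightarrow> nat set set" where
  "forest_of M = {{I e, I (pt e)} |e. e \<in> Inc \<and> arr N M 4 e \<noteq> 0}"

definition potential :: "nat set \<Rightarrow> (nat \<Rightarrow> nat) \<Rightarrow> nat" where
  "potential A M = (\<Sum>x\<in>A. pot K (arr N M 5) (arr N M 6) x)"

text \<open>\<open>A\<close> is the set of inserted vertices and \<open>c\<close> counts scanned
  incidences. A scan raises at most one rank, by at most one, whence the bound \<open>1 + c\<close>;
  with \<open>c \<le> 2 * m\<close> all ranks stay below \<open>ack K 1\<close>.\<close>

definition kinv :: "nat set \<Rightarrow> nat set set \<Rightarrow> nat \<Rightarrow> (nat \<Rightarrow> nat) \<Rightarrow> bool" where
  "kinv A D c M \<longleftrightarrow> A \<subseteq> {..<n} \<and>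
     (\<exists>\<rho>. uf_inv A (arr N M 5) (arr N M 6) \<rho> \<and> classes A \<rho> (forest_of M)) \<and>
     kforest E L D (forest_of M) \<and> (\<forall>x<n. arr N M 6 x \<noteq> 0 \<longleftrightarrow> x \<in> A) \<and>
     (\<forall>x\<in>A. arr N M 6 x \<le> 1 + c) \<and> (\<forall>e\<in>Inc. arr N M 4 (pt e) = arr N M 4 e)"

lemma forest_of_cong: "arr N M' 4 = arr N M 4 \<Longrightarrow> forest_of M' = forest_of M"
  by (simp add: forest_of_def)

text \<open>The potential has weight 10 because each vertex on a compressed path costs 10 units of
  time.\<close>

lemma wp_FIND_uf:
  assumes ok: "regs_ok n N R" and A: "A \<subseteq> {..<n}" and inv: "uf_inv A (arr N M 5) (arr N M 6) \<rho>"
    and x: "R 21 \<in> A" and bd: "\<And>x. x \<in> A \<Longrightarrow> arr N M 6 x < ack K 1"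
    and k: "10 * potential A M + 10 * K + 5 + c \<le> k"
    and post: "\<And>R' M' k'. (\<And>x. x \<noteq> 13 \<Longrightarrow> x \<noteq> 21 \<Longrightarrow> x \<noteq> 22 \<Longrightarrow> x \<noteq> 23 \<Longrightarrow> R' x = R x) \<Longrightarrow>
      R' 22 = \<rho> (R 21) \<Longrightarrow> (\<And>j. j \<noteq> 5 \<Longrightarrow> arr N M' j = arr N M j) \<Longrightarrow>
      uf_inv A (arr N M' 5) (arr N M' 6) \<rho> \<Longrightarrow> 10 * potential A M' + c \<le> k' \<Longrightarrow> regs_ok n N R' \<Longrightarrow>
      Q R' M' k'"
  shows "wp B FIND Q R M k"
proof -
  obtain xs where up: "upath (arr N M 5) (R 21) xs (\<rho> (R 21))"
    using ex_upath[OF inv less_imp_le[OF bd] x] by blast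
  note f = upath_facts[OF inv up x]
  have p: "length xs + (\<Sum>z\<in>A. pot K (compress (arr N M 5) xs (\<rho> (R 21))) (arr N M 6) z) \<le> K + potential A M"
    unfolding potential_def by (rule pot_compress[OF inv up x bd])
  show ?thesis
  proof (rule wp_FIND[OF ok B up upath_distinct[OF inv up x]])
    show "z < N" if "z \<in> set xs" for z
    proof -
      have "z \<in> A" using f that by blast
      then show ?thesis using A n_less_N by auto
    qed
    have "\<rho> (R 21) \<in> A" using f by blast
    then show "\<rho> (R 21) < N" using A n_less_N by auto
    show "10 * length xs + 5 \<le> k" using p k by linarith
  next
    fix R' M' k'
    assume a: "\<And>x. x \<noteq> 13 \<Longrightarrow> x \<noteq> 21 \<Longrightarrow> x \<noteq> 22 \<Longrightarrow> x \<noteq> 23 \<Longrightarrow> R' x = R x" "R' 22 = \<rho> (R 21)"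
      "\<And>j. j \<noteq> 5 \<Longrightarrow> arr N M' j = arr N M j" "arr N M' 5 = compress (arr N M 5) xs (\<rho> (R 21))"
      "k \<le> k' + (10 * length xs + 5)" "regs_ok n N R'"
    have "length xs + potential A M' \<le> K + potential A M"
      using p a(3,4) by (simp add: potential_def)
    then have "10 * potential A M' + c \<le> k'" using k a(5) by linarith
    moreover have "uf_inv A (arr N M' 5) (arr N M' 6) \<rho>"
      using uf_inv_compress[OF inv up x] a(3,4) by simp
    ultimately show "Q R' M' k'" using a by (intro post) auto
  qed
qed

lemma forest_of_add:
  assumes "e \<in> Inc" "arr N M' 4 = (arr N M 4)(e := 1, pt e := 1)"
  shows "forest_of M' = insert {I e, I (pt e)} (forest_of M)"
  using assms pt[OF assms(1)] unfolding forest_of_def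
  by (auto simp: insert_commute split: if_splits)

text \<open>The \<open>30 * K\<close> pay for two finds and one link, at \<open>10 * K\<close>
  each.\<close>

lemma wp_JOIN:
  assumes ok: "regs_ok n N R" and inv: "kinv A D c M" and c: "c < 2 * m"
    and e: "R 17 \<in> Inc" "R 18 = pt (R 17)" "R 16 = I (R 17)" "R 19 = I (pt (R 17))"
    and A: "R 16 \<in> A" "R 19 \<in> A" and less: "less_L L (R 16) (R 19)"
    and above: "\<And>a b. {a, b} \<in> E \<Longrightarrow> less_L L (R 16) a \<Longrightarrow> less_L L (R 16) b \<Longrightarrow> {a, b} \<in> D"
    and k: "10 * potential A M + 30 * K + 40 + cr \<le> k"
    and post: "\<And>R' M' k'. regs_ok n N R' \<Longrightarrow> (\<And>x. 13 < x \<Longrightarrow> x < 20 \<Longrightarrow> R' x = R x) \<Longrightarrow>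
      (\<And>j. j \<noteq> 4 \<Longrightarrow> j \<noteq> 5 \<Longrightarrow> j \<noteq> 6 \<Longrightarrow> arr N M' j = arr N M j) \<Longrightarrow>
      kinv A (insert {R 16, R 19} D) (Suc c) M' \<Longrightarrow> 10 * potential A M' + cr \<le> k' \<Longrightarrow> Q R' M' k'"
  shows "wp B JOIN Q R M k"
proof -
  obtain \<rho> where An: "A \<subseteq> {..<n}" and uf: "uf_inv A (arr N M 5) (arr N M 6) \<rho>"
    and cl: "classes A \<rho> (forest_of M)"
    and kf: "kforest E L D (forest_of M)" and act: "\<forall>x<n. arr N M 6 x \<noteq> 0 \<longleftrightarrow> x \<in> A"
    and rk: "\<forall>x\<in>A. arr N M 6 x \<le> 1 + c" and sy: "\<forall>e\<in>Inc. arr N M 4 (pt e) = arr N M 4 e"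
    using inv by (auto simp: kinv_def)
  have bd: "arr N M 6 x < ack K 1" if "x \<in> A" for x using rk that c K by fastforce
  have anti: "antisym L" using order by (simp add: linear_order_on_def partial_order_on_def)
  have conn: "\<rho> (R 16) = \<rho> (R 19) \<longleftrightarrow> (R 16, R 19) \<in> (adj_on UNIV (forest_of M))\<^sup>*"
    using cl A by (simp add: classes_def)
  have uw: "{R 16, R 19} \<in> E" using incidence[OF e(1)] e by simp
  show ?thesis
    unfolding JOIN_def
  proof (intro wp_seq wp_copy)
    show "1 \<le> k" using k by simp
    let ?R = "R(21 := R 16)"
    let ?c = "Seq (Assign 24 (Copy 22)) (Seq (Assign 21 (Copy 19)) (Seq FIND CHOOSE))"
    show "wp B FIND (wp B ?c Q) ?R M (k - 1)"
    proof (rule wp_FIND_uf[OF _ An uf _ bd, where c = "20 * K + 34 + cr"])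
      fix R1 M1 k1
      assume R1: "\<And>x. x \<noteq> 13 \<Longrightarrow> x \<noteq> 21 \<Longrightarrow> x \<noteq> 22 \<Longrightarrow> x \<noteq> 23 \<Longrightarrow> R1 x = ?R x" "R1 22 = \<rho> (?R 21)"
        "\<And>j. j \<noteq> 5 \<Longrightarrow> arr N M1 j = arr N M j" "uf_inv A (arr N M1 5) (arr N M1 6) \<rho>"
        "10 * potential A M1 + (20 * K + 34 + cr) \<le> k1" "regs_ok n N R1"
      let ?R1 = "R1(24 := R1 22, 21 := (R1(24 := R1 22)) 19)"
      have R1_19: "R1 19 = R 19" using R1(1) by simp
      show "wp B ?c Q R1 M1 k1"
      proof (intro wp_seq wp_copy)
        show "1 \<le> k1" "1 \<le> k1 - 1" using R1(5) by auto
        have "wp B FIND (wp B CHOOSE Q) ?R1 M1 (k1 - 2)"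
        proof (rule wp_FIND_uf[OF _ An R1(4), where c = "10 * K + 25 + cr"])
          show "regs_ok n N ?R1" using R1(6) by (simp add: regs_ok_upd)
          show "?R1 21 \<in> A" using A R1_19 by simp
          show "arr N M1 6 x < ack K 1" if "x \<in> A" for x using bd that R1(3) by simp
          show "10 * potential A M1 + 10 * K + 5 + (10 * K + 25 + cr) \<le> k1 - 2" using R1(5) by simp
          fix R2 M2 k2
          assume R2: "\<And>x. x \<noteq> 13 \<Longrightarrow> x \<noteq> 21 \<Longrightarrow> x \<noteq> 22 \<Longrightarrow> x \<noteq> 23 \<Longrightarrow> R2 x = ?R1 x"
            "R2 22 = \<rho> (?R1 21)" "\<And>j. j \<noteq> 5 \<Longrightarrow> arr N M2 j = arr N M1 j"
            "uf_inv A (arr N M2 5) (arr N M2 6) \<rho>" "10 * potential A M2 + (10 * K + 25 + cr) \<le> k2" "regs_ok n N R2"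
          have regs: "R2 22 = \<rho> (R 19)" "R2 24 = \<rho> (R 16)" "R2 17 = R 17" "R2 18 = R 18"
            "\<And>x. 13 < x \<Longrightarrow> x < 20 \<Longrightarrow> R2 x = R x"
            using R2(1,2) R1(1,2) R1_19 by auto
          have arrs: "arr N M2 j = arr N M j" if "j \<noteq> 5" for j using R2(3) R1(3) that by auto
          have fo: "forest_of M2 = forest_of M" using arrs by (intro forest_of_cong) simp
          have roots: "\<rho> (R 16) \<in> A" "\<rho> (R 19) \<in> A" "arr N M2 5 (\<rho> (R 16)) = \<rho> (R 16)"
            "arr N M2 5 (\<rho> (R 19)) = \<rho> (R 19)"
            using R2(4) A by (auto simp: uf_inv_def)
          have lt: "\<rho> (R 16) < N" "\<rho> (R 19) < N" "R 17 < N" "R 18 < N"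
            using roots An n_less_N e pt(1)[OF e(1)] by auto
          show "wp B CHOOSE Q R2 M2 k2"
            unfolding CHOOSE_def
          proof (rule wp_if)
            show "1 \<le> k2" using R2(5) by simp
          next
            assume "\<not> test_val (Neq 24 22) (R2, M2)"
            then have eq: "\<rho> (R 16) = \<rho> (R 19)" using regs by simp
            then have "kforest E L (insert {R 16, R 19} D) (forest_of M2)"
              using kforest_skip[OF kf] conn fo by simp
            then have "kinv A (insert {R 16, R 19} D) (Suc c) M2"
              unfolding kinv_def using An R2(4) cl fo act rk sy arrs
              by (auto intro!: exI[of _ \<rho>] simp: le_SucI)
            then show "wp B Skip Q R2 M2 (k2 - 1)"
              using R2(5,6) regs arrs by (intro wp_skip post) auto
          next
            assume "test_val (Neq 24 22) (R2, M2)"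
            then have neq: "\<rho> (R 16) \<noteq> \<rho> (R 19)" using regs by simp
            have rkN: "arr N M2 6 (R2 24) < N" using regs arrs[of 6] rk roots c N by fastforce
            show "wp B (Seq UNION (Seq (ST 4 17 11) (ST 4 18 11))) Q R2 M2 (k2 - 1)"
            proof (rule wp_seq, rule wp_UNION[OF R2(6) B _ _ rkN])
              fix lo hi s R3 M3 k3
              assume R3: "\<And>x. x \<noteq> 13 \<Longrightarrow> x \<noteq> 25 \<Longrightarrow> x \<noteq> 26 \<Longrightarrow> R3 x = R2 x" "regs_ok n N R3"
                and lohi: "lo = R2 24 \<and> hi = R2 22 \<or> lo = R2 22 \<and> hi = R2 24"
                and M3: "\<And>j. j \<noteq> 5 \<Longrightarrow> j \<noteq> 6 \<Longrightarrow> arr N M3 j = arr N M2 j"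
                "arr N M3 5 = (arr N M2 5)(lo := hi)" "arr N M3 6 = (arr N M2 6)(hi := s)"
                and s: "arr N M2 6 hi \<le> s" "s \<le> Suc (arr N M2 6 hi)" "arr N M2 6 lo < s"
                and k3: "k2 - 1 \<le> k3 + 12"
              have lh: "lo \<in> A" "hi \<in> A" "arr N M2 5 lo = lo" "arr N M2 5 hi = hi" "lo \<noteq> hi"
                using lohi regs roots neq by auto
              let ?\<rho> = "\<lambda>z. if \<rho> z = lo then hi else \<rho> z"
              let ?M = "aset N (aset N M3 4 (R 17) 1) 4 (R 18) 1"
              have arr4: "arr N ?M 4 = (arr N M 4)(R 17 := 1, pt (R 17) := 1)"
                using lt e M3(1) arrs by (simp add: arr_aset)
              have arr56: "arr N ?M 5 = (arr N M2 5)(lo := hi)" "arr N ?M 6 = (arr N M2 6)(hi := s)"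
                using lt M3 by (simp_all add: arr_aset)
              have arrj: "arr N ?M j = arr N M j" if "j \<noteq> 4" "j \<noteq> 5" "j \<noteq> 6" for j
                using lt M3 arrs that by (simp add: arr_aset)
              have fo': "forest_of ?M = insert {R 16, R 19} (forest_of M)"
                using forest_of_add[OF e(1) arr4] e by simp
              have 1: "uf_inv A (arr N ?M 5) (arr N ?M 6) ?\<rho>"
                unfolding arr56 by (rule uf_inv_link[OF R2(4) lh s(1,3)])
              have 2: "classes A ?\<rho> (forest_of ?M)"
                unfolding fo' using lohi regs by (intro classes_link[OF cl A]) auto
              have 3: "kforest E L (insert {R 16, R 19} D) (forest_of ?M)"
                unfolding fo' using neq conn by (intro kforest_add[OF kf anti uw less _ above]) auto
              have a6: "arr N M2 6 = arr N M 6" using arrs by simp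
              have 4: "\<forall>x<n. arr N ?M 6 x \<noteq> 0 \<longleftrightarrow> x \<in> A"
                unfolding arr56 a6
              proof (intro allI impI)
                fix x assume "x < n"
                then show "((arr N M 6)(hi := s)) x \<noteq> 0 \<longleftrightarrow> x \<in> A"
                  using act s(3) lh(2) by (cases "x = hi") auto
              qed
              have rk4: "\<forall>x\<in>A. arr N ?M 6 x \<le> 1 + Suc c"
                unfolding arr56 a6
              proof
                fix x assume "x \<in> A"
                then have "arr N M 6 x \<le> 1 + c" using rk by blast
                then show "((arr N M 6)(hi := s)) x \<le> 1 + Suc c"
                  using s(2) a6 by (cases "x = hi") auto
              qed
              have 5: "\<forall>e\<in>Inc. arr N ?M 4 (pt e) = arr N ?M 4 e"
              proof
                fix f assume f: "f \<in> Inc"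
                have "pt f = R 17 \<longleftrightarrow> f = pt (R 17)" "pt f = pt (R 17) \<longleftrightarrow> f = R 17"
                  using pt(2)[OF f] pt(2)[OF e(1)] by metis+
                moreover have "arr N M 4 (pt f) = arr N M 4 f" using sy f by blast
                ultimately show "arr N ?M 4 (pt f) = arr N ?M 4 f" unfolding arr4 using pt(2)[OF e(1)] by simp
              qed
              have ki: "kinv A (insert {R 16, R 19} D) (Suc c) ?M"
                unfolding kinv_def using An 1 2 3 4 rk4 5 by blast
              have "potential A ?M \<le> K + potential A M2"
                unfolding potential_def arr56 by (rule pot_link[OF R2(4) lh s(1,2)])
              then have k4: "10 * potential A ?M + cr \<le> k3 - 4" "4 \<le> k3" using k3 R2(5) by linarith+
              have R3': "R3 17 = R 17" "R3 18 = R 18" "R3 11 = 1" "\<And>x. 13 < x \<Longrightarrow> x < 20 \<Longrightarrow> R3 x = R x"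
                using R3 regs regs_okD[OF R3(2)] by auto
              show "wp B (Seq (ST 4 17 11) (ST 4 18 11)) Q R3 M3 k3"
              proof (intro wp_seq ST_rule, goal_cases)
                \<comment> \<open>The postcondition after the second store; the other fourteen
                  subgoals are side conditions of the two stores.\<close>
                case 15
                show ?case
                  using R3(2) R3' ki k4 arrj by (intro post) (auto simp: regs_ok_upd)
              qed (use R3 R3' B lt k4 in \<open>auto simp: regs_ok_upd\<close>)
            qed (use R2(5) regs lt in auto)
          qed
        qed
        then show "wp B FIND (wp B CHOOSE Q) ?R1 M1 (k1 - 1 - 1)"
          by (simp add: numeral_2_eq_2)
      qed
    qed (use ok A k in \<open>auto simp: regs_ok_upd\<close>)
  qed
qed

section \<open>Suffixes of the ordering and sums of degrees\<close>

lemma less_L_asym: "less_L L x y \<Longrightarrow> \<not> less_L L y x"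
  using order by (auto simp: less_L_def linear_order_on_def partial_order_on_def dest: antisymD)

lemma distinct_vs: "distinct vs"
  using sorted_vs by (rule sorted_wrt_less_L_distinct)

lemma length_vs: "length vs = n"
  using distinct_card[OF distinct_vs] set_vs by simp

text \<open>Turns the order into list positions: the vertices inserted before \<open>vs ! i\<close>
  form the suffix after position \<open>i\<close>, and these are exactly the ones above it.\<close>

lemma after_iff:
  assumes "i < n" "x < n"
  shows "x \<in> set (drop (Suc i) vs) \<longleftrightarrow> less_L L (vs ! i) x"
proof -
  obtain j where j: "j < n" "x = vs ! j" using assms(2) set_vs length_vs by (metis in_set_conv_nth lessThan_iff)
  have "x \<in> set (drop (Suc i) vs) \<longleftrightarrow> i < j"
  proof
    assume "x \<in> set (drop (Suc i) vs)"
    then obtain l where "l < n - Suc i" "x = vs ! (Suc i + l)"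
      using length_vs by (auto simp: in_set_conv_nth)
    then have "j = Suc i + l" using j distinct_vs length_vs by (simp add: nth_eq_iff_index_eq)
    then show "i < j" by simp
  next
    assume "i < j"
    then have "x = drop (Suc i) vs ! (j - Suc i)" "j - Suc i < length (drop (Suc i) vs)"
      using j length_vs by auto
    then show "x \<in> set (drop (Suc i) vs)" using nth_mem by metis
  qed
  moreover have "i < j \<Longrightarrow> less_L L (vs ! i) x" "j < i \<Longrightarrow> less_L L x (vs ! i)"
    using sorted_vs j assms length_vs by (auto simp: sorted_wrt_iff_nth_less)
  moreover have "\<not> less_L L x x" by (simp add: less_L_def)
  ultimately show ?thesis using less_L_asym j(2) by (metis linorder_neqE_nat)
qed

lemma drop_vs: "i < n \<Longrightarrow> drop i vs = vs ! i # drop (Suc i) vs"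
  using length_vs by (simp add: Cons_nth_drop_Suc)

definition degsum :: "nat list \<Rightarrow> nat" where
  "degsum us = sum_list (map (length \<circ> adjl) us)"

text \<open>Handshake count: every incidence belongs to one vertex, and there are two per
  edge.\<close>

lemma degsum_vs: "degsum vs = 2 * m"
proof -
  have "length (adjl u) = card {e \<in> Inc. I e = u}" for u
    using distinct_card[of "adjl u"] set_adjl[of u] by (simp add: adjl_upto_def)
  then have "degsum vs = (\<Sum>u\<in>{..<n}. card {e \<in> Inc. I e = u})"
    unfolding degsum_def using distinct_vs set_vs by (simp add: sum_list_distinct_conv_sum_set)
  also have "\<dots> = (\<Sum>u\<in>{..<n}. \<Sum>e\<in>{e \<in> Inc. I e = u}. 1)" by simp
  also have "\<dots> = (\<Sum>e\<in>Inc. 1)"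
    using I_lt(1) by (intro sum.group) auto
  also have "\<dots> = 2 * m" using N by simp
  finally show ?thesis .
qed

lemma kinv_mono: "kinv A D c M \<Longrightarrow> D' \<subseteq> D \<Longrightarrow> c \<le> c' \<Longrightarrow> kinv A D' c' M"
  unfolding kinv_def by (meson add_left_mono kforest_mono le_trans)

text \<open>The value of \<open>D\<close> midway through the list of \<open>vs ! i\<close>. Its
  first part is what \<open>kforest_add\<close> demands as \<open>above\<close>.\<close>

definition done_edges :: "nat \<Rightarrow> nat list \<Rightarrow> nat set set" where
  "done_edges i ds = {e \<in> E. e \<subseteq> set (drop (Suc i) vs)} \<union>
     {{vs ! i, I (pt e)} |e. e \<in> set ds \<and> I (pt e) \<in> set (drop i vs)}"

text \<open>\<open>ds\<close> has been read and \<open>es\<close> remains, each remaining incidence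
  carrying \<open>30 * K + 60\<close> credits. That array 7 is still zero is kept for the search
  that follows.\<close>

definition sinv :: "nat \<Rightarrow> nat \<Rightarrow> (nat \<Rightarrow> nat) \<Rightarrow> (nat \<Rightarrow> nat) \<Rightarrow> nat \<Rightarrow> bool" where
  "sinv i cr R M k \<longleftrightarrow> ready R M \<and> R 14 = i \<and> R 16 = vs ! i \<and> (\<forall>a. arr N M 7 a = 0) \<and>
     (\<exists>ds es. adjl (vs ! i) = ds @ es \<and> chain (arr N M 2) (R 17) es \<and>
        kinv (set (drop i vs)) (done_edges i ds) (degsum (drop (Suc i) vs) + length ds) M \<and>
        10 * potential (set (drop i vs)) M + (30 * K + 60) * length es + 1 + cr \<le> k)"

lemma wp_SCAN:
  assumes i: "i < n" and S: "sinv i cr R M k" and ne: "R 17 \<noteq> 0"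
  shows "wp B SCAN (sinv i cr) R M (k - 1)"
proof -
  let ?next = "wp B (LD 17 2 17) (sinv i cr)"
  let ?u = "vs ! i" and ?A = "set (drop i vs)" and ?Y = "set (drop (Suc i) vs)"
  let ?D = "done_edges i"
  have rdy: "ready R M" and R: "R 14 = i" "R 16 = ?u" and vis: "\<forall>a. arr N M 7 a = 0"
    using S by (auto simp: sinv_def)
  obtain ds es' where ds: "adjl ?u = ds @ es'" "chain (arr N M 2) (R 17) es'"
    "kinv ?A (?D ds) (degsum (drop (Suc i) vs) + length ds) M"
    "10 * potential ?A M + (30 * K + 60) * length es' + 1 + cr \<le> k"
    using S unfolding sinv_def by blast
  then obtain es where es: "es' = R 17 # es" using ne by (cases es') auto
  have e: "R 17 \<in> Inc" "I (R 17) = ?u" using ds(1) es set_adjl[of ?u] by auto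
  note ok = rdy[unfolded ready_def]
  let ?w = "I (pt (R 17))"
  have w: "?w < n" "?w \<noteq> ?u" using I_lt[OF e(1)] e(2) by auto
  have lt: "R 17 < N" "pt (R 17) < N" "?w < N" using e pt(1)[OF e(1)] w n_less_N by auto
  have A: "?A = insert ?u ?Y" using drop_vs[OF i] by simp
  \<comment> \<open>One incidence is still unread, so the scan counter is strictly below
    \<open>2 * m\<close> and leaves room for one more increase of a rank.\<close>
  have cs: "degsum (drop (Suc i) vs) + length ds < 2 * m"
  proof -
    have "degsum vs = degsum (take i vs) + degsum (drop i vs)"
      unfolding degsum_def by (metis append_take_drop_id map_append sum_list_append)
    moreover have "degsum (drop i vs) = length (adjl ?u) + degsum (drop (Suc i) vs)"
      using drop_vs[OF i] by (simp add: degsum_def)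
    ultimately show ?thesis using degsum_vs ds(1) es by simp
  qed
  have k: "10 * potential ?A M + (30 * K + 60) + ((30 * K + 60) * length es + 1 + cr) \<le> k"
    using ds(4) es by simp
  let ?R = "R(13 := 3 * N + R 17, 18 := pt (R 17), 19 := ?w, 13 := 6 * N + ?w, 20 := arr N M 6 ?w)"
  \<comment> \<open>The common tail of all outcomes: advance to the next incidence.\<close>
  have fin: "?next R' M' k'"
    if R': "regs_ok n N R'" "\<And>x. 13 < x \<Longrightarrow> x < 20 \<Longrightarrow> R' x = ?R x"
      "\<And>j. j \<noteq> 4 \<Longrightarrow> j \<noteq> 5 \<Longrightarrow> j \<noteq> 6 \<Longrightarrow> arr N M' j = arr N M j"
      and ki: "kinv ?A (?D (ds @ [R 17])) (degsum (drop (Suc i) vs) + length (ds @ [R 17])) M'"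
      and k': "10 * potential ?A M' + ((30 * K + 60) * length es + 3 + cr) \<le> k'" for R' M' k'
  proof (rule LD_rule)
    show "regs_ok n N R'" by fact
    have r: "R' 17 = R 17" "R' 14 = i" "R' 16 = ?u" using R'(2) R by auto
    show "R' 17 < N" using r lt by simp
    let ?R' = "R'(13 := 2 * N + R' 17, 17 := arr N M' 2 (R' 17))"
    have "ready ?R' M'" using rdy by (rule ready_cong) (use R' in \<open>auto simp: regs_ok_upd\<close>)
    moreover have "adjl ?u = (ds @ [R 17]) @ es" "chain (arr N M' 2) (?R' 17) es"
      using ds(1,2) es R'(3) r by auto
    moreover have "\<forall>a. arr N M' 7 a = 0" using vis R'(3)[of 7] by simp
    moreover have "10 * potential ?A M' + (30 * K + 60) * length es + 1 + cr \<le> k' - 2" using k' by linarith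
    moreover have "?R' 14 = i" "?R' 16 = ?u" using r by auto
    ultimately show "sinv i cr ?R' M' (k' - 2)"
      unfolding sinv_def using ki by blast
  qed (use B k' in auto)
  show ?thesis
    unfolding SCAN_def
  proof (intro wp_seq LD_rule load0_rule)
    let ?R1 = "R(13 := 3 * N + R 17, 18 := arr N M 3 (R 17))"
    let ?R2 = "?R1(19 := arr N M 0 (?R1 18))"
    let ?R3 = "?R2(13 := 6 * N + ?R2 19, 20 := arr N M 6 (?R2 19))"
    have "?R3 = ?R" using ok e by simp
    moreover have "wp B (If (Neq 20 0) JOIN Skip) ?next ?R M (k - 1 - 2 - 1 - 2)"
    proof (rule wp_if)
      show "1 \<le> k - 1 - 2 - 1 - 2" using k by simp
    next
      assume "\<not> test_val (Neq 20 0) (?R, M)"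
      then have "arr N M 6 ?w = 0" using ok regs_okD(1)[of n N R] by simp
      then have "?w \<notin> ?A" using ds(3) w unfolding kinv_def by blast
      then have "?D (ds @ [R 17]) = ?D ds" by (auto simp: done_edges_def)
      then have "kinv ?A (?D (ds @ [R 17])) (degsum (drop (Suc i) vs) + length (ds @ [R 17])) M"
        using kinv_mono[OF ds(3)] by simp
      then show "wp B Skip ?next ?R M (k - 1 - 2 - 1 - 2 - 1)"
        using k ok by (intro wp_skip fin) (auto simp: regs_ok_upd)
    next
      assume "test_val (Neq 20 0) (?R, M)"
      then have "arr N M 6 ?w \<noteq> 0" using ok regs_okD(1)[of n N R] by simp
      then have wA: "?w \<in> ?A" using ds(3) w unfolding kinv_def by blast
      then have less: "less_L L ?u ?w" using after_iff[OF i w(1)] A w(2) by auto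
      have D: "insert {?u, ?w} (?D ds) = ?D (ds @ [R 17])" using wA by (auto simp: done_edges_def)
      show "wp B JOIN ?next ?R M (k - 1 - 2 - 1 - 2 - 1)"
      proof (rule wp_JOIN[OF _ ds(3) cs, where cr = "(30 * K + 60) * length es + 3 + cr"])
        show "{a, b} \<in> ?D ds" if "{a, b} \<in> E" "less_L L (?R 16) a" "less_L L (?R 16) b" for a b
          using that R edge_lt[OF that(1)] after_iff[OF i] by (auto simp: done_edges_def)
        show "10 * potential ?A M + 30 * K + 40 + ((30 * K + 60) * length es + 3 + cr)
            \<le> k - 1 - 2 - 1 - 2 - 1" using k by simp
        fix R' M' k'
        assume "regs_ok n N R'" "\<And>x. 13 < x \<Longrightarrow> x < 20 \<Longrightarrow> R' x = ?R x"
          "\<And>j. j \<noteq> 4 \<Longrightarrow> j \<noteq> 5 \<Longrightarrow> j \<noteq> 6 \<Longrightarrow> arr N M' j = arr N M j"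
          "kinv ?A (insert {?R 16, ?R 19} (?D ds)) (Suc (degsum (drop (Suc i) vs) + length ds)) M'"
          "10 * potential ?A M' + ((30 * K + 60) * length es + 3 + cr) \<le> k'"
        then show "?next R' M' k'"
          using D R by (intro fin) auto
      qed (use ok e R A wA less in \<open>auto simp: regs_ok_upd\<close>)
    qed
    ultimately show "wp B (If (Neq 20 0) JOIN Skip) ?next ?R3 M (k - 1 - 2 - 1 - 2)"
      by (simp only:)
  qed (use ok e lt B k in \<open>auto simp: regs_ok_upd\<close>)
qed

text \<open>A vertex still to be inserted carries \<open>10 * K + 20\<close> credits, of which
  \<open>10 * K\<close> become the potential of a new root of rank 1.\<close>

definition oinv :: "nat \<Rightarrow> (nat \<Rightarrow> nat) \<Rightarrow> (nat \<Rightarrow> nat) \<Rightarrow> nat \<Rightarrow> bool" where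
  "oinv cr R M k \<longleftrightarrow> ready R M \<and> R 14 \<le> n \<and> (\<forall>a. arr N M 7 a = 0) \<and>
     kinv (set (drop (R 14) vs)) {e \<in> E. e \<subseteq> set (drop (R 14) vs)} (degsum (drop (R 14) vs)) M \<and>
     10 * potential (set (drop (R 14) vs)) M + (30 * K + 60) * degsum (take (R 14) vs) +
       (10 * K + 20) * R 14 + 1 + cr \<le> k"

text \<open>With the list exhausted, \<open>ex_incidence\<close> shows that every edge from
  \<open>vs ! i\<close> into the suffix has been read from this end.\<close>

lemma sinv_end:
  assumes i: "i < n" and S: "sinv i ((30 * K + 60) * degsum (take i vs) + (10 * K + 20) * i + 1 + cr) R M k"
    and 0: "R 17 = 0"
  shows "oinv cr R M (k - 1)"
proof -
  let ?u = "vs ! i" and ?A = "set (drop i vs)" and ?Y = "set (drop (Suc i) vs)"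
  obtain ds es where ds: "adjl ?u = ds @ es" "chain (arr N M 2) (R 17) es"
    "kinv ?A (done_edges i ds) (degsum (drop (Suc i) vs) + length ds) M"
    "10 * potential ?A M + (30 * K + 60) * length es + 1 +
      ((30 * K + 60) * degsum (take i vs) + (10 * K + 20) * i + 1 + cr) \<le> k"
    using S unfolding sinv_def by blast
  then have [simp]: "es = []" using 0 by (cases es) auto
  have A: "?A = insert ?u ?Y" using drop_vs[OF i] by simp
  have "kinv ?A {e \<in> E. e \<subseteq> ?A} (degsum (drop i vs)) M"
  proof (rule kinv_mono[OF ds(3)[unfolded done_edges_def]])
    show "degsum (drop (Suc i) vs) + length ds \<le> degsum (drop i vs)"
      using ds(1) drop_vs[OF i] by (simp add: degsum_def)
    show "{e \<in> E. e \<subseteq> ?A} \<subseteq> {e \<in> E. e \<subseteq> ?Y} \<union> {{?u, I (pt e)} |e. e \<in> set ds \<and> I (pt e) \<in> ?A}"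
    proof
      fix f assume f: "f \<in> {e \<in> E. e \<subseteq> ?A}"
      show "f \<in> {e \<in> E. e \<subseteq> ?Y} \<union> {{?u, I (pt e)} |e. e \<in> set ds \<and> I (pt e) \<in> ?A}"
      proof (cases "?u \<in> f")
        case True
        have "card f = 2" using f graph by (auto simp: simple_graph_def all_pairs_def)
        then obtain w where w: "f = {?u, w}" using True by (metis card_2_iff doubleton_eq_iff insertE singletonD)
        then obtain e where e: "e \<in> Inc" "I e = ?u" "I (pt e) = w" using ex_incidence f by blast
        then have "e \<in> set ds" using ds(1) set_adjl[of ?u] by auto
        then show ?thesis using e w f by auto
      next
        case False
        then show ?thesis using f A by auto
      qed
    qed
  qed
  then show ?thesis using S ds(4) i unfolding sinv_def oinv_def by auto
qed

lemma kinv_new: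
  assumes ki: "kinv A D c M" and u: "u < n" "u \<notin> A"
    and M': "arr N M' 5 = (arr N M 5)(u := u)" "arr N M' 6 = (arr N M 6)(u := 1)" "arr N M' 4 = arr N M 4"
  shows "kinv (insert u A) D c M'" "potential (insert u A) M' = K + potential A M"
proof -
  obtain \<rho> where \<rho>: "uf_inv A (arr N M 5) (arr N M 6) \<rho>" "classes A \<rho> (forest_of M)"
    using ki by (auto simp: kinv_def)
  have "uf_inv (insert u A) (arr N M' 5) (arr N M' 6) (\<rho>(u := u))"
    unfolding M' by (rule uf_inv_new[OF \<rho>(1) u(2)])
  moreover have "classes (insert u A) (\<rho>(u := u)) (forest_of M')"
    unfolding forest_of_cong[OF M'(3)]
    by (rule classes_new[OF \<rho>(2) u(2)]) (use \<rho>(1) in \<open>auto simp: uf_inv_def\<close>)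
  ultimately show "kinv (insert u A) D c M'"
    using ki u M' forest_of_cong[OF M'(3)] unfolding kinv_def by auto
  show "potential (insert u A) M' = K + potential A M"
    unfolding potential_def M' by (rule pot_new[OF \<rho>(1) u(2)])
qed

lemma wp_KRUSKAL:
  assumes rdy: "ready R M" and zero: "\<And>j a. j \<in> {4, 6, 7} \<Longrightarrow> arr N M j a = 0"
    and k: "(30 * K + 60) * (2 * m) + (10 * K + 20) * n + 2 + cr \<le> k"
    and post: "\<And>R' M' k'. ready R' M' \<Longrightarrow> (\<And>a. arr N M' 7 a = 0) \<Longrightarrow> kinv {..<n} E (2 * m) M' \<Longrightarrow>
      cr \<le> k' \<Longrightarrow> Q R' M' k'"
  shows "wp B KRUSKAL Q R M k"
proof -
  have ok: "regs_ok n N R" using rdy by (simp add: ready_def)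
  have D0: "{e \<in> E. e \<subseteq> set (drop n vs)} = {}"
    using graph length_vs by (auto simp: simple_graph_def all_pairs_def)
  have "forest_of M = {}" using zero by (auto simp: forest_of_def)
  moreover have "uf_inv {} (arr N M 5) (arr N M 6) id" "classes {} id {}"
    by (auto simp: uf_inv_def classes_def)
  ultimately have "kinv {} {} 0 M"
    using zero unfolding kinv_def kforest_def by auto
  moreover have "R 1 = n" using ok by (simp add: regs_ok_def)
  then have r14: "(R(14 := R 1)) 14 = n" and ok': "regs_ok n N (R(14 := R 1))" using ok by (auto simp: regs_ok_upd)
  moreover have "ready (R(14 := R 1)) M" using rdy ok' by (auto intro: ready_cong)
  ultimately have init: "oinv cr (R(14 := R 1)) M (k - 1)"
    unfolding oinv_def r14 D0 using k zero length_vs degsum_vs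
    by (simp add: potential_def degsum_def[of "[]"])
  show ?thesis
    unfolding KRUSKAL_def
  proof (intro wp_seq wp_copy)
    show "1 \<le> k" using k by simp
    show "wp B (While (Less 0 14) INSERT) Q (R(14 := R 1)) M (k - 1)"
    proof (rule wp_while[where I = "oinv cr", OF init])
      fix R M k assume "oinv cr R M k"
      then show "1 \<le> k" by (simp add: oinv_def)
    next
      fix R M k assume O: "oinv cr R M k" and t: "\<not> test_val (Less 0 14) (R, M)"
      have ok: "regs_ok n N R" using O by (simp add: oinv_def ready_def)
      then have "R 14 = 0" using t regs_okD(1)[OF ok] by simp
      moreover have "{e \<in> E. e \<subseteq> {..<n}} = E" using graph by (auto simp: simple_graph_def all_pairs_def)
      ultimately show "Q R M (k - 1)"
        using O set_vs degsum_vs by (intro post) (auto simp: oinv_def)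
    next
      fix R M k assume O: "oinv cr R M k" and t: "test_val (Less 0 14) (R, M)"
      have rdy: "ready R M" and ok: "regs_ok n N R" using O by (auto simp: oinv_def ready_def)
      obtain i where i: "R 14 = Suc i" using t regs_okD(1)[OF ok] by (cases "R 14") auto
      then have iN: "i < n" using O by (simp add: oinv_def)
      let ?u = "vs ! i" and ?A = "set (drop i vs)" and ?Y = "set (drop (Suc i) vs)"
      let ?cr = "(30 * K + 60) * degsum (take i vs) + (10 * K + 20) * i + 1 + cr"
      have u: "?u < n" using set_vs length_vs iN by (metis lessThan_iff nth_mem)
      have uA: "?u \<notin> ?Y" "?A = insert ?u ?Y"
        using after_iff[OF iN u] drop_vs[OF iN] by (auto simp: less_L_def)
      have tk: "degsum (take (Suc i) vs) = degsum (take i vs) + length (adjl ?u)"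
        using iN length_vs by (simp add: degsum_def take_Suc_conv_app_nth)
      have kO: "10 * potential ?Y M + (30 * K + 60) * degsum (take (Suc i) vs) + (10 * K + 20) * Suc i + 1 + cr \<le> k"
        using O i by (simp add: oinv_def)
      let ?M = "aset N (aset N M 5 ?u ?u) 6 ?u 1"
      have lt: "?u < N" using u n_less_N by simp
      have ki: "kinv ?Y {e \<in> E. e \<subseteq> ?Y} (degsum (drop (Suc i) vs)) M" using O i by (simp add: oinv_def)
      have arrM: "arr N ?M 5 = (arr N M 5)(?u := ?u)" "arr N ?M 6 = (arr N M 6)(?u := 1)"
        "\<And>j. j \<noteq> 5 \<Longrightarrow> j \<noteq> 6 \<Longrightarrow> arr N ?M j = arr N M j"
        using lt by (auto simp: arr_aset)
      note ki' = kinv_new[OF ki u uA(1) arrM(1,2) arrM(3)[of 4], folded uA(2)]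
      have kk: "10 * potential ?A ?M + (30 * K + 60) * length (adjl ?u) + 20 + ?cr \<le> k"
        using kO ki'(2) tk by (simp add: algebra_simps)
      have chn: "chain (arr N M 2) (arr N M 1 ?u) (adjl ?u)" using rdy u by (simp add: ready_def chains_def)
      have inner: "wp B (While (Neq 17 0) SCAN) (oinv cr) R' M' k'" if "sinv i ?cr R' M' k'" for R' M' k'
      proof (rule wp_while[where I = "sinv i ?cr", OF that])
        fix R M k assume "sinv i ?cr R M k"
        then show "1 \<le> k" by (auto simp: sinv_def)
      next
        fix R M k assume S: "sinv i ?cr R M k" and t: "test_val (Neq 17 0) (R, M)"
        have "regs_ok n N R" using S by (simp add: sinv_def ready_def)
        then show "wp B SCAN (sinv i ?cr) R M (k - 1)" using t regs_okD(1) by (intro wp_SCAN[OF iN S]) fastforce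
      next
        fix R M k assume S: "sinv i ?cr R M k" and t: "\<not> test_val (Neq 17 0) (R, M)"
        have "regs_ok n N R" using S by (simp add: sinv_def ready_def)
        then show "oinv cr R M (k - 1)" using t regs_okD(1) by (intro sinv_end[OF iN S]) fastforce
      qed
      have start: "sinv i ?cr R' M' k'"
        if "regs_ok n N R'" "R' 14 = i" "R' 16 = ?u" "R' 17 = arr N M 1 ?u" and M': "M' = ?M" and "k \<le> k' + 12"
        for R' M' k'
        unfolding sinv_def M'
      proof (intro conjI ex2I[of _ "[]" "adjl ?u"])
        show "ready R' ?M" using rdy that(1) by (rule ready_cong) (rule arrM(3); simp)
        show "\<forall>a. arr N ?M 7 a = 0" using O arrM(3)[of 7] by (simp add: oinv_def)
        show "chain (arr N ?M 2) (R' 17) (adjl ?u)" using chn that(4) arrM(3)[of 2] by simp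
        show "kinv ?A (done_edges i []) (degsum (drop (Suc i) vs) + length []) ?M"
          using ki'(1) by (simp add: done_edges_def)
        show "10 * potential ?A ?M + (30 * K + 60) * length (adjl ?u) + 1 + ?cr \<le> k'" using kk that by linarith
      qed (use that in auto)
      have i3: "3 + i < N" using iN N by simp
      have I3: "arr N M 0 (3 + i) = ?u" using rdy I_vs[OF iN] by (simp add: ready_def)
      show "wp B INSERT (oinv cr) R M (k - 1)"
        unfolding INSERT_def
        by (intro wp_seq wp_sub wp_const wp_add load0_rule ST_rule
            LD_rule inner start)
          (use ok regs_okD[OF ok] i i3 kk I3 lt B in \<open>simp_all add: regs_ok_upd arr_aset\<close>)
    qed
  qed
qed

end

section \<open>Left-child right-sibling trees\<close>

text \<open>\<open>q\<close> enumerates the vertices in the order of a breadth first search of the forest \<open>U\<close>, and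
  \<open>a i\<close> is the vertex to which \<open>q i\<close> is attached: a root (index in \<open>Rs\<close>) to the previous
  root, a first child (index in \<open>Gs\<close>) to its parent, any other child to its previous sibling,
  which precedes it immediately.\<close>

definition att_kind :: "'a set set \<Rightarrow> (nat \<Rightarrow> 'a) \<Rightarrow> (nat \<Rightarrow> 'a) \<Rightarrow> nat set \<Rightarrow> nat set \<Rightarrow> nat \<Rightarrow> bool" where
  "att_kind U q a Rs Gs i \<longleftrightarrow>
    (if i \<in> Rs then (\<exists>j\<in>Rs. j < i \<and> a i = q j \<and> (\<forall>l\<in>Rs. l \<le> j \<or> i \<le> l))
     else if i \<in> Gs then {a i, q i} \<in> U
     else i - 1 \<notin> Rs \<and> a i = q (i - 1) \<and> (\<exists>u. {u, q (i - 1)} \<in> U \<and> {u, q i} \<in> U))"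

text \<open>\<open>Rs\<close> and \<open>Gs\<close> are ghost sets of queue positions.
  \<open>inj_on a Gs\<close> limits each vertex to one first child, and the last clause puts at most
  one root into a component. Position 0 starts the tree and is attached to nothing.\<close>

definition binv :: "'a set set \<Rightarrow> 'a set \<Rightarrow> (nat \<Rightarrow> 'a) \<Rightarrow> (nat \<Rightarrow> 'a) \<Rightarrow> nat set \<Rightarrow> nat set \<Rightarrow> nat \<Rightarrow> bool" where
  "binv U V q a Rs Gs t \<longleftrightarrow> inj_on q {..<t} \<and> q ` {..<t} \<subseteq> V \<and>
     (\<forall>i. 0 < i \<longrightarrow> i < t \<longrightarrow> a i \<in> q ` {..<i} \<and> att_kind U q a Rs Gs i) \<and>
     Rs \<subseteq> {..<t} \<and> Gs \<subseteq> {0<..<t} \<and> Rs \<inter> Gs = {} \<and> inj_on a Gs \<and>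
     (\<forall>i\<in>Rs. \<forall>j\<in>Rs. (q i, q j) \<in> (adj_on UNIV U)\<^sup>* \<longrightarrow> i = j)"

lemma image_fun_upd_lessThan: "(q(t := w)) ` {..<Suc t} = insert w (q ` {..<t})"
  by (auto simp: less_Suc_eq)

lemma att_kind_extend:
  assumes "att_kind U q a Rs Gs i" "i < t" "0 < i" "Rs' = Rs \<or> Rs' = insert t Rs" "Gs' = Gs \<or> Gs' = insert t Gs"
    "Rs \<subseteq> {..<t}"
  shows "att_kind U (q(t := w)) (a(t := x)) Rs' Gs' i"
proof -
  have iff: "i \<in> Rs' \<longleftrightarrow> i \<in> Rs" "i \<in> Gs' \<longleftrightarrow> i \<in> Gs" "i - 1 \<in> Rs' \<longleftrightarrow> i - 1 \<in> Rs" using assms by auto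
  show ?thesis
  proof (cases "i \<in> Rs")
    case True
    then obtain j where "j \<in> Rs" "j < i" "a i = q j" "\<forall>l\<in>Rs. l \<le> j \<or> i \<le> l"
      using assms(1) by (auto simp: att_kind_def)
    then show ?thesis using assms True iff unfolding att_kind_def by (auto intro!: bexI[of _ j])
  next
    case False
    then show ?thesis using assms(1,2,3) iff unfolding att_kind_def by auto
  qed
qed

text \<open>Common core of the three ways to append: a new root, a first child, a further
  child.\<close>

lemma binv_extend:
  assumes b: "binv U V q a Rs Gs t" and w: "w \<in> V" "w \<notin> q ` {..<t}"
    and R: "Rs' = Rs \<or> Rs' = insert t Rs" and G: "Gs' = Gs \<or> Gs' = insert t Gs \<and> 0 < t \<and> x \<notin> a ` Gs"
    and x: "0 < t \<Longrightarrow> x \<in> q ` {..<t} \<and> att_kind U (q(t := w)) (a(t := x)) Rs' Gs' t"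
    and dis: "t \<notin> Rs' \<or> t \<notin> Gs'"
    and root: "t \<in> Rs' \<Longrightarrow> \<forall>i\<in>Rs. (q i, w) \<notin> (adj_on UNIV U)\<^sup>*"
  shows "binv U V (q(t := w)) (a(t := x)) Rs' Gs' (Suc t)"
proof -
  let ?q = "q(t := w)" and ?a = "a(t := x)"
  have B: "inj_on q {..<t}" "q ` {..<t} \<subseteq> V"
    "\<And>i. 0 < i \<Longrightarrow> i < t \<Longrightarrow> a i \<in> q ` {..<i} \<and> att_kind U q a Rs Gs i"
    "Rs \<subseteq> {..<t}" "Gs \<subseteq> {0<..<t}" "inj_on a Gs"
    "\<And>i j. i \<in> Rs \<Longrightarrow> j \<in> Rs \<Longrightarrow> (q i, q j) \<in> (adj_on UNIV U)\<^sup>* \<Longrightarrow> i = j" "Rs \<inter> Gs = {}"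
    using b by (auto simp: binv_def)
  have inj: "inj_on ?q {..<Suc t}"
    using B(1) w(2) by (auto simp: inj_on_def less_Suc_eq)
  have im: "?q ` {..<i} = q ` {..<i}" if "i \<le> t" for i using that by (intro image_cong) auto
  have ak: "?a i \<in> ?q ` {..<i} \<and> att_kind U ?q ?a Rs' Gs' i" if "0 < i" "i < Suc t" for i
  proof (cases "i = t")
    case True
    then show ?thesis using x that im[of t] by auto
  next
    case False
    then have i: "i < t" using that by simp
    then have "?a i \<in> ?q ` {..<i}" using B(3)[OF that(1) i] im[of i] by simp
    moreover have "Gs' = Gs \<or> Gs' = insert t Gs" using G by blast
    then have "att_kind U ?q ?a Rs' Gs' i"
      using att_kind_extend[OF conjunct2[OF B(3)[OF that(1) i]] i that(1) R _ B(4)] by simp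
    ultimately show ?thesis ..
  qed
  have injG: "inj_on ?a Gs'"
  proof -
    have "t \<notin> Gs" using B(5) by auto
    then have "inj_on ?a Gs" "?a ` Gs = a ` Gs" using B(6) by (auto simp: inj_on_def)
    then show ?thesis using G \<open>t \<notin> Gs\<close> by auto
  qed
  have rt: "i = j" if ij: "i \<in> Rs'" "j \<in> Rs'" "(?q i, ?q j) \<in> (adj_on UNIV U)\<^sup>*" for i j
  proof (rule ccontr)
    assume ne: "i \<noteq> j"
    have qR: "?q l = q l" if "l \<in> Rs" for l using B(4) that by auto
    consider "i \<in> Rs" "j \<in> Rs" | "i = t" "t \<in> Rs'" "j \<in> Rs" | "j = t" "t \<in> Rs'" "i \<in> Rs"
      using ij R ne by auto
    then show False
    proof cases
      case 1
      then show False using ij(3) B(7)[OF 1] ne qR[OF 1(1)] qR[OF 1(2)] by metis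
    next
      case 2
      then have "(q j, w) \<in> (adj_on UNIV U)\<^sup>*" using ij(3) qR[OF 2(3)] adj_on_rtrancl_commute by (metis fun_upd_same)
      then show False using root 2 by blast
    next
      case 3
      then have "(q i, w) \<in> (adj_on UNIV U)\<^sup>*" using ij(3) qR[OF 3(3)] by (metis fun_upd_same)
      then show False using root 3 by blast
    qed
  qed
  have "?q ` {..<Suc t} \<subseteq> V" using B(2) w(1) unfolding image_fun_upd_lessThan by blast
  moreover have "Rs' \<subseteq> {..<Suc t}" "Gs' \<subseteq> {0<..<Suc t}" using R G B(4,5) by auto
  moreover have "Rs' \<inter> Gs' = {}" using R G B(4,5,8) dis by auto
  ultimately show ?thesis unfolding binv_def using inj ak injG rt by blast
qed

lemma closed_rtrancl:
  assumes "(x, y) \<in> (adj_on UNIV U)\<^sup>*" "x \<in> S" "\<And>x w. x \<in> S \<Longrightarrow> {x, w} \<in> U \<Longrightarrow> w \<in> S"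
  shows "y \<in> S"
  using assms(1,2) by (induction rule: rtrancl_induct) (auto simp: adj_on_def dest: assms(3))

text \<open>A new root is taken only when the visited set is closed under \<open>U\<close>, so its
  component contains no visited vertex.\<close>

lemma binv_root:
  assumes b: "binv U V q a Rs Gs t" and w: "w \<in> V" "w \<notin> q ` {..<t}"
    and closed: "\<And>x w. x \<in> q ` {..<t} \<Longrightarrow> {x, w} \<in> U \<Longrightarrow> w \<in> q ` {..<t}"
    and last: "0 < t \<Longrightarrow> \<exists>j\<in>Rs. x = q j \<and> (\<forall>l\<in>Rs. l \<le> j)"
  shows "binv U V (q(t := w)) (a(t := x)) (insert t Rs) Gs (Suc t)"
proof (rule binv_extend[OF b w])
  have Rs: "Rs \<subseteq> {..<t}" using b by (simp add: binv_def)
  show "x \<in> q ` {..<t} \<and> att_kind U (q(t := w)) (a(t := x)) (insert t Rs) Gs t" if "0 < t"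
  proof -
    obtain j where j: "j \<in> Rs" "x = q j" "\<forall>l\<in>Rs. l \<le> j" using last[OF \<open>0 < t\<close>] by blast
    then have "j < t" using Rs by auto
    then show ?thesis using j unfolding att_kind_def by auto
  qed
  show "\<forall>i\<in>Rs. (q i, w) \<notin> (adj_on UNIV U)\<^sup>*"
  proof (intro ballI notI)
    fix i assume "i \<in> Rs" "(q i, w) \<in> (adj_on UNIV U)\<^sup>*"
    then have "w \<in> q ` {..<t}" using closed_rtrancl[of "q i" w U "q ` {..<t}"] Rs closed by auto
    then show False using w(2) by simp
  qed
qed (use b in \<open>auto simp: binv_def\<close>)

lemma binv_first:
  assumes b: "binv U V q a Rs Gs t" and w: "w \<in> V" "w \<notin> q ` {..<t}"
    and x: "{x, w} \<in> U" "x \<in> q ` {..<t}" "x \<notin> a ` Gs"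
  shows "binv U V (q(t := w)) (a(t := x)) Rs (insert t Gs) (Suc t)"
proof (rule binv_extend[OF b w])
  have "t \<notin> Rs" using b by (auto simp: binv_def)
  then show "x \<in> q ` {..<t} \<and> att_kind U (q(t := w)) (a(t := x)) Rs (insert t Gs) t"
    "t \<in> Rs \<Longrightarrow> \<forall>i\<in>Rs. (q i, w) \<notin> (adj_on UNIV U)\<^sup>*" using x by (auto simp: att_kind_def)
qed (use x b in \<open>auto simp: binv_def\<close>)

lemma binv_sibling:
  assumes b: "binv U V q a Rs Gs t" and w: "w \<in> V" "w \<notin> q ` {..<t}" and t: "0 < t" "t - 1 \<notin> Rs"
    and u: "{u, q (t - 1)} \<in> U" "{u, w} \<in> U"
  shows "binv U V (q(t := w)) (a(t := q (t - 1))) Rs Gs (Suc t)"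
proof (rule binv_extend[OF b w])
  have "t \<notin> Rs" "t \<notin> Gs" using b by (auto simp: binv_def)
  then show "q (t - 1) \<in> q ` {..<t} \<and> att_kind U (q(t := w)) (a(t := q (t - 1))) Rs Gs t"
    "t \<in> Rs \<Longrightarrow> \<forall>i\<in>Rs. (q i, w) \<notin> (adj_on UNIV U)\<^sup>*"
    using t u by (auto simp: att_kind_def)
qed (use b in \<open>auto simp: binv_def\<close>)

text \<open>Outside \<open>Gs\<close> attachment can be inverted: a root follows the preceding root,
  any other vertex follows position \<open>i - 1\<close>, which is then not a root. So every vertex
  has at most one next sibling.\<close>

lemma binv_bad_unique:
  assumes b: "binv U V q a Rs Gs t"
    and i: "0 < i" "i < t" "i \<notin> Gs" and j: "0 < j" "j < t" "j \<notin> Gs" and eq: "a i = a j"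
  shows "i = j"
proof -
  have q: "c = d" if "q c = q d" "c < t" "d < t" for c d
    using b that by (auto simp: binv_def inj_on_def)
  have Rs: "Rs \<subseteq> {..<t}" using b by (simp add: binv_def)
  have src: "(l \<in> Rs \<and> (\<exists>c\<in>Rs. c < l \<and> a l = q c \<and> (\<forall>l'\<in>Rs. l' \<le> c \<or> l \<le> l'))) \<or>
      (l \<notin> Rs \<and> l - 1 \<notin> Rs \<and> a l = q (l - 1))" if "0 < l" "l < t" "l \<notin> Gs" for l
  proof -
    have "att_kind U q a Rs Gs l" using b that by (simp add: binv_def)
    then show ?thesis using that by (auto simp: att_kind_def split: if_splits)
  qed
  from src[OF i] src[OF j] show ?thesis
  proof (elim disjE conjE bexE)
    fix c d assume c: "i \<in> Rs" "c \<in> Rs" "c < i" "a i = q c" "\<forall>l'\<in>Rs. l' \<le> c \<or> i \<le> l'"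
      and d: "j \<in> Rs" "d \<in> Rs" "d < j" "a j = q d" "\<forall>l'\<in>Rs. l' \<le> d \<or> j \<le> l'"
    have "c = d" using q[of c d] c d eq i j by simp
    moreover have "j \<le> c \<or> i \<le> j" "i \<le> d \<or> j \<le> i" using c(1,5) d(1,5) by blast+
    ultimately show ?thesis using c(3) d(3) by linarith
  next
    fix c assume c: "c \<in> Rs" "a i = q c" "a j = q (j - 1)" "j - 1 \<notin> Rs" "c < i"
    have "q c = q (j - 1)" using c(2,3) eq by metis
    then have "c = j - 1" by (rule q) (use c(5) i j in linarith)+
    then show ?thesis using c(1,4) by blast
  next
    fix c assume c: "c \<in> Rs" "a j = q c" "a i = q (i - 1)" "i - 1 \<notin> Rs" "c < j"
    have "q c = q (i - 1)" using c(2,3) eq by metis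
    then have "c = i - 1" by (rule q) (use c(5) i j in linarith)+
    then show ?thesis using c(1,4) by blast
  next
    assume c: "a i = q (i - 1)" "a j = q (j - 1)"
    have "q (i - 1) = q (j - 1)" using c eq by metis
    then have "i - 1 = j - 1" by (rule q) (use i j in linarith)+
    then show ?thesis using i j by linarith
  qed
qed

text \<open>A pair meets \<open>v\<close> as \<open>q i\<close>, for one \<open>i\<close> at most,
  or as the vertex attached to, which \<open>d\<close> counts.\<close>

lemma card_edges_at:
  fixes q a :: "nat \<Rightarrow> 'a"
  assumes inj: "inj_on q {..<t}" and J: "J \<subseteq> {0<..<t}"
    and c: "card {i \<in> J. a i = v} \<le> d"
  shows "card {e \<in> (\<lambda>i. {q i, a i}) ` J. v \<in> e} \<le> Suc d"
proof -
  have fin: "finite J" by (rule finite_subset[OF J]) simp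
  have "{e \<in> (\<lambda>i. {q i, a i}) ` J. v \<in> e} \<subseteq>
      (\<lambda>i. {q i, a i}) ` ({i \<in> J. q i = v} \<union> {i \<in> J. a i = v})" by auto
  then have "card {e \<in> (\<lambda>i. {q i, a i}) ` J. v \<in> e} \<le>
      card ((\<lambda>i. {q i, a i}) ` ({i \<in> J. q i = v} \<union> {i \<in> J. a i = v}))"
    using fin by (intro card_mono) auto
  also have "\<dots> \<le> card ({i \<in> J. q i = v} \<union> {i \<in> J. a i = v})"
    using fin by (intro card_image_le) auto
  also have "\<dots> \<le> card {i \<in> J. q i = v} + card {i \<in> J. a i = v}" by (rule card_Un_le)
  also have "card {i \<in> J. q i = v} \<le> Suc 0"
  proof (subst card_le_Suc0_iff_eq)
    show "\<forall>i\<in>{i \<in> J. q i = v}. \<forall>j\<in>{i \<in> J. q i = v}. i = j"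
      using J inj_onD[OF inj] by fastforce
  qed (use fin in simp)
  finally show ?thesis using c by linarith
qed

text \<open>Degree 3 comes from the own attachment, the next sibling and the first child. The pairs
  from \<open>Gs\<close> lie in \<open>E\<close>, so only the remaining pairs \<open>Bd\<close>
  enter \<open>linked_graph\<close>, at most two at a vertex.\<close>

lemma binv_result:
  assumes graph: "simple_graph V E" and order: "linear_order_on V L"
    and kf: "kforest E L E U" and b: "binv U V q a Rs Gs n" and V: "q ` {..<n} = V"
    and F: "F = (\<lambda>i. {q i, a i}) ` {0<..<n}"
  shows "tree_graph V F" "max_degree V F \<le> 3" "adm r V (E \<union> F) L \<le> 2 + 2 * col (2 * r) V E L"
proof -
  have inj: "inj_on q {..<n}" and att: "\<And>i. 0 < i \<Longrightarrow> i < n \<Longrightarrow> a i \<in> q ` {..<i} \<and> att_kind U q a Rs Gs i"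
    and Rs: "Rs \<subseteq> {..<n}" and Gs: "Gs \<subseteq> {0<..<n}" and injG: "inj_on a Gs"
    and rt: "\<And>i j. i \<in> Rs \<Longrightarrow> j \<in> Rs \<Longrightarrow> (q i, q j) \<in> (adj_on UNIV U)\<^sup>* \<Longrightarrow> i = j"
    using b by (auto simp: binv_def)
  have Vf: "finite V" "V \<noteq> {}" using graph by (auto simp: simple_graph_def)
  then have n: "0 < n" using V by auto
  show "tree_graph V F" using tree_attach[OF inj _ n, of a] att V F by simp
  define J where "J = {0<..<n} - Gs"
  define Bd where "Bd = (\<lambda>i. {q i, a i}) ` J"
  have bad: "card {i \<in> J. a i = v} \<le> 1" for v
    unfolding One_nat_def using binv_bad_unique[OF b]
    by (subst card_le_Suc0_iff_eq) (auto simp: J_def)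
  have good: "card {i \<in> Gs. a i = v} \<le> 1" for v
    unfolding One_nat_def using injG finite_subset[OF Gs]
    by (subst card_le_Suc0_iff_eq) (auto simp: inj_on_def)
  have "card {e \<in> F. v \<in> e} \<le> 3" for v
  proof -
    have "{i \<in> {0<..<n}. a i = v} \<subseteq> {i \<in> J. a i = v} \<union> {i \<in> Gs. a i = v}" by (auto simp: J_def)
    then have "card {i \<in> {0<..<n}. a i = v} \<le> card ({i \<in> J. a i = v} \<union> {i \<in> Gs. a i = v})"
      using finite_subset[OF Gs] by (intro card_mono) (auto simp: J_def)
    also have "\<dots> \<le> 2" using bad[of v] good[of v] card_Un_le[of "{i \<in> J. a i = v}" "{i \<in> Gs. a i = v}"] by linarith
    finally show ?thesis using card_edges_at[OF inj order.refl] F by fastforce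
  qed
  then show "max_degree V F \<le> 3" unfolding max_degree_def using Vf by (subst Max_le_iff) auto
  have U: "U \<subseteq> E" using kf by (simp add: kforest_def)
  have "{q i, a i} \<in> E" if "i \<in> Gs" for i
  proof -
    have "0 < i" "i < n" "i \<notin> Rs" using that Gs b by (auto simp: binv_def)
    then have "{a i, q i} \<in> U" using att[of i] that by (simp add: att_kind_def)
    then show ?thesis using U by (auto simp: insert_commute)
  qed
  then have EF: "E \<union> F = E \<union> Bd" unfolding F Bd_def J_def by blast
  \<comment> \<open>\<open>U\<close> spans all of \<open>E\<close>, so roots in different components
    of \<open>U\<close> are in different components of \<open>G\<close>.\<close>
  have conn: "(adj_on UNIV E)\<^sup>* \<subseteq> (adj_on UNIV U)\<^sup>*"
    using kf by (intro rtrancl_subset_rtrancl) (auto simp: kforest_def adj_on_def)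
  interpret linked_graph V E L U Bd "q ` Rs"
  proof
    show "simple_graph V E" "linear_order_on V L" "U \<subseteq> E" by fact+
    show "finite Bd" by (simp add: Bd_def J_def)
    show "card {e \<in> Bd. v \<in> e} \<le> 2" for v
      using card_edges_at[OF inj, of J a v 1] bad[of v] unfolding Bd_def by (simp add: J_def numeral_2_eq_2)
    show "a = b" if "a \<in> q ` Rs" "b \<in> q ` Rs" "(a, b) \<in> (adj_on UNIV E)\<^sup>*" for a b
      using that conn rt by blast
    show "a = b" if "{u, a} \<in> U" "{u, b} \<in> U" "less_L L u a" "less_L L u b"
      "(a, b) \<in> (adj_on {w. less_L L u w} E)\<^sup>*" for u a b
      using kf that unfolding kforest_def by blast
    show "(\<exists>u. {u, x} \<in> U \<and> {u, y} \<in> U) \<or> x \<in> q ` Rs \<and> y \<in> q ` Rs" if xy: "{x, y} \<in> Bd" for x y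
    proof -
      obtain i where i: "0 < i" "i < n" "i \<notin> Gs" "{x, y} = {q i, a i}"
        using xy by (auto simp: Bd_def J_def)
      then have k: "att_kind U q a Rs Gs i" using att by blast
      show ?thesis
      proof (cases "i \<in> Rs")
        case True
        then have "a i \<in> q ` Rs" using k by (auto simp: att_kind_def)
        then show ?thesis using True i(4) by (auto simp: doubleton_eq_iff)
      next
        case False
        then show ?thesis using k i by (auto simp: att_kind_def doubleton_eq_iff)
      qed
    qed
  qed
  show "adm r V (E \<union> F) L \<le> 2 + 2 * col (2 * r) V E L" unfolding EF by (rule adm_le_col)
qed

section \<open>The program for the breadth first search\<close>

text \<open>Registers 14 and 15 are head and tail of the queue, 19 is the vertex being expanded, 24
  the child. Register 20 is where the next child gets attached: it starts as the parent and moves to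
  the child just appended.\<close>

definition APPEND :: com where
  "APPEND = Seq (ST 7 24 11) (Seq (ST 8 15 24) (Seq (ST 9 15 20)
     (Seq (Assign 20 (Copy 24)) (Assign 15 (Add 15 11)))))"

definition CHILD :: com where
  "CHILD = Seq (LD 22 4 21) (Seq (If (Neq 22 0)
     (Seq (LD 23 3 21) (Seq (Assign 24 (Load 23)) (Seq (LD 25 7 24)
       (If (Eq 25 0) APPEND Skip)))) Skip) (LD 21 2 21))"

definition PROC :: com where
  "PROC = Seq (LD 19 8 14) (Seq (Assign 14 (Add 14 11)) (Seq (Assign 20 (Copy 19))
     (Seq (LD 21 1 19) (While (Neq 21 0) CHILD))))"

text \<open>Register 16 keeps the last root, to which the next one is attached. For the first root
  it holds 0, written at queue position 0, which is never output.\<close>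

definition VISIT :: com where
  "VISIT = Seq (LD 18 7 17) (Seq
       (If (Eq 18 0) (Seq (ST 7 17 11) (Seq (ST 8 15 17) (Seq (ST 9 15 16)
          (Seq (Assign 16 (Copy 17)) (Seq (Assign 15 (Add 15 11)) (While (Less 14 15) PROC)))))) Skip)
       (Assign 17 (Add 17 11)))"

definition BFS :: com where
  "BFS = Seq (Assign 14 (Copy 0)) (Seq (Assign 15 (Copy 0)) (Seq (Assign 16 (Copy 0)) (Seq (Assign 17 (Copy 0))
     (While (Less 17 1) VISIT))))"

text \<open>\<open>C\<close> freezes array 4 as left by Kruskal's algorithm; \<open>C_sym\<close>
  makes each forest edge visible from both ends.\<close>

locale ram_bfs = ram_graph +
  fixes C :: "nat \<Rightarrow> nat" and U :: "nat set set"
  assumes U_def: "U = {{I e, I (pt e)} |e. e \<in> Inc \<and> C e \<noteq> 0}"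
    and C_sym: "e \<in> Inc \<Longrightarrow> C (pt e) = C e"
begin

lemma U_adjl:
  assumes "{u, w} \<in> U"
  shows "\<exists>e\<in>set (adjl u). C e \<noteq> 0 \<and> I (pt e) = w"
proof -
  obtain e where e: "e \<in> Inc" "C e \<noteq> 0" "{u, w} = {I e, I (pt e)}" using assms U_def by auto
  then consider "u = I e" "w = I (pt e)" | "w = I e" "u = I (pt e)" by (auto simp: doubleton_eq_iff)
  then show ?thesis
  proof cases
    case 1
    then show ?thesis using e set_adjl by auto
  next
    case 2
    then show ?thesis using e set_adjl[of u] pt[OF e(1)] C_sym[OF e(1)] by (intro bexI[of _ "pt e"]) auto
  qed
qed

lemma adjl_U: "e \<in> set (adjl u) \<Longrightarrow> C e \<noteq> 0 \<Longrightarrow> {u, I (pt e)} \<in> U"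
  using U_def set_adjl by auto

section \<open>Invariants and cost of the search\<close>

definition core :: "(nat \<Rightarrow> nat) \<Rightarrow> (nat \<Rightarrow> nat) \<Rightarrow> nat set \<Rightarrow> nat set \<Rightarrow> bool" where
  "core R M Rs Gs \<longleftrightarrow> ready R M \<and> (\<forall>e. arr N M 4 e = C e) \<and>
     (\<forall>v<n. arr N M 7 v \<noteq> 0 \<longleftrightarrow> v \<in> arr N M 8 ` {..<R 15}) \<and>
     binv U {..<n} (arr N M 8) (arr N M 9) Rs Gs (R 15) \<and>
     (0 < R 15 \<longrightarrow> (\<exists>j\<in>Rs. R 16 = arr N M 8 j \<and> (\<forall>l\<in>Rs. l \<le> j)))"

lemma core_cong:
  assumes "core R M Rs Gs" "regs_ok n N R'" "R' 15 = R 15" "R' 16 = R 16"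
  shows "core R' M Rs Gs"
  using assms unfolding core_def by (auto intro: ready_cong)

lemma core_le: "core R M Rs Gs \<Longrightarrow> R 15 \<le> n"
proof -
  assume "core R M Rs Gs"
  then have b: "inj_on (arr N M 8) {..<R 15}" "arr N M 8 ` {..<R 15} \<subseteq> {..<n}"
    by (auto simp: core_def binv_def)
  then show "R 15 \<le> n" using card_mono[OF _ b(2)] card_image[OF b(1)] by simp
qed

lemma core_less:
  assumes c: "core R M Rs Gs" and w: "w < n" "arr N M 7 w = 0"
  shows "R 15 < n"
proof -
  have b: "inj_on (arr N M 8) {..<R 15}" "arr N M 8 ` {..<R 15} \<subseteq> {..<n}" "w \<notin> arr N M 8 ` {..<R 15}"
    using c w by (auto simp: core_def binv_def)
  then have "card (arr N M 8 ` {..<R 15}) < card {..<n}" using w(1) by (intro psubset_card_mono) auto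
  then show ?thesis using card_image[OF b(1)] by simp
qed

lemma core_append:
  assumes c: "core R M Rs Gs" and w: "w < n" "arr N M 7 w = 0"
    and b: "binv U {..<n} ((arr N M 8)(R 15 := w)) ((arr N M 9)(R 15 := x)) Rs' Gs' (Suc (R 15))"
    and M': "M' = aset N (aset N (aset N M 7 w 1) 8 (R 15) w) 9 (R 15) x"
    and R': "regs_ok n N R'" "R' 15 = Suc (R 15)"
      "\<exists>j\<in>Rs'. R' 16 = ((arr N M 8)(R 15 := w)) j \<and> (\<forall>l\<in>Rs'. l \<le> j)"
  shows "core R' M' Rs' Gs'" "\<And>j. j < 7 \<Longrightarrow> arr N M' j = arr N M j"
    "arr N M' 8 = (arr N M 8)(R 15 := w)" "arr N M' 9 = (arr N M 9)(R 15 := x)"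
proof -
  have lt: "w < N" "R 15 < N" using w core_less[OF c w] n_less_N by auto
  show a: "\<And>j. j < 7 \<Longrightarrow> arr N M' j = arr N M j"
    and q: "arr N M' 8 = (arr N M 8)(R 15 := w)" "arr N M' 9 = (arr N M 9)(R 15 := x)"
    using lt unfolding M' by (auto simp: arr_aset)
  have v: "arr N M' 7 = (arr N M 7)(w := 1)" using lt unfolding M' by (simp add: arr_aset)
  have "ready R' M'" by (rule ready_cong[of R M]) (use c R'(1) a in \<open>auto simp: core_def\<close>)
  moreover have "arr N M' 7 v \<noteq> 0 \<longleftrightarrow> v \<in> arr N M' 8 ` {..<R' 15}" if "v < n" for v
    using c that unfolding v q R'(2) image_fun_upd_lessThan core_def by (cases "v = w") auto
  ultimately show "core R' M' Rs' Gs'"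
    using c b R' a[of 4] q unfolding core_def by auto
qed

text \<open>Remaining work if the vertices in \<open>S\<close> have been taken from the queue; every
  unit is paid with 40 credits.\<close>

definition rest :: "nat set \<Rightarrow> nat" where
  "rest S = (\<Sum>v\<in>{..<n} - S. 1 + length (adjl v))"

lemma rest_insert:
  assumes "v < n" "v \<notin> S"
  shows "rest S = 1 + length (adjl v) + rest (insert v S)"
proof -
  have "{..<n} - S - {v} = {..<n} - insert v S" by auto
  then show ?thesis unfolding rest_def using assms by (subst sum.remove[of _ v]) auto
qed

lemma rest_empty: "rest {} = n + 2 * m"
proof -
  have "degsum vs = (\<Sum>v\<in>{..<n}. length (adjl v))"
    unfolding degsum_def sum_list_distinct_conv_sum_set[OF distinct_vs] set_vs comp_def ..
  moreover have "(\<Sum>v\<in>{..<n}. 1 + length (adjl v)) = n + (\<Sum>v\<in>{..<n}. length (adjl v))"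
    by (subst sum.distrib) simp
  ultimately show ?thesis using degsum_vs unfolding rest_def Diff_empty by linarith
qed

text \<open>Position \<open>h - 1\<close> is being expanded. The disjunction records the two states
  of register 20: either no child has been appended, and the vertex is free to receive a first
  child, or the last queue entry is its child.\<close>

definition cinv :: "nat \<Rightarrow> nat \<Rightarrow> nat \<Rightarrow> (nat \<Rightarrow> nat) \<Rightarrow> (nat \<Rightarrow> nat) \<Rightarrow> nat \<Rightarrow> bool" where
  "cinv s h cr R M k \<longleftrightarrow> (\<exists>Rs Gs ds es. core R M Rs Gs \<and> R 14 = h \<and> R 17 = s \<and> s < n \<and>
     (\<forall>v\<le>s. v \<in> arr N M 8 ` {..<R 15}) \<and> 0 < h \<and> h \<le> R 15 \<and> R 19 = arr N M 8 (h - 1) \<and>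
     (\<forall>x w. x \<in> arr N M 8 ` {..<h - 1} \<longrightarrow> {x, w} \<in> U \<longrightarrow> w \<in> arr N M 8 ` {..<R 15}) \<and>
     arr N M 9 ` Gs \<subseteq> arr N M 8 ` {..<h} \<and>
     adjl (R 19) = ds @ es \<and> chain (arr N M 2) (R 21) es \<and>
     (\<forall>e\<in>set ds. C e \<noteq> 0 \<longrightarrow> I (pt e) \<in> arr N M 8 ` {..<R 15}) \<and>
     (R 20 = R 19 \<and> R 19 \<notin> arr N M 9 ` Gs \<or>
      R 20 = arr N M 8 (R 15 - 1) \<and> R 15 - 1 \<notin> Rs \<and> {R 19, R 20} \<in> U) \<and>
     40 * length es + 1 + (40 * rest (arr N M 8 ` {..<h}) + 1 + cr) \<le> k)"

lemma wp_CHILD: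
  assumes S: "cinv s h cr R M k" and ne: "R 21 \<noteq> 0"
  shows "wp B CHILD (cinv s h cr) R M (k - 1)"
proof -
  let ?next = "wp B (LD 21 2 21) (cinv s h cr)"
  let ?q = "arr N M 8" and ?a = "arr N M 9" and ?t = "R 15" and ?u = "R 19"
  obtain Rs Gs ds es' where c: "core R M Rs Gs" "R 14 = h" "R 17 = s" "s < n"
     "\<forall>v\<le>s. v \<in> ?q ` {..<?t}" "0 < h" "h \<le> ?t" "?u = ?q (h - 1)"
     "\<forall>x w. x \<in> ?q ` {..<h - 1} \<longrightarrow> {x, w} \<in> U \<longrightarrow> w \<in> ?q ` {..<?t}"
     "?a ` Gs \<subseteq> ?q ` {..<h}" "adjl ?u = ds @ es'" "chain (arr N M 2) (R 21) es'"
     "\<forall>e\<in>set ds. C e \<noteq> 0 \<longrightarrow> I (pt e) \<in> ?q ` {..<?t}"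
     "R 20 = ?u \<and> ?u \<notin> ?a ` Gs \<or> R 20 = ?q (?t - 1) \<and> ?t - 1 \<notin> Rs \<and> {?u, R 20} \<in> U"
     "40 * length es' + 1 + (40 * rest (?q ` {..<h}) + 1 + cr) \<le> k"
    using S unfolding cinv_def by (elim exE conjE) (rule that)
  then obtain es where es: "es' = R 21 # es" using ne by (cases es') auto
  have rdy: "ready R M" and ok: "regs_ok n N R" using c(1) by (auto simp: core_def ready_def)
  have b: "binv U {..<n} ?q ?a Rs Gs ?t" using c(1) by (simp add: core_def)
  have Gs: "Gs \<subseteq> {0<..<?t}" and Rs: "Rs \<subseteq> {..<?t}" using b by (auto simp: binv_def)
  have e: "R 21 \<in> Inc" "I (R 21) = ?u" "R 21 \<in> set (adjl ?u)" using c(11) es set_adjl[of ?u] by auto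
  let ?w = "I (pt (R 21))"
  have w: "?w < n" using I_lt[OF e(1)] by simp
  have lt: "R 21 < N" "pt (R 21) < N" "?w < N" using e pt(1)[OF e(1)] w n_less_N by auto
  have arrs: "arr N M 4 (R 21) = C (R 21)" "arr N M 3 (R 21) = pt (R 21)" "\<And>a. arr N M 0 a = I a"
    using c(1) e(1) by (auto simp: core_def ready_def)
  have k: "40 + (40 * length es + 1 + (40 * rest (?q ` {..<h}) + 1 + cr)) \<le> k"
    using c(15) es by simp
  have hq: "?u \<in> ?q ` {..<?t}" using c(6-8) by auto
  have fin: "?next R' M' k'"
    if core: "core R' M' Rs' Gs'" and R': "R' 14 = h" "R' 17 = s" "R' 19 = ?u" "R' 21 = R 21"
      and M': "\<And>j. j < 4 \<Longrightarrow> arr N M' j = arr N M j"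
      and q: "?t \<le> R' 15" "\<And>i. i < ?t \<Longrightarrow> arr N M' 8 i = ?q i"
      and e': "C (R 21) \<noteq> 0 \<longrightarrow> ?w \<in> arr N M' 8 ` {..<R' 15}"
      and G: "arr N M' 9 ` Gs' \<subseteq> ?q ` {..<h}"
      and p: "R' 20 = ?u \<and> ?u \<notin> arr N M' 9 ` Gs' \<or>
        R' 20 = arr N M' 8 (R' 15 - 1) \<and> R' 15 - 1 \<notin> Rs' \<and> {?u, R' 20} \<in> U"
      and k': "40 * length es + 3 + (40 * rest (?q ` {..<h}) + 1 + cr) \<le> k'" for R' M' Rs' Gs' k'
  proof -
    have sub: "?q ` {..<i} = arr N M' 8 ` {..<i}" if "i \<le> ?t" for i
      using q(2) that by (intro image_cong) auto
    have vis: "v \<in> arr N M' 8 ` {..<R' 15}" if "v \<in> ?q ` {..<?t}" for v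
      using that q(1) unfolding sub[OF order.refl] by auto
    have hq': "?q ` {..<h} = arr N M' 8 ` {..<h}" "?q ` {..<h - 1} = arr N M' 8 ` {..<h - 1}"
      using sub c(7) by auto
    have okR': "regs_ok n N R'" using core by (simp add: core_def ready_def)
    let ?R = "R'(13 := 2 * N + R' 21, 21 := arr N M' 2 (R' 21))"
    have "core ?R M' Rs' Gs'" by (rule core_cong[OF core]) (use okR' in \<open>auto simp: regs_ok_upd\<close>)
    moreover have "adjl ?u = (ds @ [R 21]) @ es" "chain (arr N M' 2) (?R 21) es"
      using c(11,12) es M'[of 2] R'(4) by auto
    moreover have "\<forall>e\<in>set (ds @ [R 21]). C e \<noteq> 0 \<longrightarrow> I (pt e) \<in> arr N M' 8 ` {..<?R 15}"
      using c(13) vis e' by auto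
    moreover have "\<forall>x w. x \<in> arr N M' 8 ` {..<h - 1} \<longrightarrow> {x, w} \<in> U \<longrightarrow> w \<in> arr N M' 8 ` {..<?R 15}"
      using c(9) vis unfolding hq'(2)[symmetric] by auto
    moreover have "\<forall>v\<le>s. v \<in> arr N M' 8 ` {..<?R 15}" using c(5) vis by auto
    moreover have "?u = arr N M' 8 (h - 1)" using c(6-8) q(2) by simp
    moreover have "h \<le> R' 15" using c(7) q(1) by simp
    moreover have "40 * length es + 1 + (40 * rest (arr N M' 8 ` {..<h}) + 1 + cr) \<le> k' - 2"
      using k' hq'(1) by simp
    ultimately have "cinv s h cr ?R M' (k' - 2)"
      unfolding cinv_def using R' c(4,6) G[unfolded hq'(1)] p
      by (intro ex2I[of _ Rs' Gs'] ex2I[of _ "ds @ [R 21]" es]) simp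
    then show ?thesis using okR' B R' lt k' by (intro LD_rule) auto
  qed
  have skip: "?next R' M k'"
    if "regs_ok n N R'" "\<And>x. 13 < x \<Longrightarrow> x < 22 \<Longrightarrow> R' x = R x"
      "C (R 21) \<noteq> 0 \<longrightarrow> ?w \<in> ?q ` {..<?t}" "k \<le> k' + 30" for R' k'
  proof (rule fin[of R' M Rs Gs])
    show "core R' M Rs Gs" by (rule core_cong[OF c(1)]) (use that in auto)
    have "R' 15 = ?t" "R' 20 = R 20" using that(2) by auto
    then show "C (R 21) \<noteq> 0 \<longrightarrow> ?w \<in> ?q ` {..<R' 15}"
      "R' 20 = ?u \<and> ?u \<notin> ?a ` Gs \<or> R' 20 = ?q (R' 15 - 1) \<and> R' 15 - 1 \<notin> Rs \<and> {?u, R' 20} \<in> U"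
      "?t \<le> R' 15" using that(3) c(14) by auto
  qed (use that c k in auto)
  have add: "?next R' M' k'"
    if ch: "C (R 21) \<noteq> 0" and nv: "arr N M 7 ?w = 0" and R': "regs_ok n N R'" "R' 15 = Suc ?t" "R' 20 = ?w"
      "R' 14 = R 14" "R' 16 = R 16" "R' 17 = R 17" "R' 19 = R 19" "R' 21 = R 21"
      and M': "M' = aset N (aset N (aset N M 7 ?w 1) 8 ?t ?w) 9 ?t (R 20)" and k': "k \<le> k' + 30" for R' M' k'
  proof -
    have U: "{?u, ?w} \<in> U" using adjl_U[OF e(3) ch] .
    have wq: "?w \<notin> ?q ` {..<?t}" using c(1) w nv by (auto simp: core_def)
    have t0: "0 < ?t" using c(6,7) by simp
    have last: "\<exists>j\<in>Rs. R' 16 = (?q(?t := ?w)) j \<and> (\<forall>l\<in>Rs. l \<le> j)"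
    proof -
      obtain j where "j \<in> Rs" "R 16 = ?q j" "\<forall>l\<in>Rs. l \<le> j" using c(1) t0 by (auto simp: core_def)
      then show ?thesis using Rs R'(5) by (intro bexI[of _ j]) auto
    qed
    have G1: "(?a(?t := x)) ` Gs = ?a ` Gs" for x using Gs by (intro image_cong) auto
    obtain Gs' where b': "binv U {..<n} (?q(?t := ?w)) (?a(?t := R 20)) Rs Gs' (Suc ?t)"
      and G': "(?a(?t := R 20)) ` Gs' \<subseteq> ?q ` {..<h}"
    \<comment> \<open>The state of register 20 decides between a first child and a further
      sibling.\<close>
    proof (cases "R 20 = ?u \<and> ?u \<notin> ?a ` Gs")
      case True
      have "binv U {..<n} (?q(?t := ?w)) (?a(?t := ?u)) Rs (insert ?t Gs) (Suc ?t)"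
        using binv_first[OF b _ wq U hq] True w by simp
      moreover have "(?a(?t := ?u)) ` insert ?t Gs \<subseteq> ?q ` {..<h}"
        using G1 c(6,8,10) by auto
      ultimately show thesis using that True by metis
    next
      case False
      then have p: "R 20 = ?q (?t - 1)" "?t - 1 \<notin> Rs" "{?u, ?q (?t - 1)} \<in> U" using c(14) by auto
      have "binv U {..<n} (?q(?t := ?w)) (?a(?t := ?q (?t - 1))) Rs Gs (Suc ?t)"
        using binv_sibling[OF b _ wq t0 p(2,3) U] w by simp
      moreover have "(?a(?t := ?q (?t - 1))) ` Gs \<subseteq> ?q ` {..<h}" unfolding G1 by (rule c(10))
      ultimately show thesis using that p(1) by metis
    qed
    note ca = core_append[OF c(1) w nv b' M' R'(1,2) last]
    show ?thesis
    proof (rule fin[OF ca(1)])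
      show "R' 20 = ?u \<and> ?u \<notin> arr N M' 9 ` Gs' \<or>
        R' 20 = arr N M' 8 (R' 15 - 1) \<and> R' 15 - 1 \<notin> Rs \<and> {?u, R' 20} \<in> U"
        using R'(2,3) U ca(3) Rs by auto
      show "C (R 21) \<noteq> 0 \<longrightarrow> ?w \<in> arr N M' 8 ` {..<R' 15}"
        unfolding ca(3) R'(2) image_fun_upd_lessThan by simp
      show "arr N M' 9 ` Gs' \<subseteq> ?q ` {..<h}" unfolding ca(4) by (rule G')
      show "arr N M' j = arr N M j" if "j < 4" for j using ca(2) that by simp
      show "arr N M' 8 i = ?q i" if "i < ?t" for i unfolding ca(3) using that by simp
    qed (use R' c k k' in auto)
  qed
  have tN: "?t < N" using core_le[OF c(1)] n_less_N by simp
  have tB: "Suc ?t \<le> B" using tN B by linarith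
  show ?thesis
    unfolding CHILD_def
  proof (rule wp_seq, rule LD_rule, rule_tac[7] wp_seq, rule_tac[7] wp_if)
    assume t: "\<not> test_val (Neq 22 0) (R(13 := 4 * N + R 21, 22 := arr N M 4 (R 21)), M)"
    show "wp B Skip ?next (R(13 := 4 * N + R 21, 22 := arr N M 4 (R 21))) M (k - 1 - 2 - 1)"
      by (intro wp_skip skip) (use t ok regs_okD[OF ok] arrs k in \<open>auto simp: regs_ok_upd\<close>)
  next
    assume "test_val (Neq 22 0) (R(13 := 4 * N + R 21, 22 := arr N M 4 (R 21)), M)"
    then have ch: "C (R 21) \<noteq> 0" using regs_okD[OF ok] arrs by simp
    let ?R = "R(13 := 4 * N + R 21, 22 := arr N M 4 (R 21))"
    show "wp B (Seq (LD 23 3 21) (Seq (Assign 24 (Load 23)) (Seq (LD 25 7 24)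
       (If (Eq 25 0) APPEND Skip)))) ?next ?R M (k - 1 - 2 - 1)"
    proof (intro wp_seq LD_rule load0_rule)
      have r: "(?R(13 := 3 * N + ?R 21, 23 := arr N M 3 (?R 21))) 23 = pt (R 21)" using arrs by simp
      let ?R2 = "?R(13 := 3 * N + ?R 21, 23 := arr N M 3 (?R 21))"
      let ?R3 = "?R2(24 := arr N M 0 (?R2 23))"
      let ?R4 = "?R3(13 := 7 * N + ?R3 24, 25 := arr N M 7 (?R3 24))"
      have R4: "?R4 24 = ?w" "?R4 25 = arr N M 7 ?w" using arrs by auto
      have ok4: "regs_ok n N ?R4" using ok by (simp add: regs_ok_upd)
      have same: "\<And>x. 13 < x \<Longrightarrow> x < 22 \<Longrightarrow> ?R4 x = R x" by simp
      show "wp B (If (Eq 25 0) APPEND Skip) ?next ?R4 M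
          (k - 1 - 2 - 1 - 2 - 1 - 2)"
      proof (rule wp_if)
        show "1 \<le> k - 1 - 2 - 1 - 2 - 1 - 2" using k by simp
      next
        assume "\<not> test_val (Eq 25 0) (?R4, M)"
        then have "arr N M 7 ?w \<noteq> 0" using R4 regs_okD(1)[OF ok4] by simp
        then have "?w \<in> ?q ` {..<?t}" using c(1) w by (auto simp: core_def)
        then show "wp B Skip ?next ?R4 M (k - 1 - 2 - 1 - 2 - 1 - 2 - 1)"
          using ok4 same k by (intro wp_skip skip) auto
      next
        assume "test_val (Eq 25 0) (?R4, M)"
        then have nv: "arr N M 7 ?w = 0" using R4 regs_okD(1)[OF ok4] by simp
        obtain R5 where R5: "R5 = ?R4" by blast
        have r5: "R5 24 = ?w" "R5 15 = ?t" "R5 20 = R 20" "R5 11 = 1" "regs_ok n N R5"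
          "R5 14 = R 14" "R5 16 = R 16" "R5 17 = R 17" "R5 19 = R 19" "R5 21 = R 21"
          unfolding R5 using R4 ok4 regs_okD[OF ok] by auto
        have "wp B APPEND ?next R5 M
           (k - 1 - 2 - 1 - 2 - 1 - 2 - 1)"
          unfolding APPEND_def
          by (intro wp_seq ST_rule wp_copy wp_add add[OF ch nv])
            (use r5 B lt tN tB k in \<open>simp_all add: regs_ok_upd\<close>)
        then show "wp B APPEND ?next ?R4 M
           (k - 1 - 2 - 1 - 2 - 1 - 2 - 1)" unfolding R5 .
      qed
    qed (use ok lt B k arrs in \<open>auto simp: regs_ok_upd\<close>)
  qed (use ok lt B k in \<open>auto simp: regs_ok_upd\<close>)
qed

definition closed_upto :: "(nat \<Rightarrow> nat) \<Rightarrow> nat \<Rightarrow> nat \<Rightarrow> bool" where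
  "closed_upto q h t \<longleftrightarrow> (\<forall>x w. x \<in> q ` {..<h} \<longrightarrow> {x, w} \<in> U \<longrightarrow> w \<in> q ` {..<t})"

definition pinv :: "nat \<Rightarrow> nat \<Rightarrow> (nat \<Rightarrow> nat) \<Rightarrow> (nat \<Rightarrow> nat) \<Rightarrow> nat \<Rightarrow> bool" where
  "pinv s cr R M k \<longleftrightarrow> (\<exists>Rs Gs. core R M Rs Gs \<and> R 17 = s \<and> s < n \<and>
     (\<forall>v\<le>s. v \<in> arr N M 8 ` {..<R 15}) \<and> R 14 \<le> R 15 \<and>
     closed_upto (arr N M 8) (R 14) (R 15) \<and> arr N M 9 ` Gs \<subseteq> arr N M 8 ` {..<R 14} \<and>
     40 * rest (arr N M 8 ` {..<R 14}) + 1 + cr \<le> k)"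

lemma cinv_end:
  assumes S: "cinv s h cr R M k" and 0: "R 21 = 0"
  shows "pinv s cr R M (k - 1)"
proof -
  let ?q = "arr N M 8" and ?a = "arr N M 9" and ?t = "R 15" and ?u = "R 19"
  obtain Rs Gs ds es where c: "core R M Rs Gs" "R 14 = h" "R 17 = s" "s < n"
     "\<forall>v\<le>s. v \<in> ?q ` {..<?t}" "0 < h" "h \<le> ?t" "?u = ?q (h - 1)"
     "\<forall>x w. x \<in> ?q ` {..<h - 1} \<longrightarrow> {x, w} \<in> U \<longrightarrow> w \<in> ?q ` {..<?t}"
     "?a ` Gs \<subseteq> ?q ` {..<h}" "adjl ?u = ds @ es" "chain (arr N M 2) (R 21) es"
     "\<forall>e\<in>set ds. C e \<noteq> 0 \<longrightarrow> I (pt e) \<in> ?q ` {..<?t}"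
     "40 * length es + 1 + (40 * rest (?q ` {..<h}) + 1 + cr) \<le> k"
    using S unfolding cinv_def by (elim exE conjE) (rule that)
  have es: "es = []" using c(12) 0 by (cases es) auto
  have "closed_upto ?q h ?t"
    unfolding closed_upto_def
  proof (intro allI impI)
    fix x w assume x: "x \<in> ?q ` {..<h}" "{x, w} \<in> U"
    show "w \<in> ?q ` {..<?t}"
    proof (cases "x = ?u")
      case True
      then obtain e where "e \<in> set ds" "C e \<noteq> 0" "I (pt e) = w"
        using U_adjl[of ?u w] x(2) c(11) es by auto
      then show ?thesis using c(13) by blast
    next
      case False
      obtain i where i: "i < h" "x = ?q i" using x(1) by auto
      then have "i \<noteq> h - 1" using False c(8) by auto
      then have "x \<in> ?q ` {..<h - 1}" using i by auto
      then show ?thesis using c(9) x(2) by blast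
    qed
  qed
  moreover have "40 * rest (?q ` {..<h}) + 1 + cr \<le> k - 1" using c(14) by linarith
  ultimately show ?thesis unfolding pinv_def using c(1-5,7,10)
    by (intro ex2I[of _ Rs Gs]) simp
qed

lemma wp_PROC:
  assumes S: "pinv s cr R M k" and less: "R 14 < R 15"
  shows "wp B PROC (pinv s cr) R M (k - 1)"
proof -
  let ?q = "arr N M 8" and ?a = "arr N M 9" and ?t = "R 15" and ?h = "R 14"
  let ?u = "?q ?h"
  obtain Rs Gs where c: "core R M Rs Gs" "R 17 = s" "s < n" "\<forall>v\<le>s. v \<in> ?q ` {..<?t}" "?h \<le> ?t"
     "closed_upto ?q ?h ?t" "?a ` Gs \<subseteq> ?q ` {..<?h}" "40 * rest (?q ` {..<?h}) + 1 + cr \<le> k"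
    using S unfolding pinv_def by (elim exE conjE) (rule that)
  have rdy: "ready R M" and ok: "regs_ok n N R" using c(1) by (auto simp: core_def ready_def)
  have inj: "inj_on ?q {..<?t}" and qn: "?q ` {..<?t} \<subseteq> {..<n}" using c(1) by (auto simp: core_def binv_def)
  have u: "?u < n" "?u < N" using qn less n_less_N by auto
  have hN: "?h < N" using less core_le[OF c(1)] n_less_N by simp
  have hB: "Suc ?h \<le> B" using hN B by linarith
  have uq: "?u \<notin> ?q ` {..<?h}" using less inj_on_image_mem_iff[OF inj, of ?h "{..<?h}"] by auto
  have im: "?q ` {..<Suc ?h} = insert ?u (?q ` {..<?h})" by (simp add: lessThan_Suc)
  have k: "40 + (40 * length (adjl ?u) + (40 * rest (?q ` {..<Suc ?h}) + 1 + cr)) \<le> k"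
    using rest_insert[OF u(1) uq] c(8) im by simp
  have chn: "chain (arr N M 2) (arr N M 1 ?u) (adjl ?u)" using rdy u by (simp add: ready_def chains_def)
  have start: "cinv s (Suc ?h) cr R' M k'"
    if R': "regs_ok n N R'" "R' 14 = Suc ?h" "R' 15 = ?t" "R' 16 = R 16" "R' 17 = R 17" "R' 19 = ?u"
      "R' 20 = ?u" "R' 21 = arr N M 1 ?u" and k': "k \<le> k' + 20" for R' k'
    unfolding cinv_def
  proof (intro ex2I[of _ Rs Gs] ex2I[of _ "[]" "adjl ?u"] conjI)
    show "core R' M Rs Gs" by (rule core_cong[OF c(1)]) (use R' in auto)
    \<comment> \<open>The vertex is not among the earlier queue entries, and so far first children
      are attached only to those.\<close>
    show "R' 20 = R' 19 \<and> R' 19 \<notin> ?a ` Gs \<or> R' 20 = ?q (R' 15 - 1) \<and> R' 15 - 1 \<notin> Rs \<and> {R' 19, R' 20} \<in> U"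
      using R' uq c(7) by auto
    show "?a ` Gs \<subseteq> ?q ` {..<Suc ?h}" using c(7) im by auto
    show "\<forall>x w. x \<in> ?q ` {..<Suc ?h - 1} \<longrightarrow> {x, w} \<in> U \<longrightarrow> w \<in> ?q ` {..<R' 15}"
      using c(6) R'(3) by (simp add: closed_upto_def)
    show "40 * length (adjl ?u) + 1 + (40 * rest (?q ` {..<Suc ?h}) + 1 + cr) \<le> k'"
      using k k' by linarith
  qed (use R' c less chn in auto)
  have loop: "wp B (While (Neq 21 0) CHILD) (pinv s cr) R' M' k'" if "cinv s (Suc ?h) cr R' M' k'" for R' M' k'
  proof (rule wp_while[where I = "cinv s (Suc ?h) cr", OF that])
    fix R M k assume "cinv s (Suc ?h) cr R M k"
    then show "1 \<le> k" unfolding cinv_def by (elim exE conjE) linarith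
  next
    fix R1 M1 k1 assume S: "cinv s (Suc ?h) cr R1 M1 k1" and t: "test_val (Neq 21 0) (R1, M1)"
    have "regs_ok n N R1" using S unfolding cinv_def core_def ready_def by (elim exE conjE)
    then show "wp B CHILD (cinv s (Suc ?h) cr) R1 M1 (k1 - 1)"
      using t regs_okD(1) by (intro wp_CHILD[OF S]) fastforce
  next
    fix R1 M1 k1 assume S: "cinv s (Suc ?h) cr R1 M1 k1" and t: "\<not> test_val (Neq 21 0) (R1, M1)"
    have "regs_ok n N R1" using S unfolding cinv_def core_def ready_def by (elim exE conjE)
    then show "pinv s cr R1 M1 (k1 - 1)" using t regs_okD(1) by (intro cinv_end[OF S]) fastforce
  qed
  show ?thesis
    unfolding PROC_def
    by (intro wp_seq LD_rule wp_add wp_copy loop start)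
      (use ok regs_okD[OF ok] hN hB u B k in \<open>simp_all add: regs_ok_upd\<close>)
qed

definition rinv :: "nat \<Rightarrow> (nat \<Rightarrow> nat) \<Rightarrow> (nat \<Rightarrow> nat) \<Rightarrow> nat \<Rightarrow> bool" where
  "rinv cr R M k \<longleftrightarrow> (\<exists>Rs Gs. core R M Rs Gs \<and> R 17 \<le> n \<and>
     (\<forall>v<R 17. v \<in> arr N M 8 ` {..<R 15}) \<and> R 14 = R 15 \<and>
     closed_upto (arr N M 8) (R 15) (R 15) \<and> arr N M 9 ` Gs \<subseteq> arr N M 8 ` {..<R 15} \<and>
     40 * rest (arr N M 8 ` {..<R 15}) + 20 * (n - R 17) + 1 + cr \<le> k)"

lemma wp_VISIT:
  assumes S: "rinv cr R M k" and less: "R 17 < n"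
  shows "wp B VISIT (rinv cr) R M (k - 1)"
proof -
  let ?q = "arr N M 8" and ?a = "arr N M 9" and ?t = "R 15" and ?s = "R 17"
  obtain Rs Gs where c: "core R M Rs Gs" "?s \<le> n" "\<forall>v<?s. v \<in> ?q ` {..<?t}" "R 14 = ?t"
     "closed_upto ?q ?t ?t" "?a ` Gs \<subseteq> ?q ` {..<?t}"
     "40 * rest (?q ` {..<?t}) + 20 * (n - ?s) + 1 + cr \<le> k"
    using S unfolding rinv_def by (elim exE conjE) (rule that)
  have ok: "regs_ok n N R" using c(1) by (auto simp: core_def ready_def)
  have b: "binv U {..<n} ?q ?a Rs Gs ?t" using c(1) by (simp add: core_def)
  have Gs: "Gs \<subseteq> {0<..<?t}" using b by (auto simp: binv_def)
  have lt: "?s < N" "?t < N" "Suc ?t \<le> B" "Suc ?s \<le> B"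
    using less core_le[OF c(1)] n_less_N B by linarith+
  \<comment> \<open>Reserve for the later start vertices, 20 each; the extra 2 covers the increment
    of register 17 and the unit that \<open>rinv\<close> demands.\<close>
  define cr' where "cr' = 20 * (n - Suc ?s) + 2 + cr"
  have k: "40 * rest (?q ` {..<?t}) + 18 + cr' \<le> k"
  proof -
    have "20 * (n - ?s) = 20 + 20 * (n - Suc ?s)" using less by linarith
    then show ?thesis using c(7) unfolding cr'_def by linarith
  qed
  have next_s: "wp B (Assign 17 (Add 17 11)) (rinv cr) R' M' k'"
    if p: "pinv ?s cr' R' M' (Suc k')" "R' 14 = R' 15" for R' M' k'
  proof (rule wp_add)
    obtain Rs Gs where d: "core R' M' Rs Gs" "R' 17 = ?s" "\<forall>v\<le>?s. v \<in> arr N M' 8 ` {..<R' 15}"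
     "closed_upto (arr N M' 8) (R' 15) (R' 15)" "arr N M' 9 ` Gs \<subseteq> arr N M' 8 ` {..<R' 15}"
     "40 * rest (arr N M' 8 ` {..<R' 15}) + 1 + cr' \<le> Suc k'"
      using p(1) unfolding pinv_def p(2) by (elim exE conjE) (rule that)
    have ok': "regs_ok n N R'" using d(1) by (auto simp: core_def ready_def)
    have r: "R' 17 + R' 11 = Suc ?s" using d(2) regs_okD[OF ok'] by simp
    then show "R' 17 + R' 11 \<le> B" using lt by simp
    show "1 \<le> k'" using d(6) by (simp add: cr'_def)
    let ?R = "R'(17 := R' 17 + R' 11)"
    have "core ?R M' Rs Gs" by (rule core_cong[OF d(1)]) (use ok' in \<open>auto simp: regs_ok_upd\<close>)
    moreover have "?R 17 \<le> n" "\<forall>v<?R 17. v \<in> arr N M' 8 ` {..<?R 15}" using r less d(3) by auto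
    moreover have "40 * rest (arr N M' 8 ` {..<R' 15}) + 20 * (n - ?R 17) + 1 + cr \<le> k' - 1"
      using d(6) r unfolding cr'_def by simp
    ultimately show "rinv cr ?R M' (k' - 1)"
      unfolding rinv_def using d(4,5) p(2) by (intro ex2I[of _ Rs Gs]) simp
  qed
  have loop: "wp B (While (Less 14 15) PROC) (wp B (Assign 17 (Add 17 11)) (rinv cr)) R' M' k'"
    if "pinv ?s cr' R' M' k'" for R' M' k'
  proof (rule wp_while[where I = "pinv ?s cr'", OF that])
    fix R M k assume "pinv ?s cr' R M k"
    then show "1 \<le> k" unfolding pinv_def by (elim exE conjE) linarith
  next
    fix R1 M1 k1 assume "pinv ?s cr' R1 M1 k1" "test_val (Less 14 15) (R1, M1)"
    then show "wp B PROC (pinv ?s cr') R1 M1 (k1 - 1)" by (intro wp_PROC) auto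
  next
    fix R1 M1 k1 assume p: "pinv ?s cr' R1 M1 k1" and t: "\<not> test_val (Less 14 15) (R1, M1)"
    have "R1 14 \<le> R1 15" "1 \<le> k1" using p unfolding pinv_def by (elim exE conjE, linarith)+
    then show "wp B (Assign 17 (Add 17 11)) (rinv cr) R1 M1 (k1 - 1)" using p t by (intro next_s) auto
  qed
  have start: "pinv ?s cr' R' M' k'"
    if nv: "arr N M 7 ?s = 0" and R': "regs_ok n N R'" "R' 14 = R 14" "R' 15 = Suc ?t" "R' 16 = ?s" "R' 17 = ?s"
      and M': "M' = aset N (aset N (aset N M 7 ?s 1) 8 ?t ?s) 9 ?t (R 16)" and k': "k \<le> k' + 17" for R' M' k'
  proof -
    have sq: "?s \<notin> ?q ` {..<?t}" using c(1) less nv by (auto simp: core_def)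
    have b': "binv U {..<n} (?q(?t := ?s)) (?a(?t := R 16)) (insert ?t Rs) Gs (Suc ?t)"
      by (rule binv_root[OF b _ sq]) (use less c(1,5) in \<open>auto simp: closed_upto_def core_def\<close>)
    have Rs: "Rs \<subseteq> {..<?t}" using b by (simp add: binv_def)
    have last: "\<exists>j\<in>insert ?t Rs. R' 16 = (?q(?t := ?s)) j \<and> (\<forall>l\<in>insert ?t Rs. l \<le> j)"
      using Rs R'(4) by (intro bexI[of _ ?t]) auto
    note ca = core_append[OF c(1) less nv b' M' R'(1,3) last]
    have im: "arr N M' 8 ` {..<Suc ?t} = insert ?s (?q ` {..<?t})" "arr N M' 8 ` {..<?t} = ?q ` {..<?t}"
      unfolding ca(3) by (rule image_fun_upd_lessThan) (auto intro: image_cong)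
    have "closed_upto (arr N M' 8) ?t (Suc ?t)" using c(5) unfolding closed_upto_def im by blast
    moreover have "arr N M' 9 ` Gs = ?a ` Gs" unfolding ca(4) using Gs by (intro image_cong) auto
    moreover have "\<forall>v\<le>?s. v \<in> arr N M' 8 ` {..<Suc ?t}" unfolding im using c(3) by (auto simp: le_less)
    moreover have "40 * rest (?q ` {..<?t}) + 1 + cr' \<le> k'" using k k' by linarith
    ultimately show ?thesis
      unfolding pinv_def R'(2,3) c(4) im(2) using ca(1) R'(5) less c(6)
      by (intro ex2I[of _ "insert ?t Rs" Gs]) simp
  qed
  show ?thesis
    unfolding VISIT_def
  proof (rule wp_seq, rule LD_rule, rule_tac[7] wp_seq, rule_tac[7] wp_if)
    assume t: "\<not> test_val (Eq 18 0) (R(13 := 7 * N + R 17, 18 := arr N M 7 (R 17)), M)"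
    let ?R = "R(13 := 7 * N + R 17, 18 := arr N M 7 (R 17))"
    have "arr N M 7 ?s \<noteq> 0" using t regs_okD[OF ok] by simp
    then have "?s \<in> ?q ` {..<?t}" using c(1) less by (auto simp: core_def)
    then have v: "\<forall>v\<le>?s. v \<in> ?q ` {..<?t}" using c(3) by (auto simp: le_less)
    have "core ?R M Rs Gs" by (rule core_cong[OF c(1)]) (use ok in \<open>auto simp: regs_ok_upd\<close>)
    then have "pinv ?s cr' ?R M (k - 1 - 2 - 1)"
      unfolding pinv_def using c(4-6) less v k by (intro ex2I[of _ Rs Gs]) auto
    moreover have "Suc (k - 1 - 2 - 1 - 1) = k - 1 - 2 - 1" using k by linarith
    ultimately show "wp B Skip (wp B (Assign 17 (Add 17 11)) (rinv cr)) ?R M (k - 1 - 2 - 1)"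
      using c(4) k by (intro wp_skip next_s) auto
  next
    assume t: "test_val (Eq 18 0) (R(13 := 7 * N + R 17, 18 := arr N M 7 (R 17)), M)"
    have nv: "arr N M 7 ?s = 0" using t regs_okD[OF ok] by simp
    show "wp B (Seq (ST 7 17 11) (Seq (ST 8 15 17) (Seq (ST 9 15 16)
          (Seq (Assign 16 (Copy 17)) (Seq (Assign 15 (Add 15 11)) (While (Less 14 15) PROC))))))
       (wp B (Assign 17 (Add 17 11)) (rinv cr)) (R(13 := 7 * N + R 17, 18 := arr N M 7 (R 17))) M (k - 1 - 2 - 1)"
      by (intro wp_seq ST_rule wp_copy wp_add loop start[OF nv])
        (use ok regs_okD[OF ok] lt B k in \<open>simp_all add: regs_ok_upd\<close>)
  qed (use ok lt B k in \<open>auto simp: regs_ok_upd\<close>)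
qed

lemma wp_BFS:
  assumes rdy: "ready R M" and ch: "\<And>e. arr N M 4 e = C e" and zero: "\<And>v. arr N M 7 v = 0"
    and k: "40 * (n + 2 * m) + 20 * n + 5 + cr \<le> k"
    and post: "\<And>R' M' k' Rs Gs. ready R' M' \<Longrightarrow> binv U {..<n} (arr N M' 8) (arr N M' 9) Rs Gs n \<Longrightarrow>
      arr N M' 8 ` {..<n} = {..<n} \<Longrightarrow> cr \<le> k' \<Longrightarrow> Q R' M' k'"
  shows "wp B BFS Q R M k"
proof -
  have ok: "regs_ok n N R" using rdy by (simp add: ready_def)
  have loop: "wp B (While (Less 17 1) VISIT) Q R' M' k'" if "rinv cr R' M' k'" for R' M' k'
  proof (rule wp_while[where I = "rinv cr", OF that])
    fix R M k assume "rinv cr R M k"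
    then show "1 \<le> k" unfolding rinv_def by (elim exE conjE) linarith
  next
    fix R1 M1 k1 assume S: "rinv cr R1 M1 k1" and t: "test_val (Less 17 1) (R1, M1)"
    have "regs_ok n N R1" using S unfolding rinv_def core_def ready_def by (elim exE conjE)
    then have "R1 1 = n" by (simp add: regs_ok_def)
    then show "wp B VISIT (rinv cr) R1 M1 (k1 - 1)"
      using t by (intro wp_VISIT[OF S]) simp
  next
    fix R1 M1 k1 assume S: "rinv cr R1 M1 k1" and t: "\<not> test_val (Less 17 1) (R1, M1)"
    obtain Rs Gs where c: "core R1 M1 Rs Gs" "R1 17 \<le> n" "\<forall>v<R1 17. v \<in> arr N M1 8 ` {..<R1 15}" "1 + cr \<le> k1"
      using S unfolding rinv_def by (elim exE conjE) (rule that, assumption+, linarith)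
    have ok: "regs_ok n N R1" using c(1) unfolding core_def ready_def by blast
    then have "R1 1 = n" by (simp add: regs_ok_def)
    then have "R1 17 = n" using t c(2) by simp
    moreover have b: "binv U {..<n} (arr N M1 8) (arr N M1 9) Rs Gs (R1 15)" using c(1) by (simp add: core_def)
    ultimately have eq: "arr N M1 8 ` {..<R1 15} = {..<n}" using c(3) by (auto simp: binv_def)
    moreover have "inj_on (arr N M1 8) {..<R1 15}" using b by (simp add: binv_def)
    ultimately have "R1 15 = n" using card_image by fastforce
    then show "Q R1 M1 (k1 - 1)" using b eq c(1,4) by (intro post) (auto simp: core_def)
  qed
  have start: "rinv cr R' M k'"
    if R': "regs_ok n N R'" "R' 14 = 0" "R' 15 = 0" "R' 16 = 0" "R' 17 = 0" and k': "k \<le> k' + 4" for R' k'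
  proof -
    have "ready R' M" using rdy R'(1) by (rule ready_cong) simp
    moreover have "binv U {..<n} (arr N M 8) (arr N M 9) {} {} 0" by (simp add: binv_def)
    ultimately have "core R' M {} {}" using ch zero R' by (simp add: core_def)
    then show ?thesis unfolding rinv_def using R' k k' rest_empty
      by (intro exI[of _ "{}"]) (simp add: closed_upto_def)
  qed
  show ?thesis
    unfolding BFS_def
    by (intro wp_seq wp_copy loop start) (use ok regs_okD[OF ok] k in \<open>simp_all add: regs_ok_upd\<close>)
qed

end

section \<open>The complete program\<close>

text \<open>Addresses come from registers: register 0, still 0, addresses \<open>n\<close>, and
  register 11 with the constant 1 doubles as the address of \<open>m\<close>. Each array base arises
  by adding \<open>N\<close> to the previous one.\<close>

definition SETUP :: com where
  "SETUP = Seq (Assign 11 (Const 1)) (Seq (Assign 1 (Load 0)) (Seq (Assign 13 (Load 11))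
     (Seq (Assign 12 (Const 3)) (Seq (Assign 12 (Add 12 1)) (Seq (Assign 2 (Add 12 13))
     (Seq (Assign 2 (Add 2 13)) (Seq (Assign 3 (Add 2 2)) (Seq (Assign 4 (Add 3 2))
     (Seq (Assign 5 (Add 4 2)) (Seq (Assign 6 (Add 5 2)) (Seq (Assign 7 (Add 6 2))
     (Seq (Assign 8 (Add 7 2)) (Seq (Assign 9 (Add 8 2)) (Assign 10 (Add 9 2)))))))))))))))"

text \<open>The pairs overwrite the beginning of memory. They end at cell \<open>2 * n - 2\<close>,
  below arrays 8 and 9, from which they are read.\<close>

definition OUTPUT :: com where
  "OUTPUT = Seq (Assign 14 (Copy 11)) (Seq (Assign 15 (Copy 11)) (Seq (While (Less 14 1)
     (Seq (LD 16 8 14) (Seq (Store 15 16) (Seq (Assign 15 (Add 15 11))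
       (Seq (LD 16 9 14) (Seq (Store 15 16) (Seq (Assign 15 (Add 15 11)) (Assign 14 (Add 14 11)))))))))
     (Seq (Assign 14 (Sub 1 11)) (Store 0 14))))"

definition ALG :: com where
  "ALG = Seq SETUP (Seq BUILD (Seq KRUSKAL (Seq BFS OUTPUT)))"

lemma wp_SETUP:
  assumes "M 0 = n" "M 1 = m" "N = 3 + n + 2 * m" "10 * N \<le> B" "15 + cr \<le> k"
    and post: "\<And>R' k'. regs_ok n N R' \<Longrightarrow> cr \<le> k' \<Longrightarrow> Q R' M k'"
  shows "wp B SETUP Q (\<lambda>_. 0) M k"
proof -
  have j: "{1..9} = {1, 2, 3, 4, 5, 6, 7, 8, 9 :: nat}" by auto
  have hN: "3 + n + m + m = N" "3 + n + m \<le> B" "3 + n \<le> B" "3 \<le> B" "1 \<le> B" using assms(3,4) by auto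
  have hB: "N \<le> B" "2 * N \<le> B" "3 * N \<le> B" "4 * N \<le> B" "5 * N \<le> B" "6 * N \<le> B" "7 * N \<le> B"
    "8 * N \<le> B" "9 * N \<le> B" using assms(4) by auto
  have add: "wp B (Seq (Assign x (Add y z)) c) Q R M k" if "R y + R z = v" "v \<le> B" "1 \<le> k" "wp B c Q (R(x := v)) M (k - 1)"
    for x y z c R k v
    using that by (intro wp_seq wp_add) auto
  define R2 :: "nat \<Rightarrow> nat" where "R2 = (\<lambda>_. 0)(11 := 1, 1 := n, 13 := m, 12 := 3, 12 := 3 + n, 2 := 3 + n + m, 2 := N)"
  have R2: "R2 0 = 0" "R2 1 = n" "R2 2 = N" "R2 11 = 1" "R2 12 = 3 + n" by (auto simp: R2_def)
  define R3 where "R3 = R2(3 := 2 * N, 4 := 3 * N, 5 := 4 * N, 6 := 5 * N, 7 := 6 * N, 8 := 7 * N, 9 := 8 * N, 10 := 9 * N)"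
  have "\<forall>j\<in>{1..9}. R3 (Suc j) = j * N" unfolding j using R2 by (simp add: R3_def del: One_nat_def)
  then have "regs_ok n N R3" using R2 by (simp add: regs_ok_def R3_def)
  then have "wp B (Assign 10 (Add 9 2)) Q (R2(3 := 2 * N, 4 := 3 * N, 5 := 4 * N, 6 := 5 * N, 7 := 6 * N, 8 := 7 * N, 9 := 8 * N)) M (k - 14)"
    using R2 assms(5) hB by (intro wp_add post) (auto simp: R3_def)
  then have "wp B (Seq (Assign 3 (Add 2 2)) (Seq (Assign 4 (Add 3 2))
     (Seq (Assign 5 (Add 4 2)) (Seq (Assign 6 (Add 5 2)) (Seq (Assign 7 (Add 6 2))
     (Seq (Assign 8 (Add 7 2)) (Seq (Assign 9 (Add 8 2)) (Assign 10 (Add 9 2))))))))) Q R2 M (k - 7)"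
    using R2 hB assms(5)
    by (intro add[where v = "2 * N" and x = 3] add[where v = "3 * N" and x = 4] add[where v = "4 * N" and x = 5]
        add[where v = "5 * N" and x = 6] add[where v = "6 * N" and x = 7] add[where v = "7 * N" and x = 8]
        add[where v = "8 * N" and x = 9]) simp_all
  then show ?thesis
    unfolding SETUP_def R2_def using assms(1,2,5) hN hB
    by (intro wp_seq[of _ "Assign 11 (Const 1)"] wp_seq[of _ "Assign 1 (Load 0)"] wp_seq[of _ "Assign 13 (Load 11)"]
        wp_seq[of _ "Assign 12 (Const 3)"] wp_const wp_load
        add[where v = "3 + n" and x = 12] add[where v = "3 + n + m" and x = 2 and y = 12] add[where v = N and x = 2 and y = 2])
      (simp_all del: One_nat_def)
qed

lemma arr_upd_low: "x < j * N \<Longrightarrow> arr N (M(x := v)) j = arr N M j"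
  by (auto simp: arr_def)

lemma wp_OUTPUT:
  assumes ok: "regs_ok n N R" "10 * N \<le> B" "0 < n" "n < N" "10 * n + 5 \<le> k"
    and post: "\<And>R' M' k'. M' 0 = n - 1 \<Longrightarrow>
      (\<And>i. i < n - 1 \<Longrightarrow> M' (2 * i + 1) = arr N M 8 (Suc i) \<and> M' (2 * i + 2) = arr N M 9 (Suc i)) \<Longrightarrow> Q R' M' k'"
  shows "wp B OUTPUT Q R M k"
proof -
  define J where "J R' M' k' \<longleftrightarrow> regs_ok n N R' \<and> arr N M' 8 = arr N M 8 \<and> arr N M' 9 = arr N M 9 \<and>
    (\<exists>j<n. R' 14 = Suc j \<and> R' 15 = 2 * j + 1 \<and> 10 * (n - j) + 3 \<le> k' \<and>
      (\<forall>i<j. M' (2 * i + 1) = arr N M 8 (Suc i) \<and> M' (2 * i + 2) = arr N M 9 (Suc i)))" for R' M' k'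
  have loop: "wp B (While (Less 14 1)
     (Seq (LD 16 8 14) (Seq (Store 15 16) (Seq (Assign 15 (Add 15 11))
       (Seq (LD 16 9 14) (Seq (Store 15 16) (Seq (Assign 15 (Add 15 11)) (Assign 14 (Add 14 11)))))))))
     (wp B (Seq (Assign 14 (Sub 1 11)) (Store 0 14)) Q) R' M' k'" if "J R' M' k'" for R' M' k'
  proof (rule wp_while[where I = J, OF that])
    fix R M k assume "J R M k"
    then show "1 \<le> k" by (auto simp: J_def)
  next
    fix R1 M1 k1 assume J: "J R1 M1 k1" and t: "\<not> test_val (Less 14 1) (R1, M1)"
    then obtain j where j: "j < n" "R1 14 = Suc j" "10 * (n - j) + 3 \<le> k1"
      "\<forall>i<j. M1 (2 * i + 1) = arr N M 8 (Suc i) \<and> M1 (2 * i + 2) = arr N M 9 (Suc i)"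
      and ok1: "regs_ok n N R1" by (auto simp: J_def)
    have r: "R1 0 = 0" "R1 1 = n" "R1 11 = 1" using ok1 by (auto simp: regs_ok_def)
    then have "j = n - 1" using j t by simp
    then show "wp B (Seq (Assign 14 (Sub 1 11)) (Store 0 14)) Q R1 M1 (k1 - 1)"
      using r j by (intro wp_seq wp_sub wp_store post) auto
  next
    fix R1 M1 k1 assume J: "J R1 M1 k1" and t: "test_val (Less 14 1) (R1, M1)"
    then obtain j where j: "j < n" "R1 14 = Suc j" "R1 15 = 2 * j + 1" "10 * (n - j) + 3 \<le> k1"
      "\<forall>i<j. M1 (2 * i + 1) = arr N M 8 (Suc i) \<and> M1 (2 * i + 2) = arr N M 9 (Suc i)"
      and ok1: "regs_ok n N R1" and a: "arr N M1 8 = arr N M 8" "arr N M1 9 = arr N M 9" by (auto simp: J_def)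
    have r: "R1 1 = n" "R1 11 = 1" using ok1 by (auto simp: regs_ok_def)
    have jn: "Suc j < n" using t r j by simp
    have lt: "Suc j < N" "2 * j + 3 \<le> B" "Suc (Suc j) \<le> B" using jn ok(2,4) by linarith+
    have low: "2 * j + 2 < 8 * N" "2 * j + 2 < 9 * N" using jn ok(4) by linarith+
    have k1: "10 + (10 * (n - Suc j) + 3) \<le> k1" using j(4) jn by linarith
    let ?M = "(M1(2 * j + 1 := arr N M 8 (Suc j)))(2 * j + 2 := arr N M 9 (Suc j))"
    have arrs: "arr N (M1(2 * j + 1 := x)) 9 = arr N M 9" "arr N (M1(Suc (2 * j) := x)) 9 = arr N M 9"
      "arr N ?M 8 = arr N M 8" "arr N ?M 9 = arr N M 9" for x
      using low a by (simp_all add: arr_upd_low del: fun_upd_apply)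
    have fin: "J R' M' k'" if R': "regs_ok n N R'" "R' 14 = Suc (Suc j)" "R' 15 = 2 * j + 3" "M' = ?M" "k1 \<le> k' + 10"
      for R' M' k'
    proof -
      have "\<forall>i<Suc j. M' (2 * i + 1) = arr N M 8 (Suc i) \<and> M' (2 * i + 2) = arr N M 9 (Suc i)"
        using j(5) R'(4) by (auto simp: less_Suc_eq)
      then show ?thesis unfolding J_def using R' arrs(3,4) k1 jn by (intro conjI exI[of _ "Suc j"]) auto
    qed
    show "wp B (Seq (LD 16 8 14) (Seq (Store 15 16) (Seq (Assign 15 (Add 15 11))
       (Seq (LD 16 9 14) (Seq (Store 15 16) (Seq (Assign 15 (Add 15 11)) (Assign 14 (Add 14 11)))))))) J R1 M1 (k1 - 1)"
      by (intro wp_seq wp_LD[where n = n and N = N] wp_store wp_add fin)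
        (use ok(2) ok1 r j lt k1 a in \<open>simp_all add: regs_ok_upd arrs del: One_nat_def\<close>)
  qed
  have start: "J R' M k'" if "regs_ok n N R'" "R' 14 = 1" "R' 15 = 1" "k \<le> k' + 2" for R' k'
    unfolding J_def using that ok by (auto intro!: exI[of _ 0])
  have r: "R 11 = 1" using ok(1) by (simp add: regs_ok_def)
  show ?thesis
    unfolding OUTPUT_def
    by (intro wp_seq wp_copy loop start) (use ok r in \<open>simp_all add: regs_ok_upd\<close>)
qed

lemma output_pairs_eq:
  assumes "0 < n" "M 0 = n - 1"
    "\<And>i. i < n - 1 \<Longrightarrow> M (2 * i + 1) = q (Suc i) \<and> M (2 * i + 2) = a (Suc i)"
  shows "output_pairs (R, M) = (\<lambda>i. {q i, a i}) ` {0<..<n}"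
proof -
  have "{0<..<n} = Suc ` {..<n - 1}"
    using assms(1) by (auto simp: image_iff Bex_def gr0_conv_Suc)
  then have "(\<lambda>i. {q i, a i}) ` {0<..<n} = (\<lambda>i. {q (Suc i), a (Suc i)}) ` {..<n - 1}"
    by (simp add: image_image)
  also have "\<dots> = (\<lambda>i. {M (2 * i + 1), M (2 * i + 2)}) ` {..<n - 1}"
    using assms(3) by (intro image_cong) auto
  finally show ?thesis using assms(2) by (auto simp: output_pairs_def)
qed

lemma length_concat_pairs: "length (concat (map (\<lambda>(u, v). [u, v]) es)) = 2 * length es"
  by (induction es) auto

lemma nth_concat_pairs:
  "j < length es \<Longrightarrow> concat (map (\<lambda>(u, v). [u, v]) es) ! (2 * j) = fst (es ! j) \<and>
     concat (map (\<lambda>(u, v). [u, v]) es) ! Suc (2 * j) = snd (es ! j)"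
proof (induction es arbitrary: j)
  case (Cons e es)
  then show ?case by (cases j; cases e) auto
qed simp

text \<open>Ten arrays of length \<open>N\<close> must be addressable. The base is at least 3 and
  its fourth power exceeds 20, which gives the exponent 5.\<close>

lemma word_size:
  assumes "1 \<le> n"
  shows "10 * (3 + n + 2 * m) \<le> (n + m + r + 2 :: nat) ^ 5"
proof -
  define x where "x = n + m + r + 2"
  have "3 ^ 4 \<le> x ^ 4" using assms by (intro power_mono) (auto simp: x_def)
  then have "20 * x \<le> x ^ 4 * x" by (intro mult_le_mono1) simp
  also have "\<dots> = x ^ 5" using power_Suc2[of x 4] by simp
  finally have "20 * x \<le> x ^ 5" .
  moreover have "10 * (3 + n + 2 * m) \<le> 20 * x" using assms by (simp add: x_def)
  ultimately show ?thesis unfolding x_def by (rule le_trans[rotated])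
qed

theorem theorem5p11:
  shows "\<exists>(alg :: com) (C :: nat) (d :: nat). \<forall>(n :: nat) E (r :: nat) L ws.
    simple_graph {..<n} E \<longrightarrow> linear_order_on {..<n} L \<longrightarrow> encodes_input ws n E r L \<longrightarrow>
    (\<exists>t s F.
       exec ((n + card E + r + 2) ^ d) alg (init_state ws) t s \<and>
       F = output_pairs s \<and>
       F \<subseteq> all_pairs {..<n} \<and>
       tree_graph {..<n} F \<and>
       max_degree {..<n} F \<le> 3 \<and>
       adm r {..<n} (E \<union> F) L \<le> 2 + 2 * col (2 * r) {..<n} E L \<and>
       t \<le> C * ((n + card E) * inv_ack (card E)))"
proof (rule exI[of _ ALG], rule exI[of _ "1000"], rule exI[of _ "5"], intro allI impI)
  fix n r :: nat and E L ws
  assume graph: "simple_graph {..<n} E" and order: "linear_order_on {..<n} L"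
    and enc: "encodes_input ws n E r L"
  obtain vs es where vs: "set vs = {..<n}" "sorted_wrt (less_L L) vs"
    and es: "distinct (map edge_of es)" "edge_of ` set es = E"
    and ws: "ws = [n, length es, r] @ vs @ concat (map (\<lambda>(u, v). [u, v]) es)"
    using enc by (auto simp: encodes_input_def lists_order_def lists_edges_def)
  define m where "m = length es"
  define N where "N = 3 + n + 2 * m"
  define B where "B = (n + card E + r + 2) ^ 5"
  define K where "K = inv_ack m + 4"
  define M where "M = snd (init_state ws)"
  define I where "I = arr N M 0"
  \<comment> \<open>The two incidences of an edge are adjacent cells, so the parity of the offset in
    the edge list tells on which side the opposite one lies.\<close>
  define pt where "pt e = (if even (e - (3 + n)) then Suc e else e - 1)" for e
  have mE: "card E = m" using distinct_card[OF es(1)] es(2) by (simp add: m_def)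
  have n: "0 < n" using graph by (auto simp: simple_graph_def)
  have lvs: "length vs = n" using distinct_card[OF sorted_wrt_less_L_distinct[OF vs(2)]] vs(1) by simp
  have lws: "length ws = N" using ws lvs length_concat_pairs[of es] by (simp add: N_def m_def)
  have NB: "10 * N \<le> B" using word_size[of n m r] n unfolding B_def N_def mE by simp
  have Mws: "M a = (if a < N then ws ! a else 0)" for a
    using lws by (simp add: M_def init_state_def)
  have I: "I a = ws ! a" if "a < N" for a using that Mws[of a] by (simp add: I_def arr_def)
  have M01: "M 0 = n" "M 1 = m" using Mws N_def ws by (auto simp: m_def)
  have I_vs: "I (3 + i) = vs ! i" if "i < n" for i
  proof -
    have "3 + i < N" using that by (simp add: N_def)
    then show ?thesis using I[of "3 + i"] that lvs ws by (simp add: nth_append)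
  qed
  have I_es: "I (3 + n + 2 * j) = fst (es ! j)" "I (Suc (3 + n + 2 * j)) = snd (es ! j)" if j: "j < m" for j
  proof -
    have "3 + n + 2 * j < N" "Suc (3 + n + 2 * j) < N" using j by (auto simp: N_def)
    moreover have "ws ! (3 + (n + l)) = concat (map (\<lambda>(u, v). [u, v]) es) ! l" for l
      using ws lvs by (simp add: nth_append)
    from this[of "2 * j"] this[of "Suc (2 * j)"]
    have "ws ! (3 + n + 2 * j) = fst (es ! j)" "ws ! Suc (3 + n + 2 * j) = snd (es ! j)"
      using nth_concat_pairs[of j es] j by (simp_all add: m_def add.assoc)
    ultimately show "I (3 + n + 2 * j) = fst (es ! j)" "I (Suc (3 + n + 2 * j)) = snd (es ! j)"
      using I by simp_all
  qed
  have pt: "pt (3 + n + 2 * j) = Suc (3 + n + 2 * j)" "pt (Suc (3 + n + 2 * j)) = 3 + n + 2 * j" for j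
    by (simp_all add: pt_def)
  have edge: "{fst (es ! j), snd (es ! j)} \<in> E" if "j < m" for j
    using that es(2) nth_mem[of j es] unfolding m_def edge_of_def by blast
  interpret ram_graph n m N B K I pt E L vs
  proof
    show "{I e, I (pt e)} \<in> E" if e: "e \<in> {3 + n..<N}" for e
    proof (cases "even (e - (3 + n))")
      case True
      then obtain j where "e - (3 + n) = 2 * j" by blast
      then have "e = 3 + n + 2 * j" "j < m" using e N_def by auto
      then show ?thesis using I_es edge pt by simp
    next
      case False
      then obtain j where "e - (3 + n) = Suc (2 * j)" by (metis oddE Suc_eq_plus1)
      then have "e = Suc (3 + n + 2 * j)" "j < m" using e N_def by auto
      then show ?thesis using I_es edge pt by (simp add: insert_commute)
    qed
    show "\<exists>e\<in>{3 + n..<N}. I e = u \<and> I (pt e) = w" if uw: "{u, w} \<in> E" for u w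
    proof -
      obtain j where j: "j < m" "{u, w} = {fst (es ! j), snd (es ! j)}"
        using uw es(2) unfolding m_def edge_of_def by (auto simp: in_set_conv_nth)
      have "3 + n + 2 * j \<in> {3 + n..<N}" "Suc (3 + n + 2 * j) \<in> {3 + n..<N}" using j(1) by (auto simp: N_def)
      then show ?thesis using j(2) I_es[OF j(1)] pt[of j] unfolding doubleton_eq_iff by metis
    qed
    show "2 * m + 1 < ack K 1" unfolding K_def by (rule inv_ack_bounds(2))
  qed (use N_def NB graph order vs I_vs pt in auto)
  have zero: "arr N M j a = 0" if "1 \<le> j" for j a
  proof -
    have "N \<le> j * N + a" using that by (metis le_add1 le_trans mult_le_mono1 nat_mult_1)
    then show ?thesis using Mws[of "j * N + a"] by (simp add: arr_def)
  qed
  have "bnd B (\<lambda>_. 0) M"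
  proof -
    \<comment> \<open>The base contains \<open>r\<close> so that the input cell holding
      \<open>r\<close> fits into a word as well.\<close>
    have x: "n + m + r + 2 \<le> B" unfolding B_def mE by (rule self_le_power) auto
    have "ws ! a \<le> B" if "a < N" for a
    proof -
      have "ws ! a \<in> set ws" using that lws by simp
      moreover have "v \<le> n" if v: "v \<in> set (concat (map (\<lambda>(u, v). [u, v]) es))" for v
      proof -
        obtain e where e: "e \<in> set es" "v = fst e \<or> v = snd e" using v by auto
        then have "{fst e, snd e} \<in> E" using es(2) by (auto simp: edge_of_def)
        then show ?thesis using edge_lt e(2) by fastforce
      qed
      moreover have "v \<le> n" if "v \<in> set vs" for v using that vs(1) by auto
      ultimately have "ws ! a \<le> n \<or> ws ! a = m \<or> ws ! a = r" unfolding ws m_def by auto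
      then show ?thesis using x by linarith
    qed
    then show ?thesis by (simp add: bnd_def Mws)
  qed
  \<comment> \<open>The output depends on the memory alone, hence the quantification over register
    contents.\<close>
  define good where "good M' \<longleftrightarrow> (\<forall>R'. tree_graph {..<n} (output_pairs (R', M')) \<and>
    max_degree {..<n} (output_pairs (R', M')) \<le> 3 \<and>
    adm r {..<n} (E \<union> output_pairs (R', M')) L \<le> 2 + 2 * col (2 * r) {..<n} E L)" for M'
  \<comment> \<open>Credits are budgeted backwards: each budget is the cost of one phase plus that
    of the phases after it.\<close>
  define k4 where "k4 = 10 * n + 5"
  define k3 where "k3 = 40 * (n + 2 * m) + 20 * n + 5 + k4"
  define k2 where "k2 = (30 * K + 60) * (2 * m) + (10 * K + 20) * n + 2 + k3"
  define k1 where "k1 = 22 * m + 2 + k2"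
  have "wp B ALG (\<lambda>R' M' k'. good M') (\<lambda>_. 0) M (15 + k1)"
    unfolding ALG_def
  proof (rule wp_seq, rule wp_SETUP[OF M01 N_def NB order.refl])
    fix R1 k assume 1: "regs_ok n N R1" "k1 \<le> k"
    show "wp B (Seq BUILD (Seq KRUSKAL (Seq BFS OUTPUT))) (\<lambda>R' M' k'. good M') R1 M k"
    proof (rule wp_seq, rule wp_BUILD[OF 1(1) _ _ 1(2)[unfolded k1_def]])
      fix R2 M2 k assume 2: "ready R2 M2" "\<And>j. 4 \<le> j \<Longrightarrow> arr N M2 j = arr N M j" "k2 \<le> k"
      show "wp B (Seq KRUSKAL (Seq BFS OUTPUT)) (\<lambda>R' M' k'. good M') R2 M2 k"
      proof (rule wp_seq, rule wp_KRUSKAL[OF 2(1) _ 2(3)[unfolded k2_def]])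
        fix R3 M3 k assume 3: "ready R3 M3" "\<And>a. arr N M3 7 a = 0" "kinv {..<n} E (2 * m) M3" "k3 \<le> k"
        interpret ram_bfs n m N B K I pt E L vs "arr N M3 4" "forest_of M3"
          by unfold_locales (use 3(3) in \<open>auto simp: forest_of_def kinv_def\<close>)
        have kf: "kforest E L E (forest_of M3)" using 3(3) by (simp add: kinv_def)
        show "wp B (Seq BFS OUTPUT) (\<lambda>R' M' k'. good M') R3 M3 k"
        proof (rule wp_seq, rule wp_BFS[OF 3(1) refl 3(2) 3(4)[unfolded k3_def]])
          fix R4 M4 k Rs Gs
          assume 4: "ready R4 M4" "binv (forest_of M3) {..<n} (arr N M4 8) (arr N M4 9) Rs Gs n"
            "arr N M4 8 ` {..<n} = {..<n}" "k4 \<le> k"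
          have "regs_ok n N R4" using 4(1) by (simp add: ready_def)
          then show "wp B OUTPUT (\<lambda>R' M' k'. good M') R4 M4 k"
          proof (rule wp_OUTPUT[OF _ NB n n_less_N 4(4)[unfolded k4_def]])
            fix M5 assume "M5 0 = n - 1"
              "\<And>i. i < n - 1 \<Longrightarrow> M5 (2 * i + 1) = arr N M4 8 (Suc i) \<and> M5 (2 * i + 2) = arr N M4 9 (Suc i)"
            then have F: "output_pairs (R', M5) = (\<lambda>i. {arr N M4 8 i, arr N M4 9 i}) ` {0<..<n}" for R'
              by (rule output_pairs_eq[OF n])
            show "good M5" unfolding good_def
              by (intro allI conjI binv_result[OF graph order kf 4(2,3) F])
          qed
        qed
      qed (use 2(2) zero in auto)
    qed (use zero in \<open>auto simp: I_def\<close>)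
  qed
  then obtain t R' M' where ex: "exec B ALG ((\<lambda>_. 0), M) t (R', M')" "t \<le> 15 + k1" "good M'"
    using \<open>bnd B (\<lambda>_. 0) M\<close> unfolding wp_def by blast
  have init: "init_state ws = ((\<lambda>_. 0), M)" by (simp add: M_def init_state_def)
  let ?F = "output_pairs (R', M')"
  have "tree_graph {..<n} ?F" "max_degree {..<n} ?F \<le> 3"
    "adm r {..<n} (E \<union> ?F) L \<le> 2 + 2 * col (2 * r) {..<n} E L"
    using ex(3) unfolding good_def by blast+
  moreover from this(1) have "?F \<subseteq> all_pairs {..<n}" by (simp add: tree_graph_def simple_graph_def)
  \<comment> \<open>\<open>inv_ack m \<ge> 1\<close> absorbs the terms linear in \<open>n\<close>
    and \<open>m\<close>, and \<open>n \<ge> 1\<close> the constant; 1000 leaves ample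
    slack.\<close>
  moreover have "15 + k1 \<le> 1000 * ((n + m) * inv_ack m)"
  proof -
    let ?a = "inv_ack m"
    have a: "1 \<le> ?a" by (rule inv_ack_bounds(1))
    have na: "n \<le> n * ?a" and ma: "m \<le> m * ?a" using a by simp_all
    have "15 + k1 = 29 + 22 * m + (60 * (m * ?a) + 240 * m + 120 * m) + (10 * (n * ?a) + 40 * n + 20 * n)
      + 40 * n + 80 * m + 30 * n"
      unfolding k1_def k2_def k3_def k4_def K_def by (simp add: algebra_simps)
    also have "\<dots> \<le> 1000 * (n * ?a) + 1000 * (m * ?a)" using na ma n by linarith
    finally show ?thesis by (simp add: algebra_simps)
  qed
  then have "t \<le> 1000 * ((n + card E) * inv_ack (card E))" using ex(2) unfolding mE by linarith
  moreover have "exec ((n + card E + r + 2) ^ 5) ALG (init_state ws) t (R', M')"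
    using ex(1) unfolding init B_def .
  ultimately show "\<exists>t s F. exec ((n + card E + r + 2) ^ 5) ALG (init_state ws) t s \<and> F = output_pairs s \<and>
       F \<subseteq> all_pairs {..<n} \<and> tree_graph {..<n} F \<and> max_degree {..<n} F \<le> 3 \<and>
       adm r {..<n} (E \<union> F) L \<le> 2 + 2 * col (2 * r) {..<n} E L \<and>
       t \<le> 1000 * ((n + card E) * inv_ack (card E))"
    by (intro exI[of _ t] exI[of _ "(R', M')"] exI[of _ ?F] conjI) (rule refl | assumption)+
qed

end
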